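(* Let $X\subset\Gamma$ be finite and such that the map $\mathbb N\ni n\mapsto |\underline{X}_n\setminus \underline{X}_{n-1}|$ is non-increasing. Let $R\in\mathbb N$, write $\rho:=\lfloor R/2\rfloor$, and let $\Lambda\subset\Gamma$ be finite with $\overline{X}^R\subset\Lambda$. Then for all $s,t\in[-T,T]$, $$\Big\| U_\Lambda(t,s) - \big(U_X(t,s)\otimes U_{\Lambda\setminus X}(t,s)\big)\,\tilde U_{\partial_R X}(t,s)^*\Big\| \le |\partial X|\,\|\Psi\|_\xi\,\|F\|\,|t-s|\Big[2\zeta(\rho) + |\partial X|\,\kappa\,\rho^{2D}\,\xi(\rho)\,\big(e^{v_\xi|t-s|}-1\big)\Big],$$ where $\kappa = \dfrac{G^2\|F_\xi\|}{C_\xi}$.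
   Context: Setting. $\Gamma$ is a countable set with a graph distance $d(x,y)\ge 0$ (integer-valued). $F:[0,\infty)\to(0,\infty)$ satisfies $\|F\|:=\sup_{x\in\Gamma}\sum_{y\in\Gamma}F(d(x,y))<\infty$ and $C_F:=\sup_{x,z\in\Gamma}\sum_{y\in\Gamma}\frac{F(d(x,y))F(d(y,z))}{F(d(x,z))}<\infty$. $\xi:[0,\infty)\to(0,\infty)$ is non-increasing, satisfies $\xi(a+b)\ge\xi(a)\xi(b)$ for all $a,b\ge0$, and $\lim_{r\to\infty}\xi(r)r^n=0$ for all $n\in\mathbb N$. Put $F_\xi(r):=F(r)\xi(r)$, $\|F_\xi\|:=\sup_x\sum_y F_\xi(d(x,y))$, $C_\xi:=\sup_{x,z}\sum_y\frac{F_\xi(d(x,y))F_\xi(d(y,z))}{F_\xi(d(x,z))}$ (both finite, $C_\xi\le C_F$), and $\zeta(R):=\sum_{r\in\mathbb N,\ r\ge R+1}\xi(r)$ for $R\in\mathbb N\cup\{0\}$. Each $x\in\Gamma$ carries a finite-dimensional Hilbert space $\mathcal H_x$; for finite $\Lambda$, $\mathcal H_\Lambda=\bigotimes_{x\in\Lambda}\mathcal H_x$, $\mathcal A_\Lambda=\mathcal B(\mathcal H_\Lambda)$, with $\mathcal A_\Lambda\subset\mathcal A_{\Lambda'}$ for $\Lambda\subset\Lambda'$ via tensoring with the identity, and $\mathcal H_\Lambda=\mathcal H_X\otimes\mathcal H_{\Lambda\setminus X}$ for $X\subset \Lambda$. Fix $T>0$. An interaction assigns to each finite $Z\subset\Gamma$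 and $t\in[-T,T]$ a self-adjoint $\Psi(Z,t)\in\mathcal A_Z$, continuous in $t$, with $\|\Psi\|_\xi:=\sup_{x,y\in\Gamma}\frac{1}{F_\xi(d(x,y))}\sum_{Z\ni x,y}\sup_{t\in[-T,T]}\|\Psi(Z,t)\|<\infty$. For finite $\Lambda$, $H_\Lambda(t)=\sum_{Z\subset\Lambda}\Psi(Z,t)$ and $U_\Lambda(t,s)\in\mathcal A_\Lambda$ is the unitary solution of $i\frac{d}{dt}U_\Lambda(t,s)=H_\Lambda(t)U_\Lambda(t,s)$, $U_\Lambda(s,s)=1$; $\tau_\Lambda^{t,s}(A):=U_\Lambda(t,s)^*AU_\Lambda(t,s)$. The Lieb–Robinson velocity is $v_\xi:=2\|\Psi\|_\xi C_\xi$. Known fact (Lieb–Robinson bound), usable: for finite $X,Y\subset\Lambda$, $A\in\mathcal A_X$, $B\in\mathcal A_Y$, $\|[\tau_\Lambda^{t,s}(A),B]\|\le\frac{2\|A\|\|B\|}{C_\xi}\min\big[1,g(t-s)\sum_{x\in X}\sum_{y\in Y}F_\xi(d(x,y))\big]$ with $g(r)=e^{v_\xi|r|}-1$ if $d(X,Y)>0$ and $g(r)=e^{v_\xi|r|}$ otherwise. Sets. For finite $X$: $\partial X:=\{x\in X: d(x,\Gamma\setminus X)=1\}$; for $R\in\mathbb N\cup\{0\}$, $\overline X^R:=\{x\in\Gamma:d(x,X)\le R\}$, $\underline X_R:=\{x\in\Gamma: d(x,\Gamma\setminus X)\le R\}$, $\partial_RX:=\overline X^R\cap\underline X_R$. Standing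 assumption: there are $G>0$ and $D\ge 0$ (a dimension exponent) with $|\partial_RX|\le G R^D|\partial X|$ for all finite $X\subset\Gamma$ and all $R$. Surface objects. For $R\in\mathbb N$, $\rho=\lfloor R/2\rfloor$, and finite $\Lambda\supset\overline X^R$: $M_R:=\{Y\subset\partial_{\rho}X: Y\cap X\ne\emptyset,\ Y\cap(\Lambda\setminus X)\ne\emptyset\}$, $S(R,t):=\sum_{Z\in M_R}\Psi(Z,t)$, and $\tilde U_{\partial_RX}(t,s)\in\mathcal A_{\partial_RX}$ is the unitary solution of $-i\frac{d}{dt}\tilde U_{\partial_RX}(t,s)=\tau^{t,s}_{\partial_RX}(S(R,t))\,\tilde U_{\partial_RX}(t,s)$, $\tilde U_{\partial_RX}(s,s)=1$.
   Formalization: The Hamiltonians H_Λ(t) sum Ψ(Z,t) over nonempty Z ⊂ Λ only: a scalar term Ψ(∅,t), which ‖Ψ‖_ξ does not see, would give U_Λ and U_X ⊗ U_{Λ∖X} different phases and make the bound false. *)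

theory Defs
  imports "HOL-Analysis.Analysis" "HOL-Library.Extended_Nat"
begin

text \<open>The type 'a plays the role of the countable set Gamma. d is the graph distance of a
  connected simple graph with (symmetric, irreflexive) edge relation E.\<close>

definition graph_distance :: "('a \<Rightarrow> 'a \<Rightarrow> bool) \<Rightarrow> ('a \<Rightarrow> 'a \<Rightarrow> nat) \<Rightarrow> bool" where
  "graph_distance E d \<longleftrightarrow>
     (\<forall>x y. E x y \<longleftrightarrow> E y x) \<and> (\<forall>x. \<not> E x x) \<and>
     (\<forall>x y. (\<exists>n. (E ^^ n) x y) \<and> d x y = (LEAST n. (E ^^ n) x y))"

text \<open>Distance from a point to a set (infinite for the empty set).\<close>
definition dist_set :: "('a \<Rightarrow> 'a \<Rightarrow> nat) \<Rightarrow> 'a \<Rightarrow> 'a set \<Rightarrow> enat" where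
  "dist_set d x S = (INF y\<in>S. enat (d x y))"

definition bdry :: "('a \<Rightarrow> 'a \<Rightarrow> nat) \<Rightarrow> 'a set \<Rightarrow> 'a set" where
  "bdry d X = {x\<in>X. dist_set d x (- X) = 1}"

definition outer :: "('a \<Rightarrow> 'a \<Rightarrow> nat) \<Rightarrow> 'a set \<Rightarrow> nat \<Rightarrow> 'a set" where
  "outer d X R = {x. dist_set d x X \<le> enat R}"

definition inner :: "('a \<Rightarrow> 'a \<Rightarrow> nat) \<Rightarrow> 'a set \<Rightarrow> nat \<Rightarrow> 'a set" where
  "inner d X R = {x. dist_set d x (- X) \<le> enat R}"

definition bdryR :: "('a \<Rightarrow> 'a \<Rightarrow> nat) \<Rightarrow> 'a set \<Rightarrow> nat \<Rightarrow> 'a set" where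
  "bdryR d X R = outer d X R \<inter> inner d X R"

definition Fxi :: "(real \<Rightarrow> real) \<Rightarrow> (real \<Rightarrow> real) \<Rightarrow> real \<Rightarrow> real" where
  "Fxi F \<xi> r = F r * \<xi> r"

definition normF :: "('a \<Rightarrow> 'a \<Rightarrow> nat) \<Rightarrow> (real \<Rightarrow> real) \<Rightarrow> ennreal" where
  "normF d F = (SUP x. \<Sum>\<^sub>\<infinity> y. ennreal (F (real (d x y))))"

definition constC :: "('a \<Rightarrow> 'a \<Rightarrow> nat) \<Rightarrow> (real \<Rightarrow> real) \<Rightarrow> ennreal" where
  "constC d F = (SUP x. SUP z. \<Sum>\<^sub>\<infinity> y.
      ennreal (F (real (d x y)) * F (real (d y z)) / F (real (d x z))))"

definition zeta :: "(real \<Rightarrow> real) \<Rightarrow> nat \<Rightarrow> real" where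
  "zeta \<xi> R = (\<Sum>n. \<xi> (real (n + R + 1)))"

text \<open>Power x^a for x \<ge> 0 and real a \<ge> 0 with the convention x^0 = 1 (also for x = 0).\<close>
definition rpow :: "real \<Rightarrow> real \<Rightarrow> real" where
  "rpow x a = (if a = 0 then 1 else x powr a)"

text \<open>H_x has dimension dm x with basis {0..<dm x}. A basis vector of H_Lambda is a
  configuration sigma with sigma x < dm x on Lambda and sigma x = 0 off Lambda.
  An operator on H_Lambda is given by its matrix entries on confs Lambda.\<close>

type_synonym 'a cfg = "'a \<Rightarrow> nat"
type_synonym 'a op = "'a cfg \<Rightarrow> 'a cfg \<Rightarrow> complex"

definition confs :: "('a \<Rightarrow> nat) \<Rightarrow> 'a set \<Rightarrow> 'a cfg set" where
  "confs dm \<Lambda> = {\<sigma>. \<forall>x. (x \<in> \<Lambda> \<longrightarrow> \<sigma> x < dm x) \<and> (x \<notin> \<Lambda> \<longrightarrow> \<sigma> x = 0)}"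

definition restr :: "'a set \<Rightarrow> 'a cfg \<Rightarrow> 'a cfg" where
  "restr X \<sigma> = (\<lambda>x. if x \<in> X then \<sigma> x else 0)"

definition vnorm :: "('a \<Rightarrow> nat) \<Rightarrow> 'a set \<Rightarrow> ('a cfg \<Rightarrow> complex) \<Rightarrow> real" where
  "vnorm dm \<Lambda> v = sqrt (\<Sum>\<sigma>\<in>confs dm \<Lambda>. (cmod (v \<sigma>))\<^sup>2)"

definition app :: "('a \<Rightarrow> nat) \<Rightarrow> 'a set \<Rightarrow> 'a op \<Rightarrow> ('a cfg \<Rightarrow> complex) \<Rightarrow> ('a cfg \<Rightarrow> complex)" where
  "app dm \<Lambda> A v = (\<lambda>\<sigma>. \<Sum>\<tau>\<in>confs dm \<Lambda>. A \<sigma> \<tau> * v \<tau>)"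

definition opnorm :: "('a \<Rightarrow> nat) \<Rightarrow> 'a set \<Rightarrow> 'a op \<Rightarrow> real" where
  "opnorm dm \<Lambda> A = (SUP v\<in>{v. vnorm dm \<Lambda> v \<le> 1}. vnorm dm \<Lambda> (app dm \<Lambda> A v))"

definition mmult :: "('a \<Rightarrow> nat) \<Rightarrow> 'a set \<Rightarrow> 'a op \<Rightarrow> 'a op \<Rightarrow> 'a op" where
  "mmult dm \<Lambda> A B = (\<lambda>\<sigma> \<tau>. \<Sum>\<rho>\<in>confs dm \<Lambda>. A \<sigma> \<rho> * B \<rho> \<tau>)"

definition adj :: "'a op \<Rightarrow> 'a op" where
  "adj A = (\<lambda>\<sigma> \<tau>. cnj (A \<tau> \<sigma>))"

definition idop :: "'a op" where
  "idop = (\<lambda>\<sigma> \<tau>. if \<sigma> = \<tau> then 1 else 0)"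

text \<open>Embedding A_X into A_Lambda (X \<subseteq> Lambda): A \<otimes> 1_{Lambda \ X}.\<close>
definition emb :: "'a set \<Rightarrow> 'a set \<Rightarrow> 'a op \<Rightarrow> 'a op" where
  "emb X \<Lambda> A = (\<lambda>\<sigma> \<tau>. if restr (\<Lambda> - X) \<sigma> = restr (\<Lambda> - X) \<tau>
                         then A (restr X \<sigma>) (restr X \<tau>) else 0)"

text \<open>Tensor product A \<otimes> B in A_{X \<union> Y} of A \<in> A_X, B \<in> A_Y for disjoint X, Y.\<close>
definition tens :: "'a set \<Rightarrow> 'a set \<Rightarrow> 'a op \<Rightarrow> 'a op \<Rightarrow> 'a op" where
  "tens X Y A B = (\<lambda>\<sigma> \<tau>. A (restr X \<sigma>) (restr X \<tau>) * B (restr Y \<sigma>) (restr Y \<tau>))"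

text \<open>Psi Z t is the interaction term on Z (an element of A_Z); H_Lambda(t) sums over
  nonempty Z \<subseteq> Lambda.\<close>
definition Ham :: "('a \<Rightarrow> nat) \<Rightarrow> ('a set \<Rightarrow> real \<Rightarrow> 'a op) \<Rightarrow> 'a set \<Rightarrow> real \<Rightarrow> 'a op" where
  "Ham dm \<Psi> \<Lambda> t = (\<lambda>\<sigma> \<tau>. \<Sum>Z\<in>{Z. Z \<subseteq> \<Lambda> \<and> Z \<noteq> {}}. emb Z \<Lambda> (\<Psi> Z t) \<sigma> \<tau>)"

definition normPsi :: "('a \<Rightarrow> nat) \<Rightarrow> ('a \<Rightarrow> 'a \<Rightarrow> nat) \<Rightarrow> (real \<Rightarrow> real) \<Rightarrow> (real \<Rightarrow> real) \<Rightarrow> real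
                        \<Rightarrow> ('a set \<Rightarrow> real \<Rightarrow> 'a op) \<Rightarrow> ennreal" where
  "normPsi dm d F \<xi> T \<Psi> = (SUP x. SUP y. ennreal (1 / Fxi F \<xi> (real (d x y))) *
      (\<Sum>\<^sub>\<infinity> Z\<in>{Z. finite Z \<and> x \<in> Z \<and> y \<in> Z}.
          (SUP t\<in>{-T..T}. ennreal (opnorm dm Z (\<Psi> Z t)))))"

definition solves :: "('a \<Rightarrow> nat) \<Rightarrow> 'a set \<Rightarrow> real \<Rightarrow> complex \<Rightarrow> (real \<Rightarrow> real \<Rightarrow> 'a op)
                       \<Rightarrow> (real \<Rightarrow> real \<Rightarrow> 'a op) \<Rightarrow> bool" where
  "solves dm \<Lambda> T c K U \<longleftrightarrow>
    (\<forall>s\<in>{-T..T}.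
       (\<forall>\<sigma>\<in>confs dm \<Lambda>. \<forall>\<tau>\<in>confs dm \<Lambda>. U s s \<sigma> \<tau> = idop \<sigma> \<tau>) \<and>
       (\<forall>t\<in>{-T..T}. \<forall>\<sigma>\<in>confs dm \<Lambda>. \<forall>\<tau>\<in>confs dm \<Lambda>.
          ((\<lambda>r. U r s \<sigma> \<tau>) has_vector_derivative
              (c * (\<Sum>\<rho>\<in>confs dm \<Lambda>. K t s \<sigma> \<rho> * U t s \<rho> \<tau>))) (at t within {-T..T})))"

definition heis :: "('a \<Rightarrow> nat) \<Rightarrow> 'a set \<Rightarrow> 'a op \<Rightarrow> 'a op \<Rightarrow> 'a op" where
  "heis dm \<Lambda> U A = mmult dm \<Lambda> (adj U) (mmult dm \<Lambda> A U)"

definition Mset :: "('a \<Rightarrow> 'a \<Rightarrow> nat) \<Rightarrow> 'a set \<Rightarrow> 'a set \<Rightarrow> nat \<Rightarrow> 'a set set" where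
  "Mset d X \<Lambda> R = {Y. Y \<subseteq> bdryR d X (R div 2) \<and> Y \<inter> X \<noteq> {} \<and> Y \<inter> (\<Lambda> - X) \<noteq> {}}"

definition Sop :: "('a \<Rightarrow> 'a \<Rightarrow> nat) \<Rightarrow> ('a set \<Rightarrow> real \<Rightarrow> 'a op) \<Rightarrow> 'a set \<Rightarrow> 'a set \<Rightarrow> nat
                    \<Rightarrow> real \<Rightarrow> 'a op" where
  "Sop d \<Psi> X \<Lambda> R t = (\<lambda>\<sigma> \<tau>. \<Sum>Z\<in>Mset d X \<Lambda> R. emb Z (bdryR d X R) (\<Psi> Z t) \<sigma> \<tau>)"

end

theory Submission
  imports Defs
begin

text \<open>
  With \<open>V = U\<^sub>X \<otimes> U\<^bsub>\<Lambda>-X\<^esub>\<close>, both \<open>U\<^sub>\<Lambda>\<^sup>* V\<close> and the surface evolution solve an equation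
  \<open>-\<i> dO/dt = K(t) O\<close>: the first with \<open>K\<close> the Heisenberg evolution under \<open>H\<^sub>\<Lambda>\<close> of all terms that
  couple \<open>X\<close> to its complement, the second with the evolution under the Hamiltonian of the
  \<open>R\<close>-boundary of those terms that live in the \<open>\<rho>\<close>-boundary. So the error is at most \<open>\<bar>t - s\<bar>\<close> times
  the norm of the difference of the two generators. Discarding the long-range terms costs
  \<open>2 \<zeta>(\<rho>)\<close>: such a term joins a point at depth \<open>n\<close> in \<open>X\<close> to a point at distance at least
  \<open>n + \<rho>\<close>, or a point of depth at least \<open>\<rho> + 1\<close> to the complement, and the shells of \<open>X\<close> have at most
  \<open>\<bar>\<partial>X\<bar>\<close> points. Localizing the dynamics of the remaining terms costs the second summand, by a
  Lieb--Robinson bound. For the sharp constant the commutator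
  bound must be summed over all interaction terms that reach the far region, those meeting the support
  of the observable included.
\<close>

section \<open>Finitely supported vectors and their bounded operators\<close>

text \<open>One normed algebra holds all operators, since a type cannot depend on \<Lambda>: the
  bounded operators on finitely supported functions of configurations. It is a real algebra without
  involution; hence \<i> sits inside the matrices, and the adjoint of an evolution is carried along
  as a second family.

  The sharp constant rests on a cancellation. For the commutator of an evolved observable with a
  term W, overlap of supports costs 1 and spreading costs (exp (v \<tau>) - 1) / C times the sum of
  F_\<xi> over pairs of sites, where v = 2 N C. Weighted by the norms and summed over all W that
  reach a given region, the two add up to at most N exp (v \<tau>) times the pair sum for that
  region. With the factor 2 of a commutator this is exactly the derivative of (exp (v \<tau>) - 1) /
  C times the pair sum, so the bound reproduces itself under integration.

  In \<kappa> \<rho>^(2 D), one factor G \<rho>^D |\<partial>X| counts the sites that carry the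
  surface term, the other the sites from which its evolution can spread; ||F_\<xi>|| bounds
  F_\<xi>(0) in the norm of that term.\<close>

typedef 'i fvec = "{f :: 'i \<Rightarrow> complex. finite {x. f x \<noteq> 0}}"
  morphisms coord Abs_fvec
  by (rule exI[of _ "\<lambda>_. 0"]) simp

setup_lifting type_definition_fvec

lemma finite_support [simp]: "finite {x. coord v x \<noteq> 0}"
  using coord[of v] by simp

lemma fvec_eqI: "(\<And>x. coord v x = coord w x) \<Longrightarrow> v = w"
  by (metis coord_inject ext)

instantiation fvec :: (type) real_vector
begin

lift_definition zero_fvec :: "'a fvec" is "\<lambda>_. 0" by simp
lift_definition plus_fvec :: "'a fvec \<Rightarrow> 'a fvec \<Rightarrow> 'a fvec" is "\<lambda>f g x. f x + g x"
  subgoal for f g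
    by (rule finite_subset[of _ "{x. f x \<noteq> 0} \<union> {x. g x \<noteq> 0}"]) auto
  done
lift_definition minus_fvec :: "'a fvec \<Rightarrow> 'a fvec \<Rightarrow> 'a fvec" is "\<lambda>f g x. f x - g x"
  subgoal for f g
    by (rule finite_subset[of _ "{x. f x \<noteq> 0} \<union> {x. g x \<noteq> 0}"]) auto
  done
lift_definition uminus_fvec :: "'a fvec \<Rightarrow> 'a fvec" is "\<lambda>f x. - f x" by simp
lift_definition scaleR_fvec :: "real \<Rightarrow> 'a fvec \<Rightarrow> 'a fvec" is "\<lambda>r f x. r *\<^sub>R f x"
  by (rule finite_subset[of _ "{x. _ x \<noteq> 0}", rotated]) auto

instance
  by standard (transfer; simp add: algebra_simps fun_eq_iff)+

end

lemmas coord_simps [simp] =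
  zero_fvec.rep_eq plus_fvec.rep_eq minus_fvec.rep_eq uminus_fvec.rep_eq scaleR_fvec.rep_eq

instantiation fvec :: (type) real_inner
begin

text \<open>The real part of the Hermitian product. It induces the same norm, and for complex
  matrices the adjoint with respect to it is still the conjugate transpose.\<close>

definition inner_fvec :: "'a fvec \<Rightarrow> 'a fvec \<Rightarrow> real" where
  "v \<bullet> w = (\<Sum>x | coord v x \<noteq> 0. coord v x \<bullet> coord w x)"
definition norm_fvec :: "'a fvec \<Rightarrow> real" where
  "norm (v :: 'a fvec) = sqrt (v \<bullet> v)"
definition dist_fvec :: "'a fvec \<Rightarrow> 'a fvec \<Rightarrow> real" where
  "dist (v :: 'a fvec) w = norm (v - w)"
definition sgn_fvec :: "'a fvec \<Rightarrow> 'a fvec" where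
  "sgn (v :: 'a fvec) = v /\<^sub>R norm v"
definition uniformity_fvec :: "('a fvec \<times> 'a fvec) filter" where
  "(uniformity :: ('a fvec \<times> 'a fvec) filter) = (INF e\<in>{0 <..}. principal {(x, y). dist x y < e})"
definition open_fvec :: "'a fvec set \<Rightarrow> bool" where
  "open (S :: 'a fvec set) = (\<forall>x\<in>S. \<forall>\<^sub>F (x', y) in uniformity. x' = x \<longrightarrow> y \<in> S)"

text \<open>Off the support of the left argument the summand vanishes. Over one finite set
  containing all supports, symmetry and linearity hold term by term.\<close>

lemma inner_fvec_superset:
  assumes "finite S" "{x. coord v x \<noteq> 0} \<subseteq> S"
  shows "v \<bullet> w = (\<Sum>x\<in>S. coord v x \<bullet> coord w x)"
  unfolding inner_fvec_def
  by (rule sum.mono_neutral_left) (use assms in auto)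

instance
proof
  fix x y z :: "'a fvec" and r :: real
  define S where "S = {i. coord x i \<noteq> 0} \<union> {i. coord y i \<noteq> 0} \<union> {i. coord z i \<noteq> 0}"
  have S: "finite S" "{i. coord x i \<noteq> 0} \<subseteq> S" "{i. coord y i \<noteq> 0} \<subseteq> S"
    "{i. coord (x + y) i \<noteq> 0} \<subseteq> S" "{i. coord (scaleR r x) i \<noteq> 0} \<subseteq> S"
    by (auto simp: S_def)
  note eq = inner_fvec_superset[OF S(1)]
  show "(x \<bullet> y) = (y \<bullet> x)"
    by (simp add: eq S inner_commute)
  show "((x + y) \<bullet> z) = (x \<bullet> z) + (y \<bullet> z)"
    by (simp only: eq S) (simp add: inner_add_left sum.distrib)
  show "(r *\<^sub>R x) \<bullet> y = r * (x \<bullet> y)"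
    by (simp only: eq S) (simp add: sum_distrib_left)
  show "0 \<le> (x \<bullet> x)"
    by (simp add: inner_fvec_def sum_nonneg)
  show "(x \<bullet> x) = 0 \<longleftrightarrow> x = 0"
  proof
    assume "(x \<bullet> x) = 0"
    then have "\<forall>i\<in>{i. coord x i \<noteq> 0}. coord x i \<bullet> coord x i = 0"
      unfolding inner_fvec_def by (subst (asm) sum_nonneg_eq_0_iff) auto
    then show "x = 0"
      by (auto intro!: fvec_eqI)
  qed (simp add: inner_fvec_def)
qed (simp_all add: norm_fvec_def dist_fvec_def sgn_fvec_def uniformity_fvec_def open_fvec_def)

end

lemma norm_fvec_superset:
  assumes "finite S" "{x. coord v x \<noteq> 0} \<subseteq> S"
  shows "norm v = sqrt (\<Sum>x\<in>S. (cmod (coord v x))\<^sup>2)"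
  by (simp add: norm_fvec_def inner_fvec_superset[OF assms] power2_norm_eq_inner)

text \<open>The type of bounded linear maps cannot itself be a ring, since composition requires equal domain
  and codomain; hence this copy of the endomorphisms.\<close>

typedef (overloaded) 'v bop = "UNIV :: ('v::real_normed_vector \<Rightarrow>\<^sub>L 'v) set"
  morphisms blinfun_of_bop Abs_bop by simp

setup_lifting type_definition_bop

instantiation bop :: (real_normed_vector) "{real_algebra, monoid_mult}"
begin

lift_definition zero_bop :: "'a bop" is 0 .
lift_definition one_bop :: "'a bop" is id_blinfun .
lift_definition plus_bop :: "'a bop \<Rightarrow> 'a bop \<Rightarrow> 'a bop" is "(+)" .
lift_definition minus_bop :: "'a bop \<Rightarrow> 'a bop \<Rightarrow> 'a bop" is "(-)" .
lift_definition uminus_bop :: "'a bop \<Rightarrow> 'a bop" is uminus .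
lift_definition times_bop :: "'a bop \<Rightarrow> 'a bop \<Rightarrow> 'a bop" is "(o\<^sub>L)" .
lift_definition scaleR_bop :: "real \<Rightarrow> 'a bop \<Rightarrow> 'a bop" is scaleR .
instance
  by standard (transfer; auto intro!: blinfun_eqI simp: algebra_simps blinfun.bilinear_simps)+

end

instantiation bop :: (real_normed_vector) real_normed_algebra
begin

lift_definition norm_bop :: "'a bop \<Rightarrow> real" is norm .
definition dist_bop :: "'a bop \<Rightarrow> 'a bop \<Rightarrow> real" where
  "dist (v :: 'a bop) w = norm (v - w)"
definition sgn_bop :: "'a bop \<Rightarrow> 'a bop" where
  "sgn (v :: 'a bop) = v /\<^sub>R norm v"
definition uniformity_bop :: "('a bop \<times> 'a bop) filter" where
  "(uniformity :: ('a bop \<times> 'a bop) filter) = (INF e\<in>{0 <..}. principal {(x, y). dist x y < e})"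
definition open_bop :: "'a bop set \<Rightarrow> bool" where
  "open (S :: 'a bop set) = (\<forall>x\<in>S. \<forall>\<^sub>F (x', y) in uniformity. x' = x \<longrightarrow> y \<in> S)"

instance
proof
  show "norm x = 0 \<longleftrightarrow> x = 0" for x :: "'a bop" by transfer simp
  show "norm (x + y) \<le> norm x + norm y" for x y :: "'a bop" by transfer (rule norm_triangle_ineq)
  show "norm (a *\<^sub>R x) = \<bar>a\<bar> * norm x" for a and x :: "'a bop" by transfer simp
  show "norm (x * y) \<le> norm x * norm y" for x y :: "'a bop" by transfer (rule norm_blinfun_compose)
qed (simp_all add: dist_bop_def sgn_bop_def uniformity_bop_def open_bop_def)


end


section \<open>Action on vectors, and adjoints\<close>

definition bapp :: "'v::real_normed_vector bop \<Rightarrow> 'v \<Rightarrow> 'v" where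
  "bapp x = blinfun_apply (blinfun_of_bop x)"

lemma bop_eqI: "(\<And>v. bapp x v = bapp y v) \<Longrightarrow> x = y"
  unfolding bapp_def by (metis blinfun_eqI blinfun_of_bop_inject)

lemma bapp_simps [simp]:
  "bapp 0 v = 0" "bapp 1 v = v" "bapp (x + y) v = bapp x v + bapp y v"
  "bapp (x - y) v = bapp x v - bapp y v" "bapp (- x) v = - bapp x v"
  "bapp (r *\<^sub>R x) v = r *\<^sub>R bapp x v" "bapp (x * y) v = bapp x (bapp y v)"
  by (simp_all add: bapp_def zero_bop.rep_eq one_bop.rep_eq plus_bop.rep_eq minus_bop.rep_eq
      uminus_bop.rep_eq scaleR_bop.rep_eq times_bop.rep_eq blinfun.bilinear_simps)

lemma bapp_linear [simp]:
  "bapp x 0 = 0" "bapp x (v + w) = bapp x v + bapp x w" "bapp x (v - w) = bapp x v - bapp x w"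
  "bapp x (r *\<^sub>R v) = r *\<^sub>R bapp x v"
  by (simp_all add: bapp_def blinfun.bilinear_simps)

lemma norm_bapp: "norm (bapp x v) \<le> norm x * norm v"
  by (simp add: bapp_def norm_bop.rep_eq norm_blinfun)

lemma norm_bop_bound: "0 \<le> b \<Longrightarrow> (\<And>v. norm (bapp x v) \<le> b * norm v) \<Longrightarrow> norm x \<le> b"
  by (simp add: bapp_def norm_bop.rep_eq norm_blinfun_bound)

text \<open>A relation rather than a function: the space is not complete in general, so a bounded
  operator on it may have no adjoint.\<close>

definition adjoint_pair :: "'v::real_inner bop \<Rightarrow> 'v bop \<Rightarrow> bool" where
  "adjoint_pair x y \<longleftrightarrow> (\<forall>v w. bapp x v \<bullet> w = v \<bullet> bapp y w)"

lemma adjoint_pair_sym: "adjoint_pair x y \<Longrightarrow> adjoint_pair y x"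
  unfolding adjoint_pair_def by (metis inner_commute)

lemma adjoint_pair_one: "adjoint_pair 1 1"
  by (simp add: adjoint_pair_def)

lemma adjoint_pair_add: "adjoint_pair x y \<Longrightarrow> adjoint_pair x' y' \<Longrightarrow> adjoint_pair (x + x') (y + y')"
  by (simp add: adjoint_pair_def inner_simps)

lemma adjoint_pair_diff: "adjoint_pair x y \<Longrightarrow> adjoint_pair x' y' \<Longrightarrow> adjoint_pair (x - x') (y - y')"
  by (simp add: adjoint_pair_def inner_simps)

lemma adjoint_pair_mult: "adjoint_pair x y \<Longrightarrow> adjoint_pair x' y' \<Longrightarrow> adjoint_pair (x * x') (y' * y)"
  by (simp add: adjoint_pair_def)

lemma norm_adjoint_le:
  assumes "adjoint_pair x y"
  shows "norm x \<le> norm y"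
proof (rule norm_bop_bound)
  fix v
  have "norm (bapp x v) * norm (bapp x v) = v \<bullet> bapp y (bapp x v)"
    using assms by (simp add: adjoint_pair_def power2_norm_eq_inner flip: power2_eq_square)
  also have "\<dots> \<le> norm v * norm (bapp y (bapp x v))"
    by (rule norm_cauchy_schwarz)
  also have "\<dots> \<le> norm v * (norm y * norm (bapp x v))"
    by (intro mult_left_mono norm_bapp) auto
  finally have *: "norm (bapp x v) * norm (bapp x v) \<le> (norm y * norm v) * norm (bapp x v)"
    by (simp add: algebra_simps)
  show "norm (bapp x v) \<le> norm y * norm v"
  proof (cases "norm (bapp x v) = 0")
    case False
    then have "0 < norm (bapp x v)" by simp
    with * show ?thesis by (rule mult_right_le_imp_le)
  qed simp
qed simp

lemma norm_isometry_le:
  assumes "adjoint_pair u w" "w * u = 1"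
  shows "norm u \<le> 1"
proof (rule norm_bop_bound)
  fix v
  have "bapp w (bapp u v) = v"
    using assms(2) by (metis bapp_simps(2,7))
  then have "bapp u v \<bullet> bapp u v = v \<bullet> v"
    using assms(1) by (simp add: adjoint_pair_def)
  then show "norm (bapp u v) \<le> 1 * norm v"
    by (simp add: norm_eq_sqrt_inner)
qed simp

section \<open>Matrices as operators\<close>

text \<open>Entries outside \<open>S\<close> are ignored, so any function of two indices serves as a
  matrix and equations between matrices need checking on \<open>S\<close> only.\<close>

lift_definition matvec :: "'i set \<Rightarrow> ('i \<Rightarrow> 'i \<Rightarrow> complex) \<Rightarrow> 'i fvec \<Rightarrow> 'i fvec" is
  "\<lambda>S A f \<sigma>. if finite S \<and> \<sigma> \<in> S then \<Sum>\<tau>\<in>S. A \<sigma> \<tau> * f \<tau> else 0"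
  subgoal for S A f by (cases "finite S") (auto intro: finite_subset[of _ S])
  done

definition matop :: "'i set \<Rightarrow> ('i \<Rightarrow> 'i \<Rightarrow> complex) \<Rightarrow> 'i fvec bop" where
  "matop S A = Abs_bop (Blinfun (matvec S A))"

lemma cmod_coord_le_norm: "cmod (coord v \<tau>) \<le> norm v"
proof -
  have "(cmod (coord v \<tau>))\<^sup>2 \<le> (\<Sum>x\<in>insert \<tau> {x. coord v x \<noteq> 0}. (cmod (coord v x))\<^sup>2)"
    by (rule member_le_sum) auto
  then show ?thesis
    by (subst norm_fvec_superset[of "insert \<tau> {x. coord v x \<noteq> 0}"]) (auto intro: real_le_rsqrt)
qed

lemma bounded_linear_matvec: "bounded_linear (matvec S A)"
proof (cases "finite S")
  case True
  show ?thesis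
  proof (rule bounded_linear_intro[where K = "\<Sum>\<sigma>\<in>S. \<Sum>\<tau>\<in>S. cmod (A \<sigma> \<tau>)"])
    fix x y :: "'a fvec" and r
    show "matvec S A (x + y) = matvec S A x + matvec S A y"
      by (rule fvec_eqI) (auto simp: matvec.rep_eq sum.distrib algebra_simps)
    show "matvec S A (r *\<^sub>R x) = r *\<^sub>R matvec S A x"
      by (rule fvec_eqI) (auto simp: matvec.rep_eq scaleR_sum_right)
    have "norm (matvec S A x) = L2_set (\<lambda>\<sigma>. cmod (coord (matvec S A x) \<sigma>)) S"
      unfolding L2_set_def
      by (rule norm_fvec_superset) (use True in \<open>auto simp: matvec.rep_eq\<close>)
    also have "\<dots> \<le> (\<Sum>\<sigma>\<in>S. cmod (coord (matvec S A x) \<sigma>))"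
      by (rule L2_set_le_sum) simp
    also have "\<dots> \<le> (\<Sum>\<sigma>\<in>S. \<Sum>\<tau>\<in>S. cmod (A \<sigma> \<tau>) * norm x)"
      using True
      by (auto simp: matvec.rep_eq norm_mult intro!: sum_mono order_trans[OF norm_sum] mult_left_mono cmod_coord_le_norm)
    finally show "norm (matvec S A x) \<le> norm x * (\<Sum>\<sigma>\<in>S. \<Sum>\<tau>\<in>S. cmod (A \<sigma> \<tau>))"
      by (simp add: sum_distrib_left mult.commute)
  qed
next
  case False
  then have "matvec S A = (\<lambda>_. 0)"
    by (auto intro!: ext fvec_eqI simp: matvec.rep_eq)
  then show ?thesis by simp
qed

lemma coord_matop:
  "finite S \<Longrightarrow> coord (bapp (matop S A) v) \<sigma> = (if \<sigma> \<in> S then \<Sum>\<tau>\<in>S. A \<sigma> \<tau> * coord v \<tau> else 0)"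
  by (simp add: bapp_def matop_def Abs_bop_inverse bounded_linear_Blinfun_apply
      bounded_linear_matvec matvec.rep_eq)

lemma matop_eqI:
  "finite S \<Longrightarrow> (\<And>v \<sigma>. \<sigma> \<in> S \<Longrightarrow> (\<Sum>\<tau>\<in>S. A \<sigma> \<tau> * coord v \<tau>) = coord (bapp x v) \<sigma>) \<Longrightarrow>
    (\<And>v \<sigma>. \<sigma> \<notin> S \<Longrightarrow> coord (bapp x v) \<sigma> = 0) \<Longrightarrow> matop S A = x"
  by (auto intro!: bop_eqI fvec_eqI simp: coord_matop)

lemma matop_cong:
  assumes "finite S" "\<And>\<sigma> \<tau>. \<sigma> \<in> S \<Longrightarrow> \<tau> \<in> S \<Longrightarrow> A \<sigma> \<tau> = B \<sigma> \<tau>"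
  shows "matop S A = matop S B"
  by (rule matop_eqI) (auto simp: coord_matop assms)

lemma matop_mult:
  assumes "finite S"
  shows "matop S A * matop S B = matop S (\<lambda>\<sigma> \<tau>. \<Sum>\<rho>\<in>S. A \<sigma> \<rho> * B \<rho> \<tau>)"
proof (rule matop_eqI[symmetric])
  fix v and \<sigma> assume "\<sigma> \<in> S"
  have "(\<Sum>\<tau>\<in>S. (\<Sum>\<rho>\<in>S. A \<sigma> \<rho> * B \<rho> \<tau>) * coord v \<tau>) = (\<Sum>\<rho>\<in>S. \<Sum>\<tau>\<in>S. A \<sigma> \<rho> * (B \<rho> \<tau> * coord v \<tau>))"
    by (subst sum.swap) (simp add: sum_distrib_right mult.assoc)
  then show "(\<Sum>\<tau>\<in>S. (\<Sum>\<rho>\<in>S. A \<sigma> \<rho> * B \<rho> \<tau>) * coord v \<tau>) = coord (bapp (matop S A * matop S B) v) \<sigma>"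
    using \<open>\<sigma> \<in> S\<close> assms by (simp add: coord_matop sum_distrib_left)
qed (use assms in \<open>auto simp: coord_matop\<close>)

lemma matop_add:
  "finite S \<Longrightarrow> matop S (\<lambda>\<sigma> \<tau>. A \<sigma> \<tau> + B \<sigma> \<tau>) = matop S A + matop S B"
  by (rule matop_eqI) (auto simp: coord_matop sum.distrib algebra_simps)

lemma matop_diff:
  "finite S \<Longrightarrow> matop S (\<lambda>\<sigma> \<tau>. A \<sigma> \<tau> - B \<sigma> \<tau>) = matop S A - matop S B"
  by (rule matop_eqI) (auto simp: coord_matop sum_subtractf algebra_simps)

lemma matop_uminus:
  "finite S \<Longrightarrow> matop S (\<lambda>\<sigma> \<tau>. - A \<sigma> \<tau>) = - matop S A"
  by (rule matop_eqI) (auto simp: coord_matop sum_negf)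

lemma matop_scaleR:
  "finite S \<Longrightarrow> matop S (\<lambda>\<sigma> \<tau>. r *\<^sub>R A \<sigma> \<tau>) = r *\<^sub>R matop S A"
  by (rule matop_eqI) (auto simp: coord_matop scaleR_sum_right)

lemma matop_zero: "finite S \<Longrightarrow> matop S (\<lambda>\<sigma> \<tau>. 0) = 0"
  by (rule matop_eqI) (auto simp: coord_matop)

lemma matop_sum:
  assumes "finite S"
  shows "matop S (\<lambda>\<sigma> \<tau>. \<Sum>i\<in>I. A i \<sigma> \<tau>) = (\<Sum>i\<in>I. matop S (A i))"
  by (induction I rule: infinite_finite_induct) (auto simp: matop_zero[OF assms] matop_add[OF assms])

lemma adjoint_pair_matop:
  assumes "finite S"
  shows "adjoint_pair (matop S A) (matop S (\<lambda>\<sigma> \<tau>. cnj (A \<tau> \<sigma>)))"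
  unfolding adjoint_pair_def
proof (intro allI)
  fix v w
  have *: "(a * x) \<bullet> y = (cnj a * y) \<bullet> x" for a x y :: complex
    by (simp add: inner_complex_def algebra_simps)
  have "bapp (matop S A) v \<bullet> w = (\<Sum>\<sigma>\<in>S. \<Sum>\<tau>\<in>S. (A \<sigma> \<tau> * coord v \<tau>) \<bullet> coord w \<sigma>)"
    by (subst inner_fvec_superset[OF assms])
       (auto simp: coord_matop assms inner_sum_left intro: ccontr)
  also have "\<dots> = (\<Sum>\<tau>\<in>S. \<Sum>\<sigma>\<in>S. (cnj (A \<sigma> \<tau>) * coord w \<sigma>) \<bullet> coord v \<tau>)"
    by (subst sum.swap) (intro sum.cong refl *)
  also have "\<dots> = bapp (matop S (\<lambda>\<sigma> \<tau>. cnj (A \<tau> \<sigma>))) w \<bullet> v"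
    by (subst inner_fvec_superset[OF assms])
       (auto simp: coord_matop assms inner_sum_left intro: ccontr)
  finally show "bapp (matop S A) v \<bullet> w = v \<bullet> bapp (matop S (\<lambda>\<sigma> \<tau>. cnj (A \<tau> \<sigma>))) w"
    by (simp add: inner_commute)
qed

text \<open>A finite matrix is the sum of its entries times matrix units. Placing one entry is a
  linear map on the complex numbers, a finite-dimensional real space, hence bounded; so entrywise
  derivatives are derivatives in operator norm.\<close>

lemma has_vector_derivative_matop:
  assumes S: "finite S"
    and der: "\<And>\<sigma> \<tau>. \<sigma> \<in> S \<Longrightarrow> \<tau> \<in> S \<Longrightarrow> ((\<lambda>r. A r \<sigma> \<tau>) has_vector_derivative A' \<sigma> \<tau>) (at t within I)"
  shows "((\<lambda>r. matop S (A r)) has_vector_derivative matop S A') (at t within I)"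
proof -
  define e where "e \<sigma> \<tau> z = matop S (\<lambda>a b. if a = \<sigma> \<and> b = \<tau> then z else 0)" for \<sigma> \<tau> z
  have "linear (e \<sigma> \<tau>)" for \<sigma> \<tau>
  proof (rule linearI)
    fix z w r
    show "e \<sigma> \<tau> (z + w) = e \<sigma> \<tau> z + e \<sigma> \<tau> w"
      unfolding e_def by (subst matop_add[OF S, symmetric]) (auto intro!: matop_cong[OF S])
    show "e \<sigma> \<tau> (r *\<^sub>R z) = r *\<^sub>R e \<sigma> \<tau> z"
      unfolding e_def by (subst matop_scaleR[OF S, symmetric]) (auto intro!: matop_cong[OF S])
  qed
  then have bl: "bounded_linear (e \<sigma> \<tau>)" for \<sigma> \<tau>
    by (simp add: linear_conv_bounded_linear)
  have expand: "matop S B = (\<Sum>\<sigma>\<in>S. \<Sum>\<tau>\<in>S. e \<sigma> \<tau> (B \<sigma> \<tau>))" for B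
  proof -
    have "(\<Sum>\<sigma>\<in>S. \<Sum>\<tau>\<in>S. e \<sigma> \<tau> (B \<sigma> \<tau>)) =
        matop S (\<lambda>a b. \<Sum>\<sigma>\<in>S. \<Sum>\<tau>\<in>S. if a = \<sigma> \<and> b = \<tau> then B \<sigma> \<tau> else 0)"
      by (simp add: e_def matop_sum[OF S])
    also have "\<dots> = matop S B"
    proof (rule matop_cong[OF S])
      fix a b assume ab: "a \<in> S" "b \<in> S"
      have "(\<Sum>\<sigma>\<in>S. \<Sum>\<tau>\<in>S. if a = \<sigma> \<and> b = \<tau> then B \<sigma> \<tau> else 0) =
          (\<Sum>\<sigma>\<in>S. if a = \<sigma> then (\<Sum>\<tau>\<in>S. if b = \<tau> then B \<sigma> \<tau> else 0) else 0)"
        by (rule sum.cong) (auto intro: sum.neutral)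
      then show "(\<Sum>\<sigma>\<in>S. \<Sum>\<tau>\<in>S. if a = \<sigma> \<and> b = \<tau> then B \<sigma> \<tau> else 0) = B a b"
        using ab S by simp
    qed
    finally show ?thesis by simp
  qed
  show ?thesis
    unfolding expand
    by (intro has_vector_derivative_sum bounded_linear.has_vector_derivative[OF bl] der)
qed


section \<open>Propagators in a normed algebra\<close>

text \<open>The mean value inequality along the segment from \<open>s\<close> to \<open>t\<close>,
  parametrized by the distance from \<open>s\<close>, so that one majorant serves both
  \<open>t < s\<close> and \<open>s < t\<close>.\<close>

lemma norm_le_of_deriv_le:
  fixes f :: "real \<Rightarrow> 'b::real_normed_vector"
  assumes f: "\<And>r. r \<in> {-T..T} \<Longrightarrow> (f has_vector_derivative f' r) (at r within {-T..T})"
    and \<phi>: "\<And>x. (\<phi> has_real_derivative \<phi>' x) (at x)"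
    and le: "\<And>r. r \<in> {-T..T} \<Longrightarrow> \<bar>r - s\<bar> \<le> \<bar>t - s\<bar> \<Longrightarrow> norm (f' r) \<le> \<phi>' \<bar>r - s\<bar>"
    and st: "s \<in> {-T..T}" "t \<in> {-T..T}"
  shows "norm (f t - f s) \<le> \<phi> \<bar>t - s\<bar> - \<phi> 0"
proof (cases "t = s")
  case False
  define c where "c = sgn (t - s)"
  define L where "L = \<bar>t - s\<bar>"
  have c: "\<bar>c\<bar> = 1" "s + c * L = t" using False by (auto simp: c_def L_def sgn_if)
  have L: "0 < L" using False by (simp add: L_def)
  have seg: "s + c * x \<in> {-T..T}" if "x \<in> {0..L}" for x
    using that st False by (auto simp: c_def L_def sgn_if abs_if split: if_splits)
  have D: "((\<lambda>x. f (s + c * x)) has_vector_derivative c *\<^sub>R f' (s + c * x)) (at x within {0..L})"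
    if "x \<in> {0..L}" for x
  proof -
    have "((\<lambda>x. s + c * x) has_vector_derivative c) (at x within {0..L})"
      by (auto intro!: derivative_eq_intros simp: has_real_derivative_iff_has_vector_derivative[symmetric])
    moreover have "(f has_vector_derivative f' (s + c * x)) (at (s + c * x) within (\<lambda>x. s + c * x) ` {0..L})"
      using seg that by (intro has_vector_derivative_within_subset[OF f]) auto
    ultimately show ?thesis
      using vector_diff_chain_within by (fastforce simp: o_def)
  qed
  have "norm (f (s + c * L) - f (s + c * 0)) \<le> \<phi> L - \<phi> 0"
  proof (rule differentiable_bound_general[where f = "\<lambda>x. f (s + c * x)"
      and f' = "\<lambda>x. c *\<^sub>R f' (s + c * x)" and \<phi>' = \<phi>'])
    show "continuous_on {0..L} (\<lambda>x. f (s + c * x))"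
      using D by (meson continuous_on_eq_continuous_within has_vector_derivative_continuous)
    show "continuous_on {0..L} \<phi>"
      using \<phi> by (meson DERIV_isCont continuous_at_imp_continuous_on)
    fix x assume x: "0 < x" "x < L"
    show "((\<lambda>x. f (s + c * x)) has_vector_derivative c *\<^sub>R f' (s + c * x)) (at x)"
      using D[of x] x by (simp add: at_within_Icc_at)
    show "(\<phi> has_vector_derivative \<phi>' x) (at x)"
      using \<phi> by (simp add: has_real_derivative_iff_has_vector_derivative)
    show "norm (c *\<^sub>R f' (s + c * x)) \<le> \<phi>' x"
      using le[of "s + c * x"] seg[of x] x c(1) by (simp add: abs_mult L_def)
  qed (fact L)
  then show ?thesis using c by (simp add: L_def)
qed simp

lemma vector_derivative_zero_unique:
  fixes f :: "real \<Rightarrow> 'b::real_normed_vector"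
  assumes "\<And>r. r \<in> {-T..T} \<Longrightarrow> (f has_vector_derivative 0) (at r within {-T..T})"
    and "s \<in> {-T..T}" "t \<in> {-T..T}"
  shows "f t = f s"
proof -
  obtain c where "\<And>x. x \<in> {-T..T} \<Longrightarrow> f x = c"
    using has_vector_derivative_zero_constant[OF _ assms(1)] by (metis convex_real_interval(5))
  then show ?thesis using assms by metis
qed

text \<open>The factor \<open>\<i>\<close> is absorbed into the generator: \<open>k\<close> stands for \<open>\<i>H\<close>.\<close>

definition propagator ::
  "real \<Rightarrow> (real \<Rightarrow> 'b::{real_normed_algebra, monoid_mult}) \<Rightarrow> (real \<Rightarrow> real \<Rightarrow> 'b) \<Rightarrow> (real \<Rightarrow> real \<Rightarrow> 'b) \<Rightarrow> bool"
  where "propagator T k u w \<longleftrightarrow> (\<forall>s\<in>{-T..T}. u s s = 1 \<and> w s s = 1 \<and> (\<forall>t\<in>{-T..T}.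
    norm (u t s) \<le> 1 \<and>
    ((\<lambda>r. u r s) has_vector_derivative - (k t * u t s)) (at t within {-T..T}) \<and>
    ((\<lambda>r. w r s) has_vector_derivative w t s * k t) (at t within {-T..T})))"

context
  fixes T :: real and k :: "real \<Rightarrow> 'b::{real_normed_algebra, monoid_mult}" and u w
  assumes is_propagator: "propagator T k u w"
begin

lemma propagator_refl [simp]: "s \<in> {-T..T} \<Longrightarrow> u s s = 1" "s \<in> {-T..T} \<Longrightarrow> w s s = 1"
  using is_propagator by (auto simp: propagator_def)

lemma propagator_deriv:
  assumes "t \<in> {-T..T}" "s \<in> {-T..T}"
  shows "((\<lambda>r. u r s) has_vector_derivative - (k t * u t s)) (at t within {-T..T})"
    and "((\<lambda>r. w r s) has_vector_derivative w t s * k t) (at t within {-T..T})"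
  using is_propagator assms by (auto simp: propagator_def)

text \<open>In the derivative with respect to \<open>t\<close> the two generators meet in the middle
  and cancel, so the product keeps its value at \<open>t = r\<close>. Inverses and time reversal are
  special cases, without a uniqueness theorem for the equation.\<close>

lemma propagator_cocycle:
  assumes "r \<in> {-T..T}" "s \<in> {-T..T}" "t \<in> {-T..T}"
  shows "w t r * u t s = u r s"
proof -
  have "w t r * u t s = w r r * u r s"
  proof (rule vector_derivative_zero_unique[of T "\<lambda>x. w x r * u x s"])
    fix x assume x: "x \<in> {-T..T}"
    show "((\<lambda>x. w x r * u x s) has_vector_derivative 0) (at x within {-T..T})"
      using has_vector_derivative_mult[OF propagator_deriv(2)[OF x assms(1)] propagator_deriv(1)[OF x assms(2)]]
      by (simp add: mult.assoc)
  qed (use assms in auto)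
  then show ?thesis using assms by simp
qed

lemma propagator_swap: "s \<in> {-T..T} \<Longrightarrow> t \<in> {-T..T} \<Longrightarrow> w t s = u s t"
  using propagator_cocycle[of s t t] by simp

text \<open>A left inverse need not be a right inverse in this algebra; the second identity is the
  first one with the two times exchanged.\<close>

lemma propagator_inverse:
  assumes "s \<in> {-T..T}" "t \<in> {-T..T}"
  shows "w t s * u t s = 1" "u t s * w t s = 1"
  using propagator_cocycle[of s s t] propagator_cocycle[of t t s] assms
  by (simp_all add: propagator_swap)

lemma propagator_norm:
  assumes "s \<in> {-T..T}" "t \<in> {-T..T}"
  shows "norm (u t s) \<le> 1" "norm (w t s) \<le> 1"
  using is_propagator assms by (auto simp: propagator_def propagator_swap)

lemma norm_conjugate_le:
  assumes "s \<in> {-T..T}" "t \<in> {-T..T}"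
  shows "norm (w t s * a * u t s) \<le> norm a" "norm (u t s * a * w t s) \<le> norm a"
proof -
  have *: "norm (x * a * y) \<le> norm a" if "norm x \<le> 1" "norm y \<le> 1" for x y
  proof -
    have "norm (x * a * y) \<le> norm x * norm a * norm y"
      by (meson norm_mult_ineq norm_ge_zero mult_right_mono order_trans)
    also have "\<dots> \<le> 1 * norm a * 1"
      using that by (intro mult_mono) auto
    finally show ?thesis by simp
  qed
  show "norm (w t s * a * u t s) \<le> norm a" "norm (u t s * a * w t s) \<le> norm a"
    using propagator_norm[OF assms] by (auto intro!: *)
qed

end


section \<open>The Lieb--Robinson bound\<close>

definition comm :: "'b::ring \<Rightarrow> 'b \<Rightarrow> 'b" where
  "comm x y = x * y - y * x"

lemma norm_comm_le: "norm (comm x y) \<le> 2 * norm x * norm (y :: 'b::real_normed_algebra)"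
proof -
  have "norm (comm x y) \<le> norm (x * y) + norm (y * x)"
    unfolding comm_def by (rule norm_triangle_ineq4)
  also have "\<dots> \<le> norm x * norm y + norm y * norm x"
    by (intro add_mono norm_mult_ineq)
  finally show ?thesis by simp
qed

lemma comm_swap: "comm x y = - comm y x"
  by (simp add: comm_def)

lemma comm_sum_left: "comm (\<Sum>i\<in>I. f i) y = (\<Sum>i\<in>I. comm (f i) y)"
  by (simp add: comm_def sum_distrib_left sum_distrib_right sum_subtractf)

text \<open>\<open>loc Z\<close> stands for the algebra of the region \<open>Z\<close>,
  \<open>p Z\<close> for the supremum over time of the norm of its interaction term,
  \<open>f\<close> for F_\<xi> of the distance, \<open>N\<close> for the interaction norm and
  \<open>C\<close> for C_\<xi>. Thus \<open>2 * N * C\<close> is the Lieb--Robinson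
  velocity.\<close>

locale local_dynamics =
  fixes \<Lambda> :: "'a set" and T :: real
    and loc :: "'a set \<Rightarrow> 'b::{real_normed_algebra, monoid_mult} set"
    and \<psi> :: "'a set \<Rightarrow> real \<Rightarrow> 'b" and p :: "'a set \<Rightarrow> real"
    and u w :: "'a set \<Rightarrow> real \<Rightarrow> real \<Rightarrow> 'b"
    and f :: "'a \<Rightarrow> 'a \<Rightarrow> real" and N C :: real
  assumes finite_\<Lambda>: "finite \<Lambda>"
    and loc_commute: "Z \<subseteq> \<Lambda> \<Longrightarrow> W \<subseteq> \<Lambda> \<Longrightarrow> Z \<inter> W = {} \<Longrightarrow> A \<in> loc Z \<Longrightarrow> B \<in> loc W \<Longrightarrow> A * B = B * A"
    and \<psi>_loc: "Z \<subseteq> \<Lambda> \<Longrightarrow> Z \<noteq> {} \<Longrightarrow> \<psi> Z r \<in> loc Z"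
    and \<psi>_norm: "Z \<subseteq> \<Lambda> \<Longrightarrow> Z \<noteq> {} \<Longrightarrow> r \<in> {-T..T} \<Longrightarrow> norm (\<psi> Z r) \<le> p Z"
    and p_nonneg: "0 \<le> p Z"
    and prop_u: "Y \<subseteq> \<Lambda> \<Longrightarrow> propagator T (\<lambda>r. \<Sum>Z\<in>{Z. Z \<subseteq> Y \<and> Z \<noteq> {}}. \<psi> Z r) (u Y) (w Y)"
    and f_nonneg: "0 \<le> f x y"
    and N_nonneg: "0 \<le> N" and C_pos: "0 < C"
    and p_sum: "x \<in> \<Lambda> \<Longrightarrow> y \<in> \<Lambda> \<Longrightarrow> (\<Sum>Z\<in>{Z. Z \<subseteq> \<Lambda> \<and> x \<in> Z \<and> y \<in> Z}. p Z) \<le> N * f x y"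
    and f_conv: "x \<in> \<Lambda> \<Longrightarrow> z \<in> \<Lambda> \<Longrightarrow> (\<Sum>y\<in>\<Lambda>. f x y * f y z) \<le> C * f x z"
begin

definition gen :: "'a set \<Rightarrow> real \<Rightarrow> 'b" where
  "gen Y r = (\<Sum>Z\<in>{Z. Z \<subseteq> Y \<and> Z \<noteq> {}}. \<psi> Z r)"

definition inter_sum :: "'a set \<Rightarrow> 'a set \<Rightarrow> real" where
  "inter_sum P Q = (\<Sum>x\<in>P. \<Sum>y\<in>Q. f x y)"

text \<open>The Lieb--Robinson majorant at time \<open>\<tau>\<close> for observables on \<open>P\<close> and \<open>W\<close>; the indicator is the
  contribution of overlapping supports, which a bound with \<open>exp\<close> alone would overestimate.\<close>

definition env :: "'a set \<Rightarrow> real \<Rightarrow> 'a set \<Rightarrow> real" where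
  "env P \<tau> W = of_bool (W \<inter> P \<noteq> {}) + (exp (2 * N * C * \<tau>) - 1) / C * inter_sum P W"

lemma prop_gen: "Y \<subseteq> \<Lambda> \<Longrightarrow> propagator T (gen Y) (u Y) (w Y)"
  using prop_u by (simp add: gen_def[abs_def])

lemma inter_sum_nonneg: "0 \<le> inter_sum P Q"
  by (simp add: inter_sum_def sum_nonneg f_nonneg)

lemma exp_factor_nonneg: "0 \<le> \<tau> \<Longrightarrow> 0 \<le> (exp (2 * N * C * \<tau>) - 1) / C"
  using N_nonneg C_pos by simp

lemma env_nonneg: "0 \<le> \<tau> \<Longrightarrow> 0 \<le> env P \<tau> W"
  unfolding env_def by (intro add_nonneg_nonneg mult_nonneg_nonneg exp_factor_nonneg inter_sum_nonneg) auto

lemma finite_subsets [simp]: "Y \<subseteq> \<Lambda> \<Longrightarrow> finite {Z. Z \<subseteq> Y \<and> Q Z}"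
  using finite_\<Lambda> by (auto intro: finite_subset[of _ "Pow \<Lambda>"])

text \<open>The overlap indicator is at most the number of points of \<open>P\<close> in
  \<open>W\<close> and contributes \<open>N\<close>. In the other summand the convolution bound
  produces a \<open>C\<close> that cancels the denominator, leaving \<open>N\<close> times the
  exponential minus 1. The two add up to \<open>N\<close> times a pure exponential.\<close>

lemma sum_env_at_site_le:
  assumes "P \<subseteq> \<Lambda>" "y \<in> \<Lambda>" "0 \<le> \<tau>"
  shows "(\<Sum>W\<in>{W. W \<subseteq> \<Lambda> \<and> y \<in> W}. p W * env P \<tau> W) \<le> N * exp (2 * N * C * \<tau>) * (\<Sum>x\<in>P. f x y)"
proof -
  let ?\<W> = "{W. W \<subseteq> \<Lambda> \<and> y \<in> W}"
  let ?c = "(exp (2 * N * C * \<tau>) - 1) / C"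
  have finP: "finite P" using assms finite_\<Lambda> finite_subset by blast
  have through: "(\<Sum>W\<in>?\<W>. p W * of_bool (x \<in> W)) \<le> N * f x y" if "x \<in> \<Lambda>" for x
  proof -
    have "(\<Sum>W\<in>?\<W>. p W * of_bool (x \<in> W)) = (\<Sum>W\<in>{W. W \<subseteq> \<Lambda> \<and> x \<in> W \<and> y \<in> W}. p W)"
      by (rule sum.mono_neutral_cong_right) auto
    then show ?thesis using p_sum[OF that assms(2)] by simp
  qed
  have "of_bool (W \<inter> P \<noteq> {}) \<le> (\<Sum>x\<in>P. of_bool (x \<in> W) :: real)" for W
  proof (cases "W \<inter> P = {}")
    case False
    then obtain x where x: "x \<in> W" "x \<in> P" by auto
    then have "of_bool (x \<in> W) \<le> (\<Sum>x\<in>P. of_bool (x \<in> W) :: real)"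
      by (intro member_le_sum) (auto simp: finP)
    then show ?thesis using x False by simp
  qed (simp add: sum_nonneg)
  then have "(\<Sum>W\<in>?\<W>. p W * of_bool (W \<inter> P \<noteq> {})) \<le> (\<Sum>W\<in>?\<W>. p W * (\<Sum>x\<in>P. of_bool (x \<in> W)))"
    by (intro sum_mono mult_left_mono p_nonneg)
  also have "\<dots> = (\<Sum>x\<in>P. \<Sum>W\<in>?\<W>. p W * of_bool (x \<in> W))"
    unfolding sum_distrib_left by (rule sum.swap)
  also have "\<dots> \<le> (\<Sum>x\<in>P. N * f x y)"
    using assms by (intro sum_mono through) auto
  finally have 1: "(\<Sum>W\<in>?\<W>. p W * of_bool (W \<inter> P \<noteq> {})) \<le> N * (\<Sum>x\<in>P. f x y)"
    by (simp add: sum_distrib_left)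
  have "inter_sum P W = (\<Sum>x\<in>P. \<Sum>z\<in>\<Lambda>. f x z * of_bool (z \<in> W))" if "W \<subseteq> \<Lambda>" for W
    unfolding inter_sum_def
    by (intro sum.cong refl sum.mono_neutral_cong_left) (use that finite_\<Lambda> in auto)
  then have "(\<Sum>W\<in>?\<W>. p W * inter_sum P W)
      = (\<Sum>W\<in>?\<W>. \<Sum>x\<in>P. \<Sum>z\<in>\<Lambda>. f x z * (p W * of_bool (z \<in> W)))"
    by (auto simp: sum_distrib_left algebra_simps intro!: sum.cong)
  also have "\<dots> = (\<Sum>x\<in>P. \<Sum>W\<in>?\<W>. \<Sum>z\<in>\<Lambda>. f x z * (p W * of_bool (z \<in> W)))"
    by (rule sum.swap)
  also have "\<dots> = (\<Sum>x\<in>P. \<Sum>z\<in>\<Lambda>. f x z * (\<Sum>W\<in>?\<W>. p W * of_bool (z \<in> W)))"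
    unfolding sum_distrib_left by (intro sum.cong refl sum.swap)
  also have "\<dots> \<le> (\<Sum>x\<in>P. \<Sum>z\<in>\<Lambda>. f x z * (N * f z y))"
    by (intro sum_mono mult_left_mono through f_nonneg)
  also have "\<dots> = (\<Sum>x\<in>P. N * (\<Sum>z\<in>\<Lambda>. f x z * f z y))"
    by (simp add: sum_distrib_left algebra_simps)
  also have "\<dots> \<le> (\<Sum>x\<in>P. N * (C * f x y))"
    using assms by (intro sum_mono mult_left_mono f_conv N_nonneg) auto
  finally have 2: "(\<Sum>W\<in>?\<W>. p W * inter_sum P W) \<le> N * C * (\<Sum>x\<in>P. f x y)"
    by (simp add: sum_distrib_left algebra_simps)
  have "(\<Sum>W\<in>?\<W>. p W * env P \<tau> W)
      = (\<Sum>W\<in>?\<W>. p W * of_bool (W \<inter> P \<noteq> {})) + ?c * (\<Sum>W\<in>?\<W>. p W * inter_sum P W)"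
    unfolding env_def sum_distrib_left sum.distrib[symmetric] by (intro sum.cong refl) (simp only: algebra_simps)
  also have "\<dots> \<le> N * (\<Sum>x\<in>P. f x y) + ?c * (N * C * (\<Sum>x\<in>P. f x y))"
    by (intro add_mono mult_left_mono 1 2 exp_factor_nonneg assms)
  also have "\<dots> = N * exp (2 * N * C * \<tau>) * (\<Sum>x\<in>P. f x y)"
    using C_pos by (simp add: field_simps)
  finally show ?thesis .
qed

text \<open>Each \<open>W\<close> is charged to a site of \<open>Q\<close> that it contains. Twice
  the right-hand side is the derivative in \<tau> of the second summand of
  \<open>env P \<tau> Q\<close>; this is what makes \<open>env\<close> a supersolution.\<close>

lemma sum_env_le:
  assumes "P \<subseteq> \<Lambda>" "Q \<subseteq> \<Lambda>" "0 \<le> \<tau>"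
    and \<W>: "\<And>W. W \<in> \<W> \<Longrightarrow> W \<subseteq> \<Lambda> \<and> W \<inter> Q \<noteq> {}"
  shows "(\<Sum>W\<in>\<W>. p W * env P \<tau> W) \<le> N * exp (2 * N * C * \<tau>) * inter_sum P Q"
proof -
  have "\<W> \<subseteq> Pow \<Lambda>" using \<W> by auto
  then have fin: "finite Q" "finite \<W>"
    using assms(2) finite_\<Lambda> by (auto intro: finite_subset)
  have nn: "0 \<le> p W * env P \<tau> W" for W
    by (intro mult_nonneg_nonneg p_nonneg env_nonneg assms)
  have "(\<Sum>W\<in>\<W>. p W * env P \<tau> W) \<le> (\<Sum>W\<in>\<W>. \<Sum>y\<in>Q. of_bool (y \<in> W) * (p W * env P \<tau> W))"
  proof (rule sum_mono)
    fix W assume "W \<in> \<W>"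
    then obtain y where y: "y \<in> Q" "y \<in> W" using \<W> by blast
    then have "of_bool (y \<in> W) * (p W * env P \<tau> W) \<le> (\<Sum>y\<in>Q. of_bool (y \<in> W) * (p W * env P \<tau> W))"
      by (intro member_le_sum fin mult_nonneg_nonneg nn) auto
    then show "p W * env P \<tau> W \<le> (\<Sum>y\<in>Q. of_bool (y \<in> W) * (p W * env P \<tau> W))"
      using y by simp
  qed
  also have "\<dots> = (\<Sum>y\<in>Q. \<Sum>W\<in>\<W>. of_bool (y \<in> W) * (p W * env P \<tau> W))"
    by (rule sum.swap)
  also have "\<dots> \<le> (\<Sum>y\<in>Q. \<Sum>W\<in>{W. W \<subseteq> \<Lambda> \<and> y \<in> W}. p W * env P \<tau> W)"
  proof (rule sum_mono)
    fix y
    have "(\<Sum>W\<in>\<W>. of_bool (y \<in> W) * (p W * env P \<tau> W)) = (\<Sum>W\<in>{W\<in>\<W>. y \<in> W}. p W * env P \<tau> W)"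
      using fin by (intro sum.mono_neutral_cong_right) auto
    also have "\<dots> \<le> (\<Sum>W\<in>{W. W \<subseteq> \<Lambda> \<and> y \<in> W}. p W * env P \<tau> W)"
      using \<W> by (intro sum_mono2 nn) auto
    finally show "(\<Sum>W\<in>\<W>. of_bool (y \<in> W) * (p W * env P \<tau> W)) \<le> \<dots>" .
  qed
  also have "\<dots> \<le> (\<Sum>y\<in>Q. N * exp (2 * N * C * \<tau>) * (\<Sum>x\<in>P. f x y))"
    using assms by (intro sum_mono sum_env_at_site_le) auto
  also have "\<dots> = N * exp (2 * N * C * \<tau>) * inter_sum P Q"
    unfolding inter_sum_def sum_distrib_left by (rule sum.swap)
  finally show ?thesis .
qed

lemma gen_split:
  assumes "Y \<subseteq> \<Lambda>"
  shows "gen Y r = gen (Y - Z) r + (\<Sum>W\<in>{W. W \<subseteq> Y \<and> W \<inter> Z \<noteq> {}}. \<psi> W r)"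
proof -
  have "{W. W \<subseteq> Y \<and> W \<noteq> {}} = {W. W \<subseteq> Y - Z \<and> W \<noteq> {}} \<union> {W. W \<subseteq> Y \<and> W \<inter> Z \<noteq> {}}"
    by auto
  moreover have "finite {W. W \<subseteq> Y - Z \<and> W \<noteq> {}}" "finite {W. W \<subseteq> Y \<and> W \<inter> Z \<noteq> {}}"
    using assms by (auto intro: finite_subsets)
  moreover have "{W. W \<subseteq> Y - Z \<and> W \<noteq> {}} \<inter> {W. W \<subseteq> Y \<and> W \<inter> Z \<noteq> {}} = {}"
    by auto
  ultimately show ?thesis
    by (simp add: gen_def sum.union_disjoint)
qed

text \<open>Iterating the integral inequality for the commutators, with \<open>env\<close> as a supersolution:
  the remainder of the trivial bound after \<open>n\<close> steps is \<open>(K \<tau>)\<^sup>n / n!\<close>.\<close>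

lemma lieb_robinson_iterate:
  fixes \<alpha> :: "real \<Rightarrow> 'b" and A :: 'b
  defines "K \<equiv> 2 * (\<Sum>W\<in>{W. W \<subseteq> \<Lambda>}. p W)"
  assumes Y: "Y \<subseteq> \<Lambda>" and P: "P \<subseteq> \<Lambda>" and A: "A \<in> loc P" and t: "t \<in> {-T..T}"
    and \<alpha>_t: "\<alpha> t = A" and \<alpha>_norm: "\<And>r. r \<in> {-T..T} \<Longrightarrow> norm (\<alpha> r) \<le> norm A"
    and \<alpha>_deriv: "\<And>r. r \<in> {-T..T} \<Longrightarrow> (\<alpha> has_vector_derivative - comm (gen Y r) (\<alpha> r)) (at r within {-T..T})"
  assumes "Z \<subseteq> \<Lambda>" "B \<in> loc Z" "r \<in> {-T..T}"
  shows "norm (comm (\<alpha> r) B) \<le> 2 * norm A * norm B * (env P \<bar>r - t\<bar> Z + (K * \<bar>r - t\<bar>) ^ n / fact n)"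
  using assms(9-)
proof (induction n arbitrary: Z B r)
  case 0
  have "norm (comm (\<alpha> r) B) \<le> 2 * norm (\<alpha> r) * norm B"
    by (rule norm_comm_le)
  also have "\<dots> \<le> 2 * norm A * norm B * 1"
    using \<alpha>_norm[OF 0(3)] by (auto intro!: mult_right_mono)
  also have "\<dots> \<le> 2 * norm A * norm B * (env P \<bar>r - t\<bar> Z + 1)"
    using env_nonneg[of "\<bar>r - t\<bar>" P Z] by (intro mult_left_mono) auto
  finally show ?case by simp
next
  case (Suc n)
  have K: "0 \<le> K" by (simp add: K_def sum_nonneg p_nonneg)
  let ?k = "gen (Y - Z)"
  let ?\<W> = "{W. W \<subseteq> Y \<and> W \<inter> Z \<noteq> {}}"
  let ?q = "\<lambda>r. \<Sum>W\<in>?\<W>. \<psi> W r"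
  note pr = prop_gen[of "Y - Z"]
  have YZ: "Y - Z \<subseteq> \<Lambda>" using Y by auto
  \<comment> \<open>Interaction picture: the terms of \<open>Y\<close> that miss \<open>Z\<close>
    commute with \<open>B\<close>, so conjugation by their dynamics removes them from the derivative
    without changing norms. Only terms meeting \<open>Z\<close> remain.\<close>
  define m where "m r = w (Y - Z) r t * comm (\<alpha> r) B * u (Y - Z) r t" for r
  define m' where "m' r = w (Y - Z) r t * (- comm (comm (?q r) (\<alpha> r)) B) * u (Y - Z) r t" for r
  \<comment> \<open>The majorant for step \<open>n + 1\<close> without the overlap indicator; the
    latter enters as the value at \<open>r = t\<close>, where the commutator vanishes for disjoint
    supports.\<close>
  define \<phi> where "\<phi> x = 2 * norm A * norm B * ((exp (2 * N * C * x) - 1) / C * inter_sum P Z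
      + (K * x) ^ Suc n / fact (Suc n))" for x
  define \<phi>' where "\<phi>' x = 2 * norm A * norm B * (2 * N * exp (2 * N * C * x) * inter_sum P Z
      + K * ((K * x) ^ n / fact n))" for x
  have comm_k: "?k r * B = B * ?k r" for r
    unfolding gen_def sum_distrib_left sum_distrib_right
  proof (intro sum.cong refl)
    fix W assume W: "W \<in> {W. W \<subseteq> Y - Z \<and> W \<noteq> {}}"
    then have "W \<subseteq> \<Lambda>" "W \<noteq> {}" "W \<inter> Z = {}" using Y by auto
    then show "\<psi> W r * B = B * \<psi> W r"
      using loc_commute \<psi>_loc Suc.prems by metis
  qed
  then have comm_k': "?k r * (B * x) = B * (?k r * x)" for r x
    by (metis mult.assoc)
  have m_deriv: "(m has_vector_derivative m' r) (at r within {-T..T})" if r: "r \<in> {-T..T}" for r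
  proof -
    have c: "((\<lambda>r. comm (\<alpha> r) B) has_vector_derivative
        (- comm (gen Y r) (\<alpha> r)) * B - B * (- comm (gen Y r) (\<alpha> r))) (at r within {-T..T})"
      unfolding comm_def[of "\<alpha> _"]
      by (intro has_vector_derivative_diff has_vector_derivative_mult_left has_vector_derivative_mult_right \<alpha>_deriv r)
    have "(m has_vector_derivative
       w (Y - Z) r t * comm (\<alpha> r) B * - (?k r * u (Y - Z) r t)
       + (w (Y - Z) r t * ((- comm (gen Y r) (\<alpha> r)) * B - B * (- comm (gen Y r) (\<alpha> r)))
          + w (Y - Z) r t * ?k r * comm (\<alpha> r) B) * u (Y - Z) r t) (at r within {-T..T})"
      unfolding m_def
      by (intro has_vector_derivative_mult propagator_deriv[OF pr] c YZ r t)
    also have "w (Y - Z) r t * comm (\<alpha> r) B * - (?k r * u (Y - Z) r t)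
       + (w (Y - Z) r t * ((- comm (gen Y r) (\<alpha> r)) * B - B * (- comm (gen Y r) (\<alpha> r)))
          + w (Y - Z) r t * ?k r * comm (\<alpha> r) B) * u (Y - Z) r t = m' r"
      unfolding m'_def gen_split[OF Y, of r Z] comm_def
      by (simp add: algebra_simps comm_k comm_k')
    finally show ?thesis .
  qed
  have \<phi>_deriv: "(\<phi> has_real_derivative \<phi>' x) (at x)" for x
  proof -
    have f: "fact (Suc n) = (1 + real n) * fact n" by simp
    have "((\<lambda>x. (K * x) ^ Suc n) has_real_derivative (1 + real n) * (K * (K * x) ^ n)) (at x)"
      by (intro DERIV_power_Suc DERIV_cmult_Id)
    then have "((\<lambda>x. (K * x) ^ Suc n / fact (Suc n)) has_real_derivative
        (1 + real n) * (K * (K * x) ^ n) / fact (Suc n)) (at x)"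
      by (rule DERIV_cdivide)
    moreover have "(1 + real n) * (K * (K * x) ^ n) / fact (Suc n) = K * ((K * x) ^ n / fact n)"
      unfolding f by (subst mult_divide_mult_cancel_left) auto
    ultimately have 1: "((\<lambda>x. (K * x) ^ Suc n / fact (Suc n)) has_real_derivative K * ((K * x) ^ n / fact n)) (at x)" by metis
    have "((\<lambda>x. (exp (2 * N * C * x) - 1) / C * inter_sum P Z) has_real_derivative
        2 * N * exp (2 * N * C * x) * inter_sum P Z) (at x)"
      using C_pos by (auto intro!: derivative_eq_intros)
    then show ?thesis using 1
      unfolding \<phi>_def \<phi>'_def
      by (intro DERIV_cmult DERIV_add) 
  qed
  have "norm (m' r) \<le> \<phi>' \<bar>r - t\<bar>" if r: "r \<in> {-T..T}" for r
  proof -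
    have "norm (comm (?q r) (\<alpha> r)) \<le> (\<Sum>W\<in>?\<W>. norm (comm (\<psi> W r) (\<alpha> r)))"
      unfolding comm_sum_left by (rule norm_sum)
    also have "\<dots> \<le> (\<Sum>W\<in>?\<W>. 2 * norm A * p W * (env P \<bar>r - t\<bar> W + (K * \<bar>r - t\<bar>) ^ n / fact n))"
    proof (rule sum_mono)
      fix W assume "W \<in> ?\<W>"
      then have W: "W \<subseteq> \<Lambda>" "W \<noteq> {}" using Y by auto
      have "norm (comm (\<psi> W r) (\<alpha> r)) = norm (comm (\<alpha> r) (\<psi> W r))"
        by (metis comm_swap norm_minus_cancel)
      also have "\<dots> \<le> 2 * norm A * norm (\<psi> W r) * (env P \<bar>r - t\<bar> W + (K * \<bar>r - t\<bar>) ^ n / fact n)"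
        by (intro Suc.IH \<psi>_loc W r)
      also have "\<dots> \<le> 2 * norm A * p W * (env P \<bar>r - t\<bar> W + (K * \<bar>r - t\<bar>) ^ n / fact n)"
        using K by (intro mult_right_mono mult_left_mono \<psi>_norm W r add_nonneg_nonneg env_nonneg) auto
      finally show "norm (comm (\<psi> W r) (\<alpha> r)) \<le> \<dots>" .
    qed
    also have "\<dots> = 2 * norm A * ((\<Sum>W\<in>?\<W>. p W * env P \<bar>r - t\<bar> W)
        + (\<Sum>W\<in>?\<W>. p W) * ((K * \<bar>r - t\<bar>) ^ n / fact n))"
      unfolding sum_distrib_left sum_distrib_right sum.distrib[symmetric]
      by (intro sum.cong refl) (simp only: algebra_simps)
    \<comment> \<open>\<open>K\<close> already contains the factor 2 of the outer commutator with
      \<open>B\<close>, which is still to come; hence half of it here.\<close>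
    also have "\<dots> \<le> 2 * norm A * (N * exp (2 * N * C * \<bar>r - t\<bar>) * inter_sum P Z
        + K / 2 * ((K * \<bar>r - t\<bar>) ^ n / fact n))"
    proof (intro mult_left_mono add_mono mult_right_mono)
      show "(\<Sum>W\<in>?\<W>. p W * env P \<bar>r - t\<bar> W) \<le> N * exp (2 * N * C * \<bar>r - t\<bar>) * inter_sum P Z"
        using P Suc.prems Y by (intro sum_env_le) auto
      have "(\<Sum>W\<in>?\<W>. p W) \<le> (\<Sum>W\<in>{W. W \<subseteq> \<Lambda>}. p W)"
        using Y finite_\<Lambda> by (intro sum_mono2 p_nonneg) auto
      then show "(\<Sum>W\<in>?\<W>. p W) \<le> K / 2" by (simp add: K_def)
    qed (use K in auto)
    finally have q: "norm (comm (?q r) (\<alpha> r)) \<le> \<dots>" .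
    have "norm (m' r) \<le> norm (comm (comm (?q r) (\<alpha> r)) B)"
      unfolding m'_def by (rule order_trans[OF norm_conjugate_le(1)[OF pr, OF YZ t r]]) simp
    also have "\<dots> \<le> 2 * norm (comm (?q r) (\<alpha> r)) * norm B"
      by (rule norm_comm_le)
    also have "\<dots> \<le> 2 * (2 * norm A * (N * exp (2 * N * C * \<bar>r - t\<bar>) * inter_sum P Z
        + K / 2 * ((K * \<bar>r - t\<bar>) ^ n / fact n))) * norm B"
      by (intro mult_right_mono mult_left_mono q) auto
    also have "\<dots> = \<phi>' \<bar>r - t\<bar>"
      by (simp add: \<phi>'_def field_simps)
    finally show ?thesis .
  qed
  then have "norm (m r - m t) \<le> \<phi> \<bar>r - t\<bar> - \<phi> 0"
    by (intro norm_le_of_deriv_le[OF m_deriv \<phi>_deriv] t Suc.prems) auto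
  moreover have "norm (comm (\<alpha> r) B) \<le> norm (m r)"
  proof -
    have "comm (\<alpha> r) B = u (Y - Z) r t * m r * w (Y - Z) r t"
      unfolding m_def using propagator_inverse[OF pr, OF YZ t Suc.prems(3)]
      by (simp add: mult.assoc) (simp add: mult.assoc[symmetric])
    then show ?thesis by (simp only: norm_conjugate_le(2)[OF pr, OF YZ t Suc.prems(3)])
  qed
  moreover have "norm (m t) \<le> 2 * norm A * norm B * of_bool (Z \<inter> P \<noteq> {})"
  proof (cases "Z \<inter> P = {}")
    case True
    then have "comm A B = 0"
      using loc_commute[OF P Suc.prems(1) _ A Suc.prems(2)] by (auto simp: comm_def)
    then show ?thesis using True t by (simp add: m_def \<alpha>_t)
  next
    case False
    then show ?thesis
      using norm_comm_le[of A B] propagator_refl[OF pr, OF YZ t] by (simp add: m_def \<alpha>_t)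
  qed
  moreover have "norm (m r) \<le> norm (m r - m t) + norm (m t)"
    using norm_triangle_ineq[of "m r - m t" "m t"] by simp
  ultimately have "norm (comm (\<alpha> r) B) \<le> \<phi> \<bar>r - t\<bar> - \<phi> 0 + 2 * norm A * norm B * of_bool (Z \<inter> P \<noteq> {})"
    by linarith
  then show ?case
    by (simp add: \<phi>_def env_def algebra_simps)
qed

text \<open>At fixed volume \<open>K\<close> is a finite number, so the remainder of the iteration
  vanishes as \<open>n\<close> grows and the dependence of \<open>K\<close> on the volume leaves no
  trace.\<close>

lemma lieb_robinson:
  fixes \<alpha> :: "real \<Rightarrow> 'b" and A :: 'b
  assumes "Y \<subseteq> \<Lambda>" "P \<subseteq> \<Lambda>" "A \<in> loc P" "t \<in> {-T..T}" "\<alpha> t = A"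
    and "\<And>r. r \<in> {-T..T} \<Longrightarrow> norm (\<alpha> r) \<le> norm A"
    and "\<And>r. r \<in> {-T..T} \<Longrightarrow> (\<alpha> has_vector_derivative - comm (gen Y r) (\<alpha> r)) (at r within {-T..T})"
    and "Z \<subseteq> \<Lambda>" "B \<in> loc Z" "r \<in> {-T..T}"
  shows "norm (comm (\<alpha> r) B) \<le> 2 * norm A * norm B * env P \<bar>r - t\<bar> Z"
proof (rule Lim_bounded2)
  define x where "x = 2 * (\<Sum>W\<in>{W. W \<subseteq> \<Lambda>}. p W) * \<bar>r - t\<bar>"
  have "(\<lambda>n. inverse (fact n) * x ^ n) \<longlonglongrightarrow> 0"
    by (rule summable_LIMSEQ_zero[OF summable_exp])
  then have "(\<lambda>n. x ^ n / fact n) \<longlonglongrightarrow> 0"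
    by (simp add: field_simps)
  then have "(\<lambda>n. 2 * norm A * norm B * (env P \<bar>r - t\<bar> Z + x ^ n / fact n))
      \<longlonglongrightarrow> 2 * norm A * norm B * (env P \<bar>r - t\<bar> Z + 0)"
    by (intro tendsto_intros)
  then show "(\<lambda>n. 2 * norm A * norm B * (env P \<bar>r - t\<bar> Z + x ^ n / fact n))
      \<longlonglongrightarrow> 2 * norm A * norm B * env P \<bar>r - t\<bar> Z"
    by simp
  show "\<forall>n\<ge>0. norm (comm (\<alpha> r) B) \<le> 2 * norm A * norm B * (env P \<bar>r - t\<bar> Z + x ^ n / fact n)"
    using lieb_robinson_iterate[OF assms] by (simp add: x_def)
qed

theorem local_dynamics_approx:
  assumes Y: "Y \<subseteq> \<Lambda>" and P: "P \<subseteq> \<Lambda>" and A: "A \<in> loc P" and s: "s \<in> {-T..T}" and t: "t \<in> {-T..T}"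
  shows "norm (w \<Lambda> t s * A * u \<Lambda> t s - w Y t s * A * u Y t s)
    \<le> norm A * ((exp (2 * N * C * \<bar>t - s\<bar>) - 1) / C) * inter_sum P (\<Lambda> - Y)"
proof -
  note prY = prop_gen[OF Y] and prL = prop_gen[OF order_refl]
  let ?\<W> = "{W. W \<subseteq> \<Lambda> \<and> W \<inter> (\<Lambda> - Y) \<noteq> {}}"
  define \<alpha> where "\<alpha> r = u Y r t * A * w Y r t" for r
  define h where "h r = w \<Lambda> r s * \<alpha> r * u \<Lambda> r s" for r
  define h' where "h' r = w \<Lambda> r s * comm (\<Sum>W\<in>?\<W>. \<psi> W r) (\<alpha> r) * u \<Lambda> r s" for r
  define \<phi> where "\<phi> x = norm A * ((exp (2 * N * C * x) - 1) / C) * inter_sum P (\<Lambda> - Y)" for x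
  define \<phi>' where "\<phi>' x = norm A * (2 * N * exp (2 * N * C * x)) * inter_sum P (\<Lambda> - Y)" for x
  have gen_\<Lambda>: "gen \<Lambda> r = gen Y r + (\<Sum>W\<in>?\<W>. \<psi> W r)" for r
    using gen_split[of \<Lambda> r "\<Lambda> - Y"] Y by (simp add: double_diff)
  have \<alpha>_deriv: "(\<alpha> has_vector_derivative - comm (gen Y r) (\<alpha> r)) (at r within {-T..T})"
    if r: "r \<in> {-T..T}" for r
  proof -
    have "(\<alpha> has_vector_derivative u Y r t * A * (w Y r t * gen Y r) + - (gen Y r * u Y r t) * A * w Y r t)
        (at r within {-T..T})"
      unfolding \<alpha>_def
      by (intro has_vector_derivative_mult has_vector_derivative_mult_left propagator_deriv[OF prY] r t)
    then show ?thesis by (simp add: comm_def \<alpha>_def mult.assoc)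
  qed
  have \<alpha>_norm: "norm (\<alpha> r) \<le> norm A" if "r \<in> {-T..T}" for r
    unfolding \<alpha>_def by (rule norm_conjugate_le(2)[OF prY t that])
  have h_deriv: "(h has_vector_derivative h' r) (at r within {-T..T})" if r: "r \<in> {-T..T}" for r
  proof -
    have "(h has_vector_derivative w \<Lambda> r s * \<alpha> r * - (gen \<Lambda> r * u \<Lambda> r s)
        + (w \<Lambda> r s * - comm (gen Y r) (\<alpha> r) + w \<Lambda> r s * gen \<Lambda> r * \<alpha> r) * u \<Lambda> r s) (at r within {-T..T})"
      unfolding h_def
      by (intro has_vector_derivative_mult propagator_deriv[OF prL] \<alpha>_deriv r s)
    then show ?thesis
      unfolding h'_def gen_\<Lambda> by (simp add: comm_def algebra_simps)
  qed
  have \<phi>_deriv: "(\<phi> has_real_derivative \<phi>' x) (at x)" for x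
    unfolding \<phi>_def \<phi>'_def using C_pos by (auto intro!: derivative_eq_intros simp: field_simps)
  have "norm (h' r) \<le> \<phi>' \<bar>r - t\<bar>" if r: "r \<in> {-T..T}" for r
  proof -
    have "norm (h' r) \<le> norm (comm (\<Sum>W\<in>?\<W>. \<psi> W r) (\<alpha> r))"
      unfolding h'_def by (rule norm_conjugate_le(1)[OF prL s r])
    also have "\<dots> \<le> (\<Sum>W\<in>?\<W>. norm (comm (\<psi> W r) (\<alpha> r)))"
      unfolding comm_sum_left by (rule norm_sum)
    also have "\<dots> \<le> (\<Sum>W\<in>?\<W>. 2 * norm A * (p W * env P \<bar>r - t\<bar> W))"
    proof (rule sum_mono)
      fix W assume "W \<in> ?\<W>"
      then have W: "W \<subseteq> \<Lambda>" "W \<noteq> {}" by auto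
      have "norm (comm (\<psi> W r) (\<alpha> r)) = norm (comm (\<alpha> r) (\<psi> W r))"
        by (metis comm_swap norm_minus_cancel)
      also have "\<dots> \<le> 2 * norm A * norm (\<psi> W r) * env P \<bar>r - t\<bar> W"
        by (rule lieb_robinson[where \<alpha> = \<alpha>, OF Y P A t _ \<alpha>_norm \<alpha>_deriv])
           (use W r t propagator_refl[OF prY t] \<psi>_loc in \<open>auto simp: \<alpha>_def\<close>)
      also have "\<dots> \<le> 2 * norm A * p W * env P \<bar>r - t\<bar> W"
        by (intro mult_right_mono mult_left_mono \<psi>_norm W r env_nonneg) auto
      finally show "norm (comm (\<psi> W r) (\<alpha> r)) \<le> 2 * norm A * (p W * env P \<bar>r - t\<bar> W)"
        by (simp add: mult.assoc)
    qed
    also have "\<dots> = 2 * norm A * (\<Sum>W\<in>?\<W>. p W * env P \<bar>r - t\<bar> W)"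
      by (simp add: sum_distrib_left)
    also have "\<dots> \<le> 2 * norm A * (N * exp (2 * N * C * \<bar>r - t\<bar>) * inter_sum P (\<Lambda> - Y))"
      using P by (intro mult_left_mono sum_env_le) auto
    finally show ?thesis by (simp add: \<phi>'_def algebra_simps)
  qed
  \<comment> \<open>The commutator bound grows with the distance of \<open>r\<close> from
    \<open>t\<close>, so the integration starts at \<open>t\<close>.\<close>
  then have "norm (h s - h t) \<le> \<phi> \<bar>s - t\<bar> - \<phi> 0"
    by (intro norm_le_of_deriv_le[OF h_deriv \<phi>_deriv] s t) auto
  moreover have "h s = w Y t s * A * u Y t s"
    using propagator_refl[OF prL s] propagator_swap[OF prY s t] propagator_swap[OF prY t s]
    by (simp add: h_def \<alpha>_def)
  moreover have "h t = w \<Lambda> t s * A * u \<Lambda> t s"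
    using propagator_refl[OF prY t] by (simp add: h_def \<alpha>_def)
  ultimately show ?thesis
    by (simp add: \<phi>_def abs_minus_commute norm_minus_commute)
qed

end


section \<open>Local operators on a finite volume\<close>

lemma finite_confs: "finite \<Lambda> \<Longrightarrow> finite (confs dm \<Lambda>)"
  by (rule finite_subset[OF _ finite_set_of_finite_funs[of \<Lambda> "\<Union>x\<in>\<Lambda>. {..<dm x}" 0]])
     (auto simp: confs_def)

text \<open>Configurations are 0 off their region, so for disjoint regions pointwise addition is
  juxtaposition.\<close>

definition glue :: "'a cfg \<Rightarrow> 'a cfg \<Rightarrow> 'a cfg" where
  "glue a b = (\<lambda>x. a x + b x)"

lemma restr_confs: "Z \<subseteq> \<Lambda> \<Longrightarrow> \<sigma> \<in> confs dm \<Lambda> \<Longrightarrow> restr Z \<sigma> \<in> confs dm Z"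
  by (auto simp: confs_def restr_def)

lemma restr_self: "\<sigma> \<in> confs dm Z \<Longrightarrow> restr Z \<sigma> = \<sigma>"
  by (auto simp: confs_def restr_def)

lemma restr_restr: "W \<subseteq> Z \<Longrightarrow> restr W (restr Z \<sigma>) = restr W \<sigma>"
  by (auto simp: restr_def fun_eq_iff)

lemma glue_confs:
  "Z \<subseteq> \<Lambda> \<Longrightarrow> a \<in> confs dm Z \<Longrightarrow> b \<in> confs dm (\<Lambda> - Z) \<Longrightarrow> glue a b \<in> confs dm \<Lambda>"
  by (auto simp: confs_def glue_def) (metis add.right_neutral add.left_neutral subsetD)

lemma restr_glue:
  assumes "a \<in> confs dm Z" "b \<in> confs dm (\<Lambda> - Z)"
  shows "restr Z (glue a b) = a" "restr (\<Lambda> - Z) (glue a b) = b"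
  using assms by (auto simp: confs_def restr_def glue_def fun_eq_iff)

lemma glue_restr: "Z \<subseteq> \<Lambda> \<Longrightarrow> \<sigma> \<in> confs dm \<Lambda> \<Longrightarrow> glue (restr Z \<sigma>) (restr (\<Lambda> - Z) \<sigma>) = \<sigma>"
  by (auto simp: confs_def restr_def glue_def fun_eq_iff)

lemma sum_confs_glue:
  assumes "Z \<subseteq> \<Lambda>"
  shows "(\<Sum>\<sigma>\<in>confs dm \<Lambda>. g \<sigma>) = (\<Sum>b\<in>confs dm (\<Lambda> - Z). \<Sum>a\<in>confs dm Z. g (glue a b))"
proof -
  have "(\<Sum>\<sigma>\<in>confs dm \<Lambda>. g \<sigma>) = (\<Sum>(b, a)\<in>confs dm (\<Lambda> - Z) \<times> confs dm Z. g (glue a b))"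
    by (rule sum.reindex_bij_witness[where i = "\<lambda>(b, a). glue a b" and j = "\<lambda>\<sigma>. (restr (\<Lambda> - Z) \<sigma>, restr Z \<sigma>)"])
       (auto simp: restr_glue glue_restr assms intro: glue_confs[OF assms] restr_confs[OF assms] restr_confs[of "\<Lambda> - Z" \<Lambda>])
  then show ?thesis by (simp add: sum.cartesian_product)
qed

lemma emb_glue:
  assumes "a \<in> confs dm Z" "b \<in> confs dm (\<Lambda> - Z)" "a' \<in> confs dm Z" "b' \<in> confs dm (\<Lambda> - Z)"
  shows "emb Z \<Lambda> A (glue a b) (glue a' b') = (if b = b' then A a a' else 0)"
  using assms by (simp add: emb_def restr_glue)

lemma emb_emb: "W \<subseteq> Z \<Longrightarrow> Z \<subseteq> \<Lambda> \<Longrightarrow> emb Z \<Lambda> (emb W Z A) = emb W \<Lambda> A"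
  by (intro ext, simp add: emb_def restr_restr) (auto simp: restr_def fun_eq_iff)

lemma confs_glueE:
  assumes "Z \<subseteq> \<Lambda>" "\<sigma> \<in> confs dm \<Lambda>"
  obtains a b where "a \<in> confs dm Z" "b \<in> confs dm (\<Lambda> - Z)" "\<sigma> = glue a b"
  using assms glue_restr[OF assms] restr_confs[OF assms] restr_confs[of "\<Lambda> - Z" \<Lambda> \<sigma> dm] by (metis Diff_subset)

lemma vnorm_bapp_matop:
  assumes "finite \<Lambda>"
  shows "norm (bapp (matop (confs dm \<Lambda>) A) v) = vnorm dm \<Lambda> (app dm \<Lambda> A (coord v))"
  by (subst norm_fvec_superset[OF finite_confs[OF assms]])
     (auto simp: coord_matop finite_confs assms vnorm_def app_def intro: ccontr)

text \<open>The supremum defining \<open>opnorm\<close> ranges over arbitrary functions, but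
  \<open>vnorm\<close> and \<open>app\<close> see only their values on \<open>confs\<close>;
  truncation turns them into finitely supported vectors. The resulting bound also shows that the
  supremum is a genuine one.\<close>

lemma opnorm_eq_norm:
  assumes "finite \<Lambda>"
  shows "opnorm dm \<Lambda> A = norm (matop (confs dm \<Lambda>) A)"
proof (rule antisym)
  let ?C = "confs dm \<Lambda>"
  note fin = finite_confs[OF assms]
  have le: "vnorm dm \<Lambda> (app dm \<Lambda> A v) \<le> norm (matop ?C A) * vnorm dm \<Lambda> v" for v
  proof -
    define v' where "v' = Abs_fvec (\<lambda>\<sigma>. if \<sigma> \<in> ?C then v \<sigma> else 0)"
    have c: "coord v' = (\<lambda>\<sigma>. if \<sigma> \<in> ?C then v \<sigma> else 0)"
      unfolding v'_def by (rule Abs_fvec_inverse) (auto intro: finite_subset[OF _ fin])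
    have "vnorm dm \<Lambda> (app dm \<Lambda> A v) = vnorm dm \<Lambda> (app dm \<Lambda> A (coord v'))"
      by (simp add: app_def c)
    also have "\<dots> \<le> norm (matop ?C A) * norm v'"
      unfolding vnorm_bapp_matop[OF assms, symmetric] by (rule norm_bapp)
    also have "norm v' = vnorm dm \<Lambda> v"
      by (subst norm_fvec_superset[OF fin]) (auto simp: c vnorm_def)
    finally show ?thesis .
  qed
  have le1: "vnorm dm \<Lambda> (app dm \<Lambda> A v) \<le> norm (matop ?C A)" if "vnorm dm \<Lambda> v \<le> 1" for v
    using le[of v] mult_left_mono[OF that, of "norm (matop ?C A)"] by simp
  have z: "vnorm dm \<Lambda> (\<lambda>_. 0) \<le> 1" by (simp add: vnorm_def)
  show "opnorm dm \<Lambda> A \<le> norm (matop ?C A)"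
    unfolding opnorm_def using le1 z by (intro cSUP_least) auto
  have bdd: "bdd_above ((\<lambda>v. vnorm dm \<Lambda> (app dm \<Lambda> A v)) ` {v. vnorm dm \<Lambda> v \<le> 1})"
    by (rule bdd_aboveI2) (use le1 in auto)
  have up: "vnorm dm \<Lambda> (app dm \<Lambda> A v) \<le> opnorm dm \<Lambda> A" if "vnorm dm \<Lambda> v \<le> 1" for v
    unfolding opnorm_def using bdd that by (auto intro: cSUP_upper)
  show "norm (matop ?C A) \<le> opnorm dm \<Lambda> A"
  proof (rule norm_bop_bound)
    show "0 \<le> opnorm dm \<Lambda> A"
      using up[OF z] by (simp add: app_def vnorm_def)
    fix v :: "'a cfg fvec"
    show "norm (bapp (matop ?C A) v) \<le> opnorm dm \<Lambda> A * norm v"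
    proof (cases "v = 0")
      case False
      let ?v = "v /\<^sub>R norm v"
      have "vnorm dm \<Lambda> (coord ?v) \<le> norm ?v"
        unfolding vnorm_def
        by (subst norm_fvec_superset[of "?C \<union> {x. coord ?v x \<noteq> 0}"])
           (auto intro!: sum_mono2 simp: fin)
      then have "norm (bapp (matop ?C A) ?v) \<le> opnorm dm \<Lambda> A"
        unfolding vnorm_bapp_matop[OF assms] using False by (intro up) simp
      then show ?thesis using False by (simp add: field_simps)
    qed simp
  qed
qed

section \<open>Local operators inside one fixed volume\<close>

context
  fixes dm :: "'a \<Rightarrow> nat" and \<Lambda> :: "'a set"
  assumes finite_\<Lambda>: "finite \<Lambda>"
begin

text \<open>\<open>lop Z A\<close> annihilates every configuration outside \<open>confs dm \<Lambda>\<close>, so unitary matrices become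
  invertible only after adding the identity on these configurations; this is \<open>ulop\<close>.\<close>

definition lop :: "'a set \<Rightarrow> 'a op \<Rightarrow> 'a cfg fvec bop" where
  "lop Z A = matop (confs dm \<Lambda>) (emb Z \<Lambda> A)"

definition proj :: "'a cfg fvec bop" where
  "proj = matop (confs dm \<Lambda>) idop"

definition ulop :: "'a set \<Rightarrow> 'a op \<Rightarrow> 'a cfg fvec bop" where
  "ulop Z A = lop Z A + (1 - proj)"

lemma fin_confs: "finite (confs dm \<Lambda>)"
  by (rule finite_confs[OF finite_\<Lambda>])

lemma fin_confs': "Z \<subseteq> \<Lambda> \<Longrightarrow> finite (confs dm Z)"
  using finite_\<Lambda> finite_subset finite_confs by metis

lemma lop_cong:
  assumes "Z \<subseteq> \<Lambda>" "\<And>\<sigma> \<tau>. \<sigma> \<in> confs dm Z \<Longrightarrow> \<tau> \<in> confs dm Z \<Longrightarrow> A \<sigma> \<tau> = B \<sigma> \<tau>"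
  shows "lop Z A = lop Z B"
  unfolding lop_def
  by (rule matop_cong[OF fin_confs]) (simp add: emb_def assms restr_confs[OF assms(1)])

lemma lop_full: "lop \<Lambda> A = matop (confs dm \<Lambda>) A"
  unfolding lop_def by (rule matop_cong[OF fin_confs]) (simp add: emb_def restr_def[of "{}"] restr_self)

lemma lop_emb: "W \<subseteq> Z \<Longrightarrow> Z \<subseteq> \<Lambda> \<Longrightarrow> lop Z (emb W Z A) = lop W A"
  by (simp add: lop_def emb_emb)

lemma lop_sum: "lop Z (\<lambda>\<sigma> \<tau>. \<Sum>i\<in>I. A i \<sigma> \<tau>) = (\<Sum>i\<in>I. lop Z (A i))"
  unfolding lop_def matop_sum[OF fin_confs, symmetric]
  by (rule matop_cong[OF fin_confs]) (simp add: emb_def)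

lemma lop_uminus: "lop Z (\<lambda>\<sigma> \<tau>. - A \<sigma> \<tau>) = - lop Z A"
  unfolding lop_def matop_uminus[OF fin_confs, symmetric]
  by (rule matop_cong[OF fin_confs]) (simp add: emb_def)

lemma lop_mult:
  assumes Z: "Z \<subseteq> \<Lambda>"
  shows "lop Z A * lop Z B = lop Z (mmult dm Z A B)"
  unfolding lop_def matop_mult[OF fin_confs]
proof (rule matop_cong[OF fin_confs])
  fix \<sigma> \<tau> assume "\<sigma> \<in> confs dm \<Lambda>" "\<tau> \<in> confs dm \<Lambda>"
  then obtain a b a' b' where [simp]: "a \<in> confs dm Z" "b \<in> confs dm (\<Lambda> - Z)" "\<sigma> = glue a b"
      "a' \<in> confs dm Z" "b' \<in> confs dm (\<Lambda> - Z)" "\<tau> = glue a' b'"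
    using Z by (metis confs_glueE)
  have "(\<Sum>\<rho>\<in>confs dm \<Lambda>. emb Z \<Lambda> A \<sigma> \<rho> * emb Z \<Lambda> B \<rho> \<tau>)
      = (\<Sum>d\<in>confs dm (\<Lambda> - Z). if d = b then (\<Sum>c\<in>confs dm Z. A a c * (if b = b' then B c a' else 0)) else 0)"
    by (simp add: sum_confs_glue[OF Z] emb_glue[where dm = dm] cong: sum.cong)
       (auto intro!: sum.cong)
  also have "\<dots> = emb Z \<Lambda> (mmult dm Z A B) \<sigma> \<tau>"
    by (simp add: emb_glue[where dm = dm] mmult_def fin_confs' )
  finally show "(\<Sum>\<rho>\<in>confs dm \<Lambda>. emb Z \<Lambda> A \<sigma> \<rho> * emb Z \<Lambda> B \<rho> \<tau>) = emb Z \<Lambda> (mmult dm Z A B) \<sigma> \<tau>" .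
qed

lemma lop_tens:
  assumes Z: "Z \<subseteq> \<Lambda>"
  shows "lop Z A * lop (\<Lambda> - Z) B = matop (confs dm \<Lambda>) (tens Z (\<Lambda> - Z) A B)"
    and "lop (\<Lambda> - Z) B * lop Z A = matop (confs dm \<Lambda>) (tens Z (\<Lambda> - Z) A B)"
proof -
  have Z': "\<Lambda> - (\<Lambda> - Z) = Z" using Z by auto
  have *: "emb (\<Lambda> - Z) \<Lambda> B (glue a b) (glue a' b') = (if a = a' then B b b' else 0)"
    if "a \<in> confs dm Z" "b \<in> confs dm (\<Lambda> - Z)" "a' \<in> confs dm Z" "b' \<in> confs dm (\<Lambda> - Z)" for a b a' b'
    using that by (simp add: emb_def restr_glue[where dm = dm and \<Lambda> = \<Lambda>] Z')
  have 1: "(\<Sum>\<rho>\<in>confs dm \<Lambda>. emb Z \<Lambda> A \<sigma> \<rho> * emb (\<Lambda> - Z) \<Lambda> B \<rho> \<tau>) = tens Z (\<Lambda> - Z) A B \<sigma> \<tau>"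
   and 2: "(\<Sum>\<rho>\<in>confs dm \<Lambda>. emb (\<Lambda> - Z) \<Lambda> B \<sigma> \<rho> * emb Z \<Lambda> A \<rho> \<tau>) = tens Z (\<Lambda> - Z) A B \<sigma> \<tau>"
    if "\<sigma> \<in> confs dm \<Lambda>" "\<tau> \<in> confs dm \<Lambda>" for \<sigma> \<tau>
  proof -
    from that obtain a b a' b' where [simp]: "a \<in> confs dm Z" "b \<in> confs dm (\<Lambda> - Z)" "\<sigma> = glue a b"
        "a' \<in> confs dm Z" "b' \<in> confs dm (\<Lambda> - Z)" "\<tau> = glue a' b'"
      using Z by (metis confs_glueE)
    have t: "tens Z (\<Lambda> - Z) A B (glue a b) (glue a' b') = A a a' * B b b'"
      by (simp add: tens_def restr_glue[where dm = dm and \<Lambda> = \<Lambda>])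
    have "(\<Sum>\<rho>\<in>confs dm \<Lambda>. emb Z \<Lambda> A \<sigma> \<rho> * emb (\<Lambda> - Z) \<Lambda> B \<rho> \<tau>)
        = (\<Sum>d\<in>confs dm (\<Lambda> - Z). if d = b then (\<Sum>c\<in>confs dm Z. if c = a' then A a c * B b b' else 0) else 0)"
      by (simp add: sum_confs_glue[OF Z] emb_glue[where dm = dm] * cong: sum.cong)
         (auto intro!: sum.cong)
    then show "(\<Sum>\<rho>\<in>confs dm \<Lambda>. emb Z \<Lambda> A \<sigma> \<rho> * emb (\<Lambda> - Z) \<Lambda> B \<rho> \<tau>) = tens Z (\<Lambda> - Z) A B \<sigma> \<tau>"
      using Z by (simp add: t fin_confs')
    have "(\<Sum>\<rho>\<in>confs dm \<Lambda>. emb (\<Lambda> - Z) \<Lambda> B \<sigma> \<rho> * emb Z \<Lambda> A \<rho> \<tau>)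
        = (\<Sum>d\<in>confs dm (\<Lambda> - Z). if d = b' then (\<Sum>c\<in>confs dm Z. if c = a then A a a' * B b b' else 0) else 0)"
      by (simp add: sum_confs_glue[OF Z] emb_glue[where dm = dm] * cong: sum.cong)
         (auto intro!: sum.cong)
    then show "(\<Sum>\<rho>\<in>confs dm \<Lambda>. emb (\<Lambda> - Z) \<Lambda> B \<sigma> \<rho> * emb Z \<Lambda> A \<rho> \<tau>) = tens Z (\<Lambda> - Z) A B \<sigma> \<tau>"
      using Z by (simp add: t fin_confs')
  qed
  show "lop Z A * lop (\<Lambda> - Z) B = matop (confs dm \<Lambda>) (tens Z (\<Lambda> - Z) A B)"
    unfolding lop_def matop_mult[OF fin_confs] by (rule matop_cong[OF fin_confs]) (rule 1)
  show "lop (\<Lambda> - Z) B * lop Z A = matop (confs dm \<Lambda>) (tens Z (\<Lambda> - Z) A B)"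
    unfolding lop_def matop_mult[OF fin_confs] by (rule matop_cong[OF fin_confs]) (rule 2)
qed

text \<open>An operator on \<open>W\<close> is also one on the complement of \<open>Z\<close>, and
  there both orders of the product have the same tensor product as matrix.\<close>

lemma lop_commute:
  assumes "Z \<subseteq> \<Lambda>" "W \<subseteq> \<Lambda>" "Z \<inter> W = {}"
  shows "lop Z A * lop W B = lop W B * lop Z A"
proof -
  have "lop W B = lop (\<Lambda> - Z) (emb W (\<Lambda> - Z) B)"
    using assms by (intro lop_emb[symmetric]) auto
  then show ?thesis using lop_tens[OF assms(1)] by metis
qed

text \<open>With the configuration outside \<open>Z\<close> frozen, the embedded operator acts as
  \<open>A\<close> on that slice, and different slices are orthogonal. Equality can fail: a site of
  dimension 0 in the rest of \<Lambda> leaves no configurations at all.\<close>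

lemma norm_lop_le:
  assumes Z: "Z \<subseteq> \<Lambda>"
  shows "norm (lop Z A) \<le> opnorm dm Z A"
proof (rule norm_bop_bound)
  have finZ: "finite Z" using Z finite_\<Lambda> by (rule finite_subset)
  note on = opnorm_eq_norm[OF finZ, of dm A]
  show "0 \<le> opnorm dm Z A" by (simp add: on)
  fix v :: "'a cfg fvec"
  let ?C = "confs dm \<Lambda>" and ?B = "confs dm (\<Lambda> - Z)" and ?A = "confs dm Z"
  have slice: "(\<Sum>a\<in>?A. (cmod (\<Sum>a'\<in>?A. A a a' * coord v (glue a' b)))\<^sup>2)
      \<le> (opnorm dm Z A)\<^sup>2 * (\<Sum>a\<in>?A. (cmod (coord v (glue a b)))\<^sup>2)" for b
  proof -
    define v' where "v' = Abs_fvec (\<lambda>a. if a \<in> ?A then coord v (glue a b) else 0)"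
    have c: "coord v' = (\<lambda>a. if a \<in> ?A then coord v (glue a b) else 0)"
      unfolding v'_def by (rule Abs_fvec_inverse) (auto intro: finite_subset[OF _ fin_confs'[OF Z]])
    have "(norm (bapp (matop ?A A) v'))\<^sup>2 \<le> (opnorm dm Z A * norm v')\<^sup>2"
      unfolding on by (intro power_mono norm_bapp) simp
    also have "norm v' = sqrt (\<Sum>a\<in>?A. (cmod (coord v (glue a b)))\<^sup>2)"
      by (subst norm_fvec_superset[OF fin_confs'[OF Z]]) (auto simp: c)
    also have "norm (bapp (matop ?A A) v') = sqrt (\<Sum>a\<in>?A. (cmod (\<Sum>a'\<in>?A. A a a' * coord v (glue a' b)))\<^sup>2)"
      by (simp add: vnorm_bapp_matop[OF finZ] vnorm_def app_def c)
    finally show ?thesis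
      by (simp add: power_mult_distrib sum_nonneg)
  qed
  have "(norm (bapp (lop Z A) v))\<^sup>2 = (\<Sum>\<sigma>\<in>?C. (cmod (\<Sum>\<tau>\<in>?C. emb Z \<Lambda> A \<sigma> \<tau> * coord v \<tau>))\<^sup>2)"
    by (simp add: lop_def vnorm_bapp_matop[OF finite_\<Lambda>] vnorm_def app_def sum_nonneg)
  also have "\<dots> = (\<Sum>b\<in>?B. \<Sum>a\<in>?A. (cmod (\<Sum>a'\<in>?A. A a a' * coord v (glue a' b)))\<^sup>2)"
  proof -
    have "(\<Sum>\<tau>\<in>?C. emb Z \<Lambda> A (glue a b) \<tau> * coord v \<tau>) = (\<Sum>a'\<in>?A. A a a' * coord v (glue a' b))"
      if "a \<in> ?A" "b \<in> ?B" for a b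
    proof -
      have "(\<Sum>\<tau>\<in>?C. emb Z \<Lambda> A (glue a b) \<tau> * coord v \<tau>)
          = (\<Sum>d\<in>?B. if d = b then (\<Sum>c\<in>?A. A a c * coord v (glue c b)) else 0)"
        using that by (simp add: sum_confs_glue[OF Z] emb_glue[where dm = dm] cong: sum.cong)
          (auto intro!: sum.cong)
      then show ?thesis using that by (simp add: fin_confs')
    qed
    then show ?thesis by (simp add: sum_confs_glue[OF Z] cong: sum.cong)
  qed
  also have "\<dots> \<le> (\<Sum>b\<in>?B. (opnorm dm Z A)\<^sup>2 * (\<Sum>a\<in>?A. (cmod (coord v (glue a b)))\<^sup>2))"
    by (intro sum_mono slice)
  also have "\<dots> = (opnorm dm Z A)\<^sup>2 * (\<Sum>\<sigma>\<in>?C. (cmod (coord v \<sigma>))\<^sup>2)"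
    by (simp add: sum_confs_glue[OF Z] sum_distrib_left)
  also have "\<dots> \<le> (opnorm dm Z A)\<^sup>2 * (norm v)\<^sup>2"
  proof -
    have "(\<Sum>\<sigma>\<in>?C. (cmod (coord v \<sigma>))\<^sup>2) \<le> (norm v)\<^sup>2"
      by (subst norm_fvec_superset[of "?C \<union> {x. coord v x \<noteq> 0}"])
         (auto simp: fin_confs sum_nonneg intro!: sum_mono2)
    then show ?thesis by (intro mult_left_mono) auto
  qed
  finally have "(norm (bapp (lop Z A) v))\<^sup>2 \<le> (opnorm dm Z A * norm v)\<^sup>2"
    by (simp add: power_mult_distrib)
  then show "norm (bapp (lop Z A) v) \<le> opnorm dm Z A * norm v"
    by (rule power2_le_imp_le) (simp add: on)
qed

lemma lop_idop: "lop Z idop = proj" if "Z \<subseteq> \<Lambda>"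
  unfolding lop_def proj_def
proof (rule matop_cong[OF fin_confs])
  fix \<sigma> \<tau> assume "\<sigma> \<in> confs dm \<Lambda>" "\<tau> \<in> confs dm \<Lambda>"
  then show "emb Z \<Lambda> idop \<sigma> \<tau> = idop \<sigma> \<tau>"
    using glue_restr[OF that] by (auto simp: emb_def idop_def) (metis)+
qed

lemma proj_absorb [simp]:
  "proj * lop Z A = lop Z A" "lop Z A * proj = lop Z A" "proj * proj = proj"
  "proj * (lop Z A * x) = lop Z A * x" "lop Z A * (proj * x) = lop Z A * x"
proof -
  have 1: "proj * matop (confs dm \<Lambda>) M = matop (confs dm \<Lambda>) M" for M
    unfolding proj_def matop_mult[OF fin_confs]
    by (rule matop_cong[OF fin_confs]) (simp add: idop_def fin_confs if_distrib[of "\<lambda>x. x * _"] cong: if_cong)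
  have 2: "matop (confs dm \<Lambda>) M * proj = matop (confs dm \<Lambda>) M" for M
    unfolding proj_def matop_mult[OF fin_confs]
    by (rule matop_cong[OF fin_confs]) (simp add: idop_def fin_confs if_distrib[of "\<lambda>x. _ * x"] cong: if_cong)
  show A: "proj * lop Z A = lop Z A" "lop Z A * proj = lop Z A"
    unfolding lop_def by (rule 1, rule 2)
  show "proj * proj = proj" using 1[of idop] by (simp add: proj_def)
  show "proj * (lop Z A * x) = lop Z A * x" "lop Z A * (proj * x) = lop Z A * x"
    using A by (simp_all add: mult.assoc[symmetric])
qed

text \<open>Every \<open>lop\<close> vanishes where \<open>1 - proj\<close> is the identity, so the
  added part disappears next to a local operator.\<close>

lemma ulop_mult_lop [simp]: "ulop Z A * lop W B = lop Z A * lop W B" "lop W B * ulop Z A = lop W B * lop Z A"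
  by (simp_all add: ulop_def algebra_simps)

lemma adjoint_pair_proj: "adjoint_pair proj proj"
  using adjoint_pair_matop[OF fin_confs, of idop]
  by (simp add: proj_def idop_def[abs_def] if_distrib[of cnj] eq_commute cong: if_cong)

lemma adjoint_pair_lop: "adjoint_pair (lop Z A) (lop Z (adj A))"
proof -
  have "(\<lambda>\<sigma> \<tau>. cnj (emb Z \<Lambda> A \<tau> \<sigma>)) = emb Z \<Lambda> (adj A)"
    by (auto simp: emb_def adj_def fun_eq_iff)
  then show ?thesis
    unfolding lop_def using adjoint_pair_matop[OF fin_confs] by metis
qed

lemma adjoint_pair_ulop: "adjoint_pair (ulop Z A) (ulop Z (adj A))"
  unfolding ulop_def
  by (intro adjoint_pair_add adjoint_pair_diff adjoint_pair_lop adjoint_pair_one adjoint_pair_proj)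

lemma has_vector_derivative_lop:
  assumes "Z \<subseteq> \<Lambda>"
    and "\<And>\<sigma> \<tau>. \<sigma> \<in> confs dm Z \<Longrightarrow> \<tau> \<in> confs dm Z \<Longrightarrow> ((\<lambda>r. A r \<sigma> \<tau>) has_vector_derivative A' \<sigma> \<tau>) (at t within I)"
  shows "((\<lambda>r. lop Z (A r)) has_vector_derivative lop Z A') (at t within I)"
  unfolding lop_def
proof (rule has_vector_derivative_matop[OF fin_confs])
  fix \<sigma> \<tau> assume "\<sigma> \<in> confs dm \<Lambda>" "\<tau> \<in> confs dm \<Lambda>"
  then show "((\<lambda>r. emb Z \<Lambda> (A r) \<sigma> \<tau>) has_vector_derivative emb Z \<Lambda> A' \<sigma> \<tau>) (at t within I)"
    unfolding emb_def using assms(2) restr_confs[OF assms(1)] by auto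
qed

text \<open>The entrywise equation alone forces unitarity: \<open>c\<close> is imaginary and
  \<open>H\<close> self-adjoint, so the product of the adjoint of \<open>V\<close> with
  \<open>V\<close> has derivative 0. The scalar is left open because the dynamics has
  \<open>- \<i>\<close> and the surface evolution \<open>\<i>\<close>.\<close>

lemma unitary_evolution:
  fixes V H :: "real \<Rightarrow> 'a op" and c :: complex
  assumes Z: "Z \<subseteq> \<Lambda>" and c: "cnj c = - c" and s: "s \<in> {-T..T}"
    and init: "\<And>\<sigma> \<tau>. \<sigma> \<in> confs dm Z \<Longrightarrow> \<tau> \<in> confs dm Z \<Longrightarrow> V s \<sigma> \<tau> = idop \<sigma> \<tau>"
    and sa: "\<And>r \<sigma> \<tau>. r \<in> {-T..T} \<Longrightarrow> \<sigma> \<in> confs dm Z \<Longrightarrow> \<tau> \<in> confs dm Z \<Longrightarrow> H r \<sigma> \<tau> = cnj (H r \<tau> \<sigma>)"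
    and der: "\<And>t \<sigma> \<tau>. t \<in> {-T..T} \<Longrightarrow> \<sigma> \<in> confs dm Z \<Longrightarrow> \<tau> \<in> confs dm Z \<Longrightarrow>
      ((\<lambda>r. V r \<sigma> \<tau>) has_vector_derivative c * (\<Sum>\<rho>\<in>confs dm Z. H t \<sigma> \<rho> * V t \<rho> \<tau>)) (at t within {-T..T})"
  defines "h \<equiv> \<lambda>r. lop Z (\<lambda>\<sigma> \<tau>. - c * H r \<sigma> \<tau>)"
  shows "ulop Z (V s) = 1" and "ulop Z (adj (V s)) = 1"
    and "t \<in> {-T..T} \<Longrightarrow> ((\<lambda>r. ulop Z (V r)) has_vector_derivative - (h t * ulop Z (V t))) (at t within {-T..T})"
    and "t \<in> {-T..T} \<Longrightarrow> ((\<lambda>r. ulop Z (adj (V r))) has_vector_derivative ulop Z (adj (V t)) * h t) (at t within {-T..T})"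
    and "t \<in> {-T..T} \<Longrightarrow> norm (ulop Z (V t)) \<le> 1"
proof -
  have "lop Z (V s) = proj"
    by (subst lop_idop[OF Z, symmetric]) (rule lop_cong[OF Z init])
  then show u1: "ulop Z (V s) = 1" by (simp add: ulop_def)
  have "lop Z (adj (V s)) = proj"
    by (subst lop_idop[OF Z, symmetric]) (rule lop_cong[OF Z], auto simp: adj_def init idop_def)
  then show w1: "ulop Z (adj (V s)) = 1" by (simp add: ulop_def)
  have du: "((\<lambda>r. ulop Z (V r)) has_vector_derivative - (h t * ulop Z (V t))) (at t within {-T..T})"
    if t: "t \<in> {-T..T}" for t
  proof -
    have "lop Z (\<lambda>\<sigma> \<tau>. c * (\<Sum>\<rho>\<in>confs dm Z. H t \<sigma> \<rho> * V t \<rho> \<tau>)) = - (h t * ulop Z (V t))"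
      unfolding h_def ulop_mult_lop lop_mult[OF Z] lop_uminus[symmetric]
      by (rule lop_cong[OF Z]) (simp add: mmult_def sum_distrib_left sum_negf mult.assoc)
    moreover have "((\<lambda>r. lop Z (V r)) has_vector_derivative
        lop Z (\<lambda>\<sigma> \<tau>. c * (\<Sum>\<rho>\<in>confs dm Z. H t \<sigma> \<rho> * V t \<rho> \<tau>))) (at t within {-T..T})"
      by (rule has_vector_derivative_lop[OF Z der[OF t]])
    ultimately show ?thesis
      unfolding ulop_def[of Z "V _"] by (auto intro!: derivative_eq_intros simp: ulop_def)
  qed
  have dw: "((\<lambda>r. ulop Z (adj (V r))) has_vector_derivative ulop Z (adj (V t)) * h t) (at t within {-T..T})"
    if t: "t \<in> {-T..T}" for t
  proof -
    let ?D = "\<lambda>\<sigma> \<tau>. cnj (c * (\<Sum>\<rho>\<in>confs dm Z. H t \<tau> \<rho> * V t \<rho> \<sigma>))"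
    have "lop Z ?D = ulop Z (adj (V t)) * h t"
      unfolding h_def ulop_mult_lop lop_mult[OF Z]
    proof (rule lop_cong[OF Z])
      fix \<sigma> \<tau> assume "\<sigma> \<in> confs dm Z" "\<tau> \<in> confs dm Z"
      then have "cnj (H t \<tau> \<rho>) = H t \<rho> \<tau>" if "\<rho> \<in> confs dm Z" for \<rho>
        using sa[OF t that] by metis
      then show "?D \<sigma> \<tau> = mmult dm Z (adj (V t)) (\<lambda>\<sigma> \<tau>. - c * H t \<sigma> \<tau>) \<sigma> \<tau>"
        by (simp add: mmult_def adj_def c sum_distrib_left algebra_simps cong: sum.cong)
    qed
    moreover have "((\<lambda>r. lop Z (adj (V r))) has_vector_derivative lop Z ?D) (at t within {-T..T})"
      unfolding adj_def
      by (rule has_vector_derivative_lop[OF Z]) (intro has_vector_derivative_cnj der t)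
    ultimately show ?thesis
      unfolding ulop_def[of Z "adj _"] by (auto intro!: derivative_eq_intros simp: ulop_def)
  qed
  show "t \<in> {-T..T} \<Longrightarrow> ((\<lambda>r. ulop Z (V r)) has_vector_derivative - (h t * ulop Z (V t))) (at t within {-T..T})"
   and "t \<in> {-T..T} \<Longrightarrow> ((\<lambda>r. ulop Z (adj (V r))) has_vector_derivative ulop Z (adj (V t)) * h t) (at t within {-T..T})"
    by (rule du, assumption) (rule dw)
  assume t: "t \<in> {-T..T}"
  have "ulop Z (adj (V t)) * ulop Z (V t) = ulop Z (adj (V s)) * ulop Z (V s)"
  proof (rule vector_derivative_zero_unique[of T "\<lambda>r. ulop Z (adj (V r)) * ulop Z (V r)", OF _ s t])
    fix r assume r: "r \<in> {-T..T}"
    show "((\<lambda>r. ulop Z (adj (V r)) * ulop Z (V r)) has_vector_derivative 0) (at r within {-T..T})"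
      using has_vector_derivative_mult[OF dw[OF r] du[OF r]] by (simp add: mult.assoc)
  qed
  then show "norm (ulop Z (V t)) \<le> 1"
    using u1 w1 by (intro norm_isometry_le[OF adjoint_pair_ulop]) simp
qed

end


section \<open>Graph distance and boundary shells\<close>

context
  fixes E :: "'a \<Rightarrow> 'a \<Rightarrow> bool" and d :: "'a \<Rightarrow> 'a \<Rightarrow> nat"
  assumes graph: "graph_distance E d"
begin

lemma path_of_dist: "(E ^^ d x y) x y"
  using graph unfolding graph_distance_def by (metis LeastI_ex)

lemma dist_le_path: "(E ^^ n) x y \<Longrightarrow> d x y \<le> n"
  using graph unfolding graph_distance_def by (metis Least_le)

lemma dist_self: "d x x = 0"
  using dist_le_path[of 0 x x] by simp

lemma dist_sym: "d x y = d y x"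
proof -
  have sym: "E a b \<Longrightarrow> E b a" for a b
    using graph by (simp add: graph_distance_def)
  have "(E ^^ n) x y \<Longrightarrow> (E ^^ n) y x" for n x y
  proof (induction n arbitrary: y)
    case (Suc n)
    then show ?case by (metis relpowp_Suc_E relpowp_Suc_I2 sym)
  qed simp
  then show ?thesis
    using path_of_dist dist_le_path by (metis antisym)
qed

lemma dist_triangle: "d x z \<le> d x y + d y z"
  using relpowp_trans[OF path_of_dist path_of_dist] by (rule dist_le_path)

text \<open>The path is cut at the first edge that leaves \<open>X\<close>; that edge is the 1 in
  the length.\<close>

lemma path_exit:
  "(E ^^ L) x y \<Longrightarrow> x \<in> X \<Longrightarrow> y \<notin> X \<Longrightarrow>
    \<exists>i j z z'. i + j + 1 = L \<and> (E ^^ i) x z \<and> z \<in> X \<and> E z z' \<and> z' \<notin> X \<and> (E ^^ j) z' y"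
proof (induction L arbitrary: x)
  case (Suc L)
  then obtain x1 where x1: "E x x1" "(E ^^ L) x1 y"
    by (meson relpowp_Suc_D2)
  show ?case
  proof (cases "x1 \<in> X")
    case True
    with Suc.IH[OF x1(2) True] Suc.prems obtain i j z z' where
      "i + j + 1 = L" "(E ^^ i) x1 z" "z \<in> X" "E z z'" "z' \<notin> X" "(E ^^ j) z' y" by metis
    moreover from this have "(E ^^ Suc i) x z"
      using relpowp_Suc_I2[of E x x1 i z] x1(1) by blast
    ultimately show ?thesis by (metis add_Suc)
  next
    case False
    then show ?thesis using x1 Suc.prems
      by (intro exI[of _ 0] exI[of _ L] exI[of _ x] exI[of _ x1]) auto
  qed
qed auto

text \<open>Distances are integers, so being at most \<open>R\<close> is being less than
  \<open>R + 1\<close>, and an infimum strictly below a bound has a witness. For empty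
  \<open>S\<close> the infimum is infinite and both sides are false.\<close>

lemma dist_set_le_iff: "dist_set d x S \<le> enat R \<longleftrightarrow> (\<exists>y\<in>S. d x y \<le> R)"
proof -
  have "e \<le> enat R \<longleftrightarrow> e < enat (Suc R)" for e
    by (cases e) auto
  then have "dist_set d x S \<le> enat R \<longleftrightarrow> (\<exists>y\<in>S. enat (d x y) < enat (Suc R))"
    unfolding dist_set_def by (simp only: INF_less_iff)
  then show ?thesis by (simp add: less_Suc_eq_le)
qed

lemma mem_outer: "x \<in> outer d X R \<longleftrightarrow> (\<exists>y\<in>X. d x y \<le> R)"
  by (simp add: outer_def dist_set_le_iff)

lemma mem_inner: "x \<in> Defs.inner d X R \<longleftrightarrow> (\<exists>y\<in>-X. d x y \<le> R)"
  by (simp add: inner_def dist_set_le_iff)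

text \<open>This turns the monotonicity of the shells into the bound |\<partial>X| for each of
  them.\<close>

lemma bdry_eq_shell: "bdry d X = Defs.inner d X 1 - Defs.inner d X 0"
proof -
  have "dist_set d x (- X) = 1 \<longleftrightarrow> dist_set d x (- X) \<le> enat 1 \<and> \<not> dist_set d x (- X) \<le> enat 0" for x
    by (cases "dist_set d x (- X)") (auto simp: one_enat_def zero_enat_def)
  moreover have "dist_set d x (- X) \<le> enat 0" if "x \<notin> X" for x
    using that by (auto simp: dist_set_le_iff intro!: bexI[of _ x] dist_self)
  ultimately show ?thesis by (auto simp: bdry_def inner_def)
qed

text \<open>A shortest path crosses the surface along an edge: it has at least \<open>n\<close>
  edges before the crossing and at least \<open>m\<close> after it, and the crossing edge makes the
  inequality strict. In a general metric space only the maximum of the two depths would be a lower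
  bound; the sum needs paths.\<close>

lemma dist_exit:
  assumes "x \<in> X" "y \<notin> X" "x \<notin> Defs.inner d X n" "y \<notin> outer d X m"
  shows "n + m < d x y"
proof -
  from path_exit[OF path_of_dist assms(1,2)] obtain i j z z' where
    *: "i + j + 1 = d x y" "(E ^^ i) x z" "z \<in> X" "E z z'" "z' \<notin> X" "(E ^^ j) z' y" by metis
  have "d x z' \<le> i + 1" "d z y \<le> Suc j"
    using dist_le_path[OF relpowp_Suc_I[OF *(2,4)]] dist_le_path[OF relpowp_Suc_I2[OF *(4,6)]] by auto
  moreover have "n < d x z'" using assms(3) *(5) by (auto simp: mem_inner not_le)
  moreover have "m < d z y" using assms(4) *(3) by (auto simp: mem_outer not_le dist_sym[of z])
  ultimately show ?thesis using *(1) by linarith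
qed

section \<open>Depth inside a set and sums over its shells\<close>

definition depth :: "'a set \<Rightarrow> 'a \<Rightarrow> nat" where
  "depth X x = (LEAST n. x \<in> Defs.inner d X n)"

lemma depth_shell:
  assumes "x \<in> X" "- X \<noteq> {}"
  shows "1 \<le> depth X x" "x \<in> Defs.inner d X (depth X x) - Defs.inner d X (depth X x - 1)"
proof -
  from assms obtain y where "y \<in> - X" by auto
  then have "x \<in> Defs.inner d X (d x y)" by (auto simp: mem_inner)
  then have in_depth: "x \<in> Defs.inner d X (depth X x)" unfolding depth_def by (rule LeastI)
  have "\<not> x \<in> Defs.inner d X 0"
    using assms path_of_dist[of x] by (auto simp: mem_inner) (metis relpowp_0_E)
  then show *: "1 \<le> depth X x" using in_depth by (metis less_one not_le)
  then show "x \<in> Defs.inner d X (depth X x) - Defs.inner d X (depth X x - 1)"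
    using in_depth not_less_Least[of "depth X x - 1" "\<lambda>n. x \<in> Defs.inner d X n"] by (auto simp: depth_def)
qed

lemma depth_dist_le: "y \<notin> X \<Longrightarrow> depth X x \<le> d x y"
  unfolding depth_def by (rule Least_le) (auto simp: mem_inner)

lemma inner_mono: "n \<le> m \<Longrightarrow> Defs.inner d X n \<subseteq> Defs.inner d X m"
  by (auto simp: mem_inner) (meson ComplI order_trans)

lemma outer_mono: "n \<le> m \<Longrightarrow> outer d X n \<subseteq> outer d X m"
  by (auto simp: mem_outer) (meson order_trans)

lemma shell_subset: "1 \<le> n \<Longrightarrow> Defs.inner d X n - Defs.inner d X (n - 1) \<subseteq> X"
  by (auto simp: mem_inner) (metis ComplI dist_self le0)

text \<open>\<open>dist_exit\<close> applies with \<open>depth X x - 1\<close>, and its strict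
  inequality gives the unit back. As depths start at 1, the gap is at least \<open>m + 1\<close>,
  the first index in \<zeta>(m).\<close>

lemma depth_dist_gap:
  assumes "x \<in> X" "y \<notin> X" "y \<notin> outer d X m"
  shows "depth X x + m \<le> d x y"
proof -
  have "1 \<le> depth X x" "x \<notin> Defs.inner d X (depth X x - 1)"
    using depth_shell[OF assms(1)] assms(2) by auto
  then show ?thesis using dist_exit[OF assms(1,2) _ assms(3), of "depth X x - 1"] by linarith
qed

text \<open>Outside the \<open>n\<close>-boundary a point is farther than \<open>n\<close> from
  \<open>X\<close> or farther than \<open>n\<close> from the complement, while \<open>x\<close> is
  within \<open>m\<close> of both.\<close>

lemma bdryR_dist:
  assumes "x \<in> bdryR d X m" "y \<notin> bdryR d X n" "y \<in> \<Lambda>" "m \<le> n"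
  shows "n - m < d x y"
proof (cases "y \<in> outer d X n")
  case False
  obtain z where z: "z \<in> X" "d x z \<le> m" using assms(1) by (auto simp: bdryR_def mem_outer)
  then have "n < d y z" using False by (auto simp: mem_outer not_le)
  then show ?thesis using dist_triangle[of y z x] z dist_sym[of x y] assms(4) by arith
next
  case True
  then have n: "y \<notin> Defs.inner d X n" using assms(2) by (auto simp: bdryR_def)
  obtain z where z: "z \<in> - X" "d x z \<le> m" using assms(1) by (auto simp: bdryR_def mem_inner)
  then have "n < d y z" using n by (auto simp: mem_inner not_le)
  then show ?thesis using dist_triangle[of y z x] z dist_sym[of x y] assms(4) by arith
qed

text \<open>Points are grouped by depth, at most |\<partial>X| in each group. As \<open>h\<close> is
  injective, different depths use different terms of the series \<zeta>(\<rho>). Two choices of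
  \<open>h\<close> occur: the shift by \<rho> on all of \<open>X\<close>, and the identity on points
  deeper than \<rho>.\<close>

lemma sum_depth_le:
  fixes \<xi> :: "real \<Rightarrow> real" and h :: "nat \<Rightarrow> nat"
  assumes shells: "\<And>n. 1 \<le> n \<Longrightarrow> card (Defs.inner d X n - Defs.inner d X (n - 1)) \<le> card (bdry d X)"
    and X: "finite X" "- X \<noteq> {}" and A: "A \<subseteq> X"
    and \<xi>: "\<And>r. 0 \<le> r \<Longrightarrow> 0 \<le> \<xi> r" and sm: "summable (\<lambda>n. \<xi> (real (n + \<rho> + 1)))"
    and h: "inj h" "\<And>x. x \<in> A \<Longrightarrow> \<rho> + 1 \<le> h (depth X x)"
  shows "(\<Sum>x\<in>A. \<xi> (real (h (depth X x)))) \<le> real (card (bdry d X)) * zeta \<xi> \<rho>"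
proof -
  have finA: "finite A" using A X finite_subset by blast
  have "(\<Sum>x\<in>A. \<xi> (real (h (depth X x)))) = (\<Sum>n\<in>depth X ` A. \<Sum>x\<in>{x\<in>A. depth X x = n}. \<xi> (real (h (depth X x))))"
    by (rule sum.image_gen[OF finA])
  also have "\<dots> = (\<Sum>n\<in>depth X ` A. real (card {x\<in>A. depth X x = n}) * \<xi> (real (h n)))"
    by (intro sum.cong refl) simp
  also have "\<dots> \<le> (\<Sum>n\<in>depth X ` A. real (card (bdry d X)) * \<xi> (real (h n)))"
  proof (intro sum_mono mult_right_mono \<xi>)
    fix n assume "n \<in> depth X ` A"
    then have n: "1 \<le> n" using depth_shell(1)[OF _ X(2)] A by blast
    have "{x\<in>A. depth X x = n} \<subseteq> Defs.inner d X n - Defs.inner d X (n - 1)"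
      using depth_shell(2)[OF _ X(2)] A by blast
    moreover have "finite (Defs.inner d X n - Defs.inner d X (n - 1))"
      using shell_subset[OF n] X finite_subset by blast
    ultimately have "card {x\<in>A. depth X x = n} \<le> card (Defs.inner d X n - Defs.inner d X (n - 1))"
      by (rule card_mono[rotated])
    with shells[OF n] show "real (card {x\<in>A. depth X x = n}) \<le> real (card (bdry d X))" by linarith
  qed auto
  also have "\<dots> = real (card (bdry d X)) * (\<Sum>n\<in>depth X ` A. \<xi> (real (h n)))"
    by (simp add: sum_distrib_left)
  \<comment> \<open>At every depth that occurs, \<open>h n\<close> is at least
    \<open>\<rho> + 1\<close>, so the truncated subtraction recovers the index of the
    series.\<close>
  also have "(\<Sum>n\<in>depth X ` A. \<xi> (real (h n))) = (\<Sum>k\<in>(\<lambda>n. h n - (\<rho> + 1)) ` depth X ` A. \<xi> (real (k + \<rho> + 1)))"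
  proof -
    have shift: "h n - (\<rho> + 1) + \<rho> + 1 = h n" if "n \<in> depth X ` A" for n
    proof -
      have "\<rho> + 1 \<le> h n" using h(2) that by blast
      then show ?thesis by linarith
    qed
    have "inj_on (\<lambda>n. h n - (\<rho> + 1)) (depth X ` A)"
    proof (rule inj_onI)
      fix m n assume "m \<in> depth X ` A" "n \<in> depth X ` A" "h m - (\<rho> + 1) = h n - (\<rho> + 1)"
      then have "h m = h n" using shift by metis
      then show "m = n" using h(1) by (simp add: inj_eq)
    qed
    from sum.reindex[OF this, of "\<lambda>k. \<xi> (real (k + \<rho> + 1))"] show ?thesis
      unfolding o_def by (simp only: shift cong: sum.cong)
  qed
  also have "\<dots> \<le> zeta \<xi> \<rho>"
    unfolding zeta_def using finA \<xi> by (intro sum_le_suminf sm) auto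
  finally show ?thesis by (simp add: mult_left_mono)
qed

end

section \<open>Finite sums from the extended norms\<close>

lemma ennreal_sum_le_infsum:
  fixes g :: "'b \<Rightarrow> ennreal"
  assumes "finite B" "B \<subseteq> A"
  shows "(\<Sum>y\<in>B. g y) \<le> (\<Sum>\<^sub>\<infinity>y\<in>A. g y)"
proof -
  have "(\<Sum>y\<in>B. g y) = infsum g B" using assms by simp
  also have "\<dots> \<le> infsum g A"
    using assms by (intro infsum_mono_neutral nonneg_summable_on_complete) auto
  finally show ?thesis .
qed

lemma sum_le_normF:
  assumes "normF d F < \<infinity>" "\<forall>r\<ge>0. F r > 0" "finite B"
  shows "(\<Sum>y\<in>B. F (real (d x y))) \<le> enn2real (normF d F)"
proof -
  have nn: "0 \<le> F (real (d x y))" for y using assms(2) by (simp add: less_imp_le)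
  have "ennreal (\<Sum>y\<in>B. F (real (d x y))) = (\<Sum>y\<in>B. ennreal (F (real (d x y))))"
    by (simp add: nn sum_ennreal)
  also have "\<dots> \<le> (\<Sum>\<^sub>\<infinity>y. ennreal (F (real (d x y))))"
    using assms by (intro ennreal_sum_le_infsum) auto
  also have "\<dots> \<le> normF d F" unfolding normF_def by (rule SUP_upper) simp
  finally have "enn2real (ennreal (\<Sum>y\<in>B. F (real (d x y)))) \<le> enn2real (normF d F)"
    using assms by (intro enn2real_mono) auto
  then show ?thesis by (simp add: nn sum_nonneg)
qed

lemma sum_le_constC:
  assumes "constC d F < \<infinity>" "\<forall>r\<ge>0. F r > 0" "finite B"
  shows "(\<Sum>y\<in>B. F (real (d x y)) * F (real (d y z))) \<le> enn2real (constC d F) * F (real (d x z))"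
proof -
  let ?g = "\<lambda>y. F (real (d x y)) * F (real (d y z)) / F (real (d x z))"
  have pos: "0 < F (real (d x y))" for x y using assms(2) by simp
  then have nn: "0 \<le> ?g y" for y by (simp add: less_imp_le)
  have "ennreal (\<Sum>y\<in>B. ?g y) = (\<Sum>y\<in>B. ennreal (?g y))"
    by (simp add: nn sum_ennreal)
  also have "\<dots> \<le> (\<Sum>\<^sub>\<infinity>y. ennreal (?g y))"
    using assms by (intro ennreal_sum_le_infsum) auto
  also have "\<dots> \<le> constC d F" unfolding constC_def by (rule SUP_upper2[of x], simp, rule SUP_upper, simp)
  finally have "enn2real (ennreal (\<Sum>y\<in>B. ?g y)) \<le> enn2real (constC d F)"
    using assms by (intro enn2real_mono) auto
  then have "(\<Sum>y\<in>B. ?g y) \<le> enn2real (constC d F)" by (simp add: nn sum_nonneg)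
  then have "(\<Sum>y\<in>B. F (real (d x y)) * F (real (d y z))) / F (real (d x z)) \<le> enn2real (constC d F)"
    by (simp add: sum_divide_distrib)
  then show ?thesis using pos by (simp add: pos_divide_le_eq)
qed

text \<open>\<open>enn2real\<close> sends an infinite supremum to 0; for finite nonempty
  \<open>Z\<close> the finiteness of \<open>normPsi\<close> rules this out.\<close>

definition sup_norm :: "('a \<Rightarrow> nat) \<Rightarrow> real \<Rightarrow> ('a set \<Rightarrow> real \<Rightarrow> 'a op) \<Rightarrow> 'a set \<Rightarrow> real" where
  "sup_norm dm T \<Psi> Z = enn2real (SUP t\<in>{-T..T}. ennreal (opnorm dm Z (\<Psi> Z t)))"

lemma normPsi_upper:
  assumes "finite \<W>" "\<And>Z. Z \<in> \<W> \<Longrightarrow> finite Z \<and> x \<in> Z \<and> y \<in> Z" "\<forall>r\<ge>0. Fxi F \<xi> r > 0"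
  shows "(\<Sum>Z\<in>\<W>. SUP t\<in>{-T..T}. ennreal (opnorm dm Z (\<Psi> Z t)))
    \<le> normPsi dm d F \<xi> T \<Psi> * ennreal (Fxi F \<xi> (real (d x y)))"
proof -
  let ?f = "Fxi F \<xi> (real (d x y))"
  let ?g = "\<lambda>Z. SUP t\<in>{-T..T}. ennreal (opnorm dm Z (\<Psi> Z t))"
  have pos: "0 < ?f" using assms(3) by simp
  have "(\<Sum>Z\<in>\<W>. ?g Z) \<le> (\<Sum>\<^sub>\<infinity>Z\<in>{Z. finite Z \<and> x \<in> Z \<and> y \<in> Z}. ?g Z)"
    using assms by (intro ennreal_sum_le_infsum) auto
  also have "\<dots> = ennreal ?f * (ennreal (1 / ?f) * (\<Sum>\<^sub>\<infinity>Z\<in>{Z. finite Z \<and> x \<in> Z \<and> y \<in> Z}. ?g Z))"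
    using pos by (simp add: mult.assoc[symmetric] ennreal_mult[symmetric])
  also have "\<dots> \<le> ennreal ?f * normPsi dm d F \<xi> T \<Psi>"
    unfolding normPsi_def by (intro mult_left_mono SUP_upper2[of x] SUP_upper2[of y]) auto
  finally show ?thesis by (simp add: mult.commute)
qed

lemma opnorm_le_sup_norm:
  assumes "normPsi dm d F \<xi> T \<Psi> < \<infinity>" "\<forall>r\<ge>0. Fxi F \<xi> r > 0" "finite Z" "Z \<noteq> {}" "t \<in> {-T..T}"
  shows "opnorm dm Z (\<Psi> Z t) \<le> sup_norm dm T \<Psi> Z"
proof -
  let ?S = "SUP t\<in>{-T..T}. ennreal (opnorm dm Z (\<Psi> Z t))"
  obtain x where "x \<in> Z" using assms by auto
  then have "?S \<le> normPsi dm d F \<xi> T \<Psi> * ennreal (Fxi F \<xi> (real (d x x)))"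
    using normPsi_upper[where \<W> = "{Z}" and x = x and y = x and F = F and \<xi> = \<xi> and T = T and dm = dm and \<Psi> = \<Psi> and d = d] assms by simp
  also have "\<dots> < \<infinity>" using assms by (simp add: ennreal_mult_less_top)
  finally have "?S < \<infinity>" .
  moreover have "ennreal (opnorm dm Z (\<Psi> Z t)) \<le> ?S"
    using assms by (intro SUP_upper)
  ultimately have "enn2real (ennreal (opnorm dm Z (\<Psi> Z t))) \<le> enn2real ?S"
    by (intro enn2real_mono) auto
  moreover have "0 \<le> opnorm dm Z (\<Psi> Z t)"
    by (simp add: opnorm_eq_norm assms)
  ultimately show ?thesis by (simp add: sup_norm_def)
qed

lemma sum_sup_norm_le:
  assumes "normPsi dm d F \<xi> T \<Psi> < \<infinity>" "\<forall>r\<ge>0. Fxi F \<xi> r > 0"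
    and "finite \<W>" "\<And>Z. Z \<in> \<W> \<Longrightarrow> finite Z \<and> x \<in> Z \<and> y \<in> Z"
  shows "(\<Sum>Z\<in>\<W>. sup_norm dm T \<Psi> Z) \<le> enn2real (normPsi dm d F \<xi> T \<Psi>) * Fxi F \<xi> (real (d x y))"
proof -
  let ?g = "\<lambda>Z. SUP t\<in>{-T..T}. ennreal (opnorm dm Z (\<Psi> Z t))"
  have le: "(\<Sum>Z\<in>\<W>. ?g Z) \<le> normPsi dm d F \<xi> T \<Psi> * ennreal (Fxi F \<xi> (real (d x y)))"
    by (rule normPsi_upper) (use assms in auto)
  also have fin: "\<dots> < \<infinity>" using assms by (simp add: ennreal_mult_less_top)
  \<comment> \<open>The finite total makes every summand finite, and only then does
    \<open>enn2real\<close> commute with the sum.\<close>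
  finally have "?g Z < top" if "Z \<in> \<W>" for Z
    using that assms(3) by (simp add: less_top)
  then have "(\<Sum>Z\<in>\<W>. sup_norm dm T \<Psi> Z) = enn2real (\<Sum>Z\<in>\<W>. ?g Z)"
    unfolding sup_norm_def by (subst enn2real_sum) (auto simp: o_def)
  also have "\<dots> \<le> enn2real (normPsi dm d F \<xi> T \<Psi> * ennreal (Fxi F \<xi> (real (d x y))))"
    using le fin by (intro enn2real_mono) auto
  also have "\<dots> = enn2real (normPsi dm d F \<xi> T \<Psi>) * Fxi F \<xi> (real (d x y))"
    using assms(2) by (simp add: enn2real_mult less_imp_le)
  finally show ?thesis .
qed


section \<open>Decoupling of the dynamics along a surface\<close>

text \<open>Compare \<open>ut\<close> with \<open>(u \<Lambda>)\<^sup>* (u X) (u (\<Lambda> - X))\<close> through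
  \<open>g = (u (\<Lambda> - X))\<^sup>* (u X)\<^sup>* (u \<Lambda>) ut\<close>, which satisfies \<open>g s = 1\<close> and whose derivative is
  a product of isometries with the difference of the two Heisenberg-evolved surface terms.\<close>

lemma (in local_dynamics) decoupling:
  assumes X: "X \<subseteq> \<Lambda>" and Y: "Y \<subseteq> \<Lambda>" and P: "P \<subseteq> \<Lambda>"
    and s: "s \<in> {-T..T}" and t: "t \<in> {-T..T}"
    and ut_s: "ut s = 1"
    and ut_deriv: "\<And>r. r \<in> {-T..T} \<Longrightarrow>
      (ut has_vector_derivative w Y r s * S r * u Y r s * ut r) (at r within {-T..T})"
    and ut_norm: "\<And>r. r \<in> {-T..T} \<Longrightarrow> norm (ut r) \<le> 1"
    and S_loc: "\<And>r. S r \<in> loc P"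
    and comm_X: "\<And>r. r \<in> {-T..T} \<Longrightarrow> w X r s * gen (\<Lambda> - X) r = gen (\<Lambda> - X) r * w X r s"
    and rest: "\<And>r. r \<in> {-T..T} \<Longrightarrow> norm (gen \<Lambda> r - gen X r - gen (\<Lambda> - X) r - S r) \<le> a"
    and S_norm: "\<And>r. r \<in> {-T..T} \<Longrightarrow> norm (S r) \<le> b"
  shows "norm (ut t * (w (\<Lambda> - X) t s * w X t s) - w \<Lambda> t s)
    \<le> \<bar>t - s\<bar> * (a + b * ((exp (2 * N * C * \<bar>t - s\<bar>) - 1) / C) * inter_sum P (\<Lambda> - Y))"
proof -
  have X': "\<Lambda> - X \<subseteq> \<Lambda>" by auto
  note prY = prop_gen[OF Y] and prL = prop_gen[OF order_refl] and prX = prop_gen[OF X] and prC = prop_gen[OF X']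
  define v where "v r = u X r s * u (\<Lambda> - X) r s" for r
  define wv where "wv r = w (\<Lambda> - X) r s * w X r s" for r
  define full where "full r = gen \<Lambda> r - gen X r - gen (\<Lambda> - X) r" for r
  define \<delta> where "\<delta> r = w \<Lambda> r s * full r * u \<Lambda> r s - w Y r s * S r * u Y r s" for r
  define g where "g r = wv r * u \<Lambda> r s * ut r" for r
  define g' where "g' r = - (wv r * u \<Lambda> r s * \<delta> r * ut r)" for r
  define M where "M = a + b * ((exp (2 * N * C * \<bar>t - s\<bar>) - 1) / C) * inter_sum P (\<Lambda> - Y)"
  have u_cancel: "u \<Lambda> r s * (w \<Lambda> r s * x) = x" if "r \<in> {-T..T}" for r x
    using propagator_inverse(2)[OF prL s that] by (simp add: mult.assoc[symmetric])
  have wv_deriv: "(wv has_vector_derivative wv r * (gen X r + gen (\<Lambda> - X) r)) (at r within {-T..T})"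
    if r: "r \<in> {-T..T}" for r
  proof -
    have "(wv has_vector_derivative w (\<Lambda> - X) r s * (w X r s * gen X r)
        + (w (\<Lambda> - X) r s * gen (\<Lambda> - X) r) * w X r s) (at r within {-T..T})"
      unfolding wv_def by (intro has_vector_derivative_mult propagator_deriv[OF prC] propagator_deriv[OF prX] r s)
    then show ?thesis
      by (simp add: wv_def algebra_simps comm_X[OF r])
  qed
  have g_deriv: "(g has_vector_derivative g' r) (at r within {-T..T})" if r: "r \<in> {-T..T}" for r
  proof -
    have "(g has_vector_derivative wv r * u \<Lambda> r s * (w Y r s * S r * u Y r s * ut r)
        + (wv r * - (gen \<Lambda> r * u \<Lambda> r s) + wv r * (gen X r + gen (\<Lambda> - X) r) * u \<Lambda> r s) * ut r)
        (at r within {-T..T})"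
      unfolding g_def
      by (intro has_vector_derivative_mult propagator_deriv[OF prL] wv_deriv ut_deriv r s)
    then show ?thesis
      by (simp add: g'_def \<delta>_def full_def algebra_simps u_cancel[OF r])
  qed
  have wv_norm: "norm (wv r * x) \<le> norm x" if r: "r \<in> {-T..T}" for r x
  proof -
    have "norm (wv r * x) = norm (w (\<Lambda> - X) r s * (w X r s * x))"
      by (simp add: wv_def mult.assoc)
    also have "\<dots> \<le> 1 * (1 * norm x)"
      by (intro order_trans[OF norm_mult_ineq] mult_mono propagator_norm(2)[OF prC s r]
          propagator_norm(2)[OF prX s r]) auto
    finally show ?thesis by simp
  qed
  have v_norm: "norm (w \<Lambda> t s * v t * x * wv t) \<le> norm x" for x
  proof -
    have "norm (w \<Lambda> t s * v t * x * wv t) = norm (w \<Lambda> t s * (u X t s * (u (\<Lambda> - X) t s * (x * (w (\<Lambda> - X) t s * w X t s)))))"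
      by (simp add: wv_def v_def mult.assoc)
    also have "\<dots> \<le> 1 * (1 * (1 * (norm x * (1 * 1))))"
      by (intro order_trans[OF norm_mult_ineq] mult_mono propagator_norm[OF prC s t]
          propagator_norm[OF prX s t] propagator_norm[OF prL s t] order_refl) auto
    finally show ?thesis by simp
  qed
  have \<delta>_norm: "norm (\<delta> r) \<le> M" if r: "r \<in> {-T..T}" and le: "\<bar>r - s\<bar> \<le> \<bar>t - s\<bar>" for r
  proof -
    \<comment> \<open>Insert the surface term evolved by the full dynamics: the first part contains
      only the discarded terms, the second only the change of dynamics from \<Lambda> to
      \<open>Y\<close>.\<close>
    have "norm (\<delta> r) \<le> norm (w \<Lambda> r s * (full r - S r) * u \<Lambda> r s)
        + norm (w \<Lambda> r s * S r * u \<Lambda> r s - w Y r s * S r * u Y r s)"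
      unfolding \<delta>_def by (rule order_trans[OF _ norm_triangle_ineq]) (simp add: algebra_simps)
    also have "\<dots> \<le> a + norm (S r) * ((exp (2 * N * C * \<bar>r - s\<bar>) - 1) / C) * inter_sum P (\<Lambda> - Y)"
      using rest[OF r] norm_conjugate_le(1)[OF prL s r, of "full r - S r"]
      by (intro add_mono local_dynamics_approx Y P S_loc s r) (auto simp: full_def)
    also have "norm (S r) * ((exp (2 * N * C * \<bar>r - s\<bar>) - 1) / C) * inter_sum P (\<Lambda> - Y)
        \<le> b * ((exp (2 * N * C * \<bar>t - s\<bar>) - 1) / C) * inter_sum P (\<Lambda> - Y)"
    proof (intro mult_right_mono mult_mono S_norm r inter_sum_nonneg exp_factor_nonneg)
      show "(exp (2 * N * C * \<bar>r - s\<bar>) - 1) / C \<le> (exp (2 * N * C * \<bar>t - s\<bar>) - 1) / C"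
        using le C_pos N_nonneg by (intro divide_right_mono diff_right_mono) (auto intro!: mult_left_mono)
      show "0 \<le> b" using S_norm[OF r] norm_ge_zero order_trans by blast
    qed auto
    finally show ?thesis by (simp add: M_def)
  qed
  \<comment> \<open>The exponential is frozen at its value for the final time instead of being
    integrated; hence the factor \<open>\<bar>t - s\<bar>\<close> next to it in the theorem.\<close>
  have "norm (g t - g s) \<le> M * \<bar>t - s\<bar> - M * 0"
  proof (rule norm_le_of_deriv_le[OF g_deriv _ _ s t])
    show "((\<lambda>x. M * x) has_real_derivative M) (at x)" for x
      by (auto intro!: derivative_eq_intros)
    fix r assume r: "r \<in> {-T..T}" "\<bar>r - s\<bar> \<le> \<bar>t - s\<bar>"
    have "norm (g' r) = norm (wv r * (u \<Lambda> r s * (\<delta> r * ut r)))"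
      by (simp add: g'_def mult.assoc)
    also have "\<dots> \<le> norm (u \<Lambda> r s * (\<delta> r * ut r))"
      by (rule wv_norm[OF r(1)])
    also have "\<dots> \<le> 1 * (norm (\<delta> r) * 1)"
      by (intro order_trans[OF norm_mult_ineq] mult_mono propagator_norm[OF prL s r(1)] ut_norm r order_refl) auto
    finally show "norm (g' r) \<le> M" using \<delta>_norm[OF r] by simp
  qed
  then have g: "norm (g t - 1) \<le> \<bar>t - s\<bar> * M"
    using ut_s propagator_refl[OF prL s] propagator_refl[OF prX s] propagator_refl[OF prC s]
    by (simp add: g_def wv_def mult.commute)
  have v1: "v t * wv t = 1" "v t * (wv t * x) = x" for x
  proof -
    have "v t * wv t = u X t s * ((u (\<Lambda> - X) t s * w (\<Lambda> - X) t s) * w X t s)"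
      by (simp add: v_def wv_def mult.assoc)
    then show "v t * wv t = 1"
      by (simp add: propagator_inverse[OF prC s t] propagator_inverse[OF prX s t])
    then show "v t * (wv t * x) = x" by (simp add: mult.assoc[symmetric])
  qed
  have "w \<Lambda> t s * (u \<Lambda> t s * x) = x" for x
    using propagator_inverse(1)[OF prL s t] by (simp add: mult.assoc[symmetric])
  \<comment> \<open>Undo the factors in front of \<open>ut\<close> in \<open>g\<close> and multiply
    by \<open>wv\<close> on the right; all factors used are contractions.\<close>
  then have "ut t * wv t - w \<Lambda> t s = w \<Lambda> t s * v t * (g t - 1) * wv t"
    by (simp add: g_def algebra_simps v1)
  then have "norm (ut t * wv t - w \<Lambda> t s) \<le> norm (g t - 1)"
    using v_norm by simp
  then show ?thesis using g by (simp add: wv_def M_def)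
qed

section \<open>Interactions with decay\<close>

lemma normF_mono:
  assumes "\<And>r. 0 \<le> r \<Longrightarrow> F r \<le> F' r"
  shows "normF d F \<le> normF d F'"
  unfolding normF_def
  by (intro SUP_mono' infsum_mono nonneg_summable_on_complete ennreal_leI assms) auto

locale spin_interaction =
  fixes E :: "'a \<Rightarrow> 'a \<Rightarrow> bool" and d :: "'a \<Rightarrow> 'a \<Rightarrow> nat"
    and F \<xi> :: "real \<Rightarrow> real" and T :: real and dm :: "'a \<Rightarrow> nat"
    and \<Psi> :: "'a set \<Rightarrow> real \<Rightarrow> 'a op"
    and U :: "'a set \<Rightarrow> real \<Rightarrow> real \<Rightarrow> 'a op" and \<Lambda> :: "'a set"
  assumes graph: "graph_distance E d"
    and F_pos: "\<forall>r\<ge>0. F r > 0"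
    and F_norm: "normF d F < \<infinity>"
    and F_conv: "constC d F < \<infinity>"
    and xi_pos: "\<forall>r\<ge>0. \<xi> r > 0"
    and xi_mono: "\<forall>a b. 0 \<le> a \<longrightarrow> a \<le> b \<longrightarrow> \<xi> b \<le> \<xi> a"
    and xi_supmult: "\<forall>a b. 0 \<le> a \<longrightarrow> 0 \<le> b \<longrightarrow> \<xi> (a + b) \<ge> \<xi> a * \<xi> b"
    and xi_decay: "\<forall>n::nat. ((\<lambda>r. \<xi> r * r ^ n) \<longlongrightarrow> 0) at_top"
    and Psi_sa: "\<forall>Z r. finite Z \<longrightarrow> Z \<noteq> {} \<longrightarrow> r \<in> {-T..T} \<longrightarrow>
                   (\<forall>\<sigma>\<in>confs dm Z. \<forall>\<tau>\<in>confs dm Z. \<Psi> Z r \<sigma> \<tau> = cnj (\<Psi> Z r \<tau> \<sigma>))"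
    and Psi_norm: "normPsi dm d F \<xi> T \<Psi> < \<infinity>"
    and U_sol: "\<forall>\<Lambda>'. finite \<Lambda>' \<longrightarrow>
                  solves dm \<Lambda>' T (- \<i>) (\<lambda>r _. Ham dm \<Psi> \<Lambda>' r) (U \<Lambda>')"
    and Lam_fin: "finite \<Lambda>"
begin

abbreviation "p \<equiv> sup_norm dm T \<Psi>"
abbreviation "f x y \<equiv> Fxi F \<xi> (real (d x y))"
abbreviation "N \<equiv> enn2real (normPsi dm d F \<xi> T \<Psi>)"
abbreviation "C \<equiv> enn2real (constC d (Fxi F \<xi>))"
abbreviation "\<ll> Z \<equiv> lop dm \<Lambda> Z"
abbreviation "\<mu> Z \<equiv> ulop dm \<Lambda> Z"

text \<open>The factor \<open>\<i>\<close> is part of the matrix because the operator algebra has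
  real scalars only.\<close>

definition \<psi> :: "'a set \<Rightarrow> real \<Rightarrow> 'a cfg fvec bop" where
  "\<psi> Z r = lop dm \<Lambda> Z (\<lambda>\<sigma> \<tau>. \<i> * \<Psi> Z r \<sigma> \<tau>)"

lemma Fxi_pos: "\<forall>r\<ge>0. Fxi F \<xi> r > 0"
  using F_pos xi_pos by (simp add: Fxi_def)

text \<open>Supermultiplicativity at 0 says that \<xi>(0) is at least its own square.\<close>

lemma xi_le_1: "0 \<le> r \<Longrightarrow> \<xi> r \<le> 1"
proof -
  assume r: "0 \<le> r"
  have "\<xi> 0 * \<xi> 0 \<le> \<xi> 0 * 1" using xi_supmult[rule_format, of 0 0] by simp
  then have "\<xi> 0 \<le> 1" using xi_pos by (simp add: mult_le_cancel_left)
  then show "\<xi> r \<le> 1" using xi_mono r by (meson order_refl order_trans)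
qed

lemma Fxi_norm: "normF d (Fxi F \<xi>) < \<infinity>"
proof -
  have "normF d (Fxi F \<xi>) \<le> normF d F"
    using F_pos xi_le_1 by (intro normF_mono) (simp add: Fxi_def mult_left_le less_imp_le)
  then show ?thesis using F_norm by (rule le_less_trans)
qed

text \<open>Supermultiplicativity, the triangle inequality and monotonicity bound the quotient of
  the \<xi> factors by 1, so C_\<xi> is at most C_F.\<close>

lemma Fxi_conv: "constC d (Fxi F \<xi>) < \<infinity>"
proof -
  have "Fxi F \<xi> (real (d x y)) * Fxi F \<xi> (real (d y z)) / Fxi F \<xi> (real (d x z))
      \<le> F (real (d x y)) * F (real (d y z)) / F (real (d x z))" for x y z
  proof -
    have "\<xi> (real (d x y)) * \<xi> (real (d y z)) \<le> \<xi> (real (d x y) + real (d y z))"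
      using xi_supmult by simp
    also have "\<dots> \<le> \<xi> (real (d x z))"
      using xi_mono dist_triangle[OF graph, of x z y] by simp
    finally have "\<xi> (real (d x y)) * \<xi> (real (d y z)) / \<xi> (real (d x z)) \<le> 1"
      using xi_pos by simp
    then have "F (real (d x y)) * F (real (d y z)) / F (real (d x z))
        * (\<xi> (real (d x y)) * \<xi> (real (d y z)) / \<xi> (real (d x z)))
      \<le> F (real (d x y)) * F (real (d y z)) / F (real (d x z))"
      using F_pos by (intro mult_left_le) (auto simp: less_imp_le)
    then show ?thesis by (simp add: Fxi_def algebra_simps)
  qed
  then have "constC d (Fxi F \<xi>) \<le> constC d F"
    unfolding constC_def
    by (intro SUP_mono' infsum_mono nonneg_summable_on_complete ennreal_leI) auto
  then show ?thesis using F_conv by (rule le_less_trans)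
qed

text \<open>The single term with all three sites equal already gives F_\<xi>(0) as a lower
  bound.\<close>

lemma C_pos: "0 < C"
proof -
  fix x :: 'a
  have pos: "0 < f x x" using Fxi_pos by simp
  have "f x x * f x x \<le> C * f x x"
    using sum_le_constC[OF Fxi_conv Fxi_pos, of "{x}" x x] by simp
  then have "f x x \<le> C" using pos by simp
  then show ?thesis using pos by linarith
qed

lemma summable_xi: "summable (\<lambda>n. \<xi> (real (n + \<rho> + 1)))"
proof -
  have "((\<lambda>n. \<xi> (real n) * real n ^ 2) \<longlongrightarrow> 0) sequentially"
    using xi_decay[rule_format, of 2] filterlim_real_sequentially by (rule filterlim_compose)
  then have "\<forall>\<^sub>F n in sequentially. \<xi> (real n) * real n ^ 2 < 1"
    by (rule order_tendstoD) simp
  then have "\<forall>\<^sub>F n in sequentially. norm (\<xi> (real n)) \<le> inverse (real n ^ 2)"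
    using eventually_gt_at_top[of 0]
  proof eventually_elim
    case (elim n)
    moreover have "0 < \<xi> (real n)" using xi_pos by simp
    ultimately show ?case by (simp add: field_simps)
  qed
  then have "summable (\<lambda>n. \<xi> (real n))"
    by (rule summable_comparison_test_ev) (rule inverse_power_summable, simp)
  then show ?thesis
    using summable_iff_shift[of "\<lambda>n. \<xi> (real n)" "\<rho> + 1"] by (simp add: add.assoc)
qed

lemma lop_Ham:
  assumes "Y \<subseteq> \<Lambda>"
  shows "\<ll> Y (\<lambda>\<sigma> \<tau>. \<i> * Ham dm \<Psi> Y r \<sigma> \<tau>) = (\<Sum>Z\<in>{Z. Z \<subseteq> Y \<and> Z \<noteq> {}}. \<psi> Z r)"
proof -
  have "(\<lambda>\<sigma> \<tau>. \<i> * Ham dm \<Psi> Y r \<sigma> \<tau>)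
      = (\<lambda>\<sigma> \<tau>. \<Sum>Z\<in>{Z. Z \<subseteq> Y \<and> Z \<noteq> {}}. emb Z Y (\<lambda>\<sigma> \<tau>. \<i> * \<Psi> Z r \<sigma> \<tau>) \<sigma> \<tau>)"
    unfolding Ham_def sum_distrib_left by (intro ext sum.cong refl) (simp add: emb_def)
  then show ?thesis
    using assms by (auto simp: lop_sum[OF Lam_fin] \<psi>_def lop_emb[OF Lam_fin] intro!: sum.cong)
qed

lemma Ham_sa:
  assumes "finite Y" "r \<in> {-T..T}" "\<sigma> \<in> confs dm Y" "\<tau> \<in> confs dm Y"
  shows "Ham dm \<Psi> Y r \<sigma> \<tau> = cnj (Ham dm \<Psi> Y r \<tau> \<sigma>)"
proof -
  have "emb Z Y (\<Psi> Z r) \<sigma> \<tau> = cnj (emb Z Y (\<Psi> Z r) \<tau> \<sigma>)" if "Z \<subseteq> Y" "Z \<noteq> {}" for Z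
    using Psi_sa[rule_format, of Z r "restr Z \<sigma>" "restr Z \<tau>"] that assms finite_subset[OF that(1)]
    by (auto simp: emb_def restr_confs)
  then show ?thesis unfolding Ham_def cnj_sum by (intro sum.cong) auto
qed

lemma propagator_U:
  assumes Y: "Y \<subseteq> \<Lambda>"
  shows "propagator T (\<lambda>r. \<Sum>Z\<in>{Z. Z \<subseteq> Y \<and> Z \<noteq> {}}. \<psi> Z r)
    (\<lambda>t s. \<mu> Y (U Y t s)) (\<lambda>t s. \<mu> Y (adj (U Y t s)))"
proof -
  have finY: "finite Y" using Y Lam_fin finite_subset by blast
  note sol = U_sol[rule_format, OF finY, unfolded solves_def]
  have gen: "\<ll> Y (\<lambda>\<sigma> \<tau>. - (- \<i>) * Ham dm \<Psi> Y r \<sigma> \<tau>) = (\<Sum>Z\<in>{Z. Z \<subseteq> Y \<and> Z \<noteq> {}}. \<psi> Z r)" for r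
    using lop_Ham[OF Y] by simp
  show ?thesis
    unfolding propagator_def gen[symmetric]
  proof (intro ballI)
    fix s assume s: "s \<in> {-T..T}"
    have init: "U Y s s \<sigma> \<tau> = idop \<sigma> \<tau>" if "\<sigma> \<in> confs dm Y" "\<tau> \<in> confs dm Y" for \<sigma> \<tau>
      using sol s that by blast
    have der: "((\<lambda>r. U Y r s \<sigma> \<tau>) has_vector_derivative
        - \<i> * (\<Sum>\<rho>\<in>confs dm Y. Ham dm \<Psi> Y t \<sigma> \<rho> * U Y t s \<rho> \<tau>)) (at t within {-T..T})"
      if "t \<in> {-T..T}" "\<sigma> \<in> confs dm Y" "\<tau> \<in> confs dm Y" for t \<sigma> \<tau>
      using sol s that by blast
    have c: "cnj (- \<i>) = - (- \<i>)" by simp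
    note ev = unitary_evolution[OF Lam_fin Y c s, where V = "\<lambda>r. U Y r s" and H = "Ham dm \<Psi> Y",
        OF init Ham_sa[OF finY] der]
    show "\<mu> Y (U Y s s) = 1 \<and> \<mu> Y (adj (U Y s s)) = 1 \<and> (\<forall>t\<in>{-T..T}.
      norm (\<mu> Y (U Y t s)) \<le> 1 \<and>
      ((\<lambda>r. \<mu> Y (U Y r s)) has_vector_derivative
        - (\<ll> Y (\<lambda>\<sigma> \<tau>. - (- \<i>) * Ham dm \<Psi> Y t \<sigma> \<tau>) * \<mu> Y (U Y t s))) (at t within {-T..T}) \<and>
      ((\<lambda>r. \<mu> Y (adj (U Y r s))) has_vector_derivative
        \<mu> Y (adj (U Y t s)) * \<ll> Y (\<lambda>\<sigma> \<tau>. - (- \<i>) * Ham dm \<Psi> Y t \<sigma> \<tau>)) (at t within {-T..T}))"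
      by (intro conjI ballI ev)
  qed
qed

sublocale local_dynamics \<Lambda> T "\<lambda>Z. range (\<ll> Z)" \<psi> p
  "\<lambda>Y t s. \<mu> Y (U Y t s)" "\<lambda>Y t s. \<mu> Y (adj (U Y t s))" f N C
proof
  show "finite \<Lambda>" by (rule Lam_fin)
  show "A * B = B * A" if "Z \<subseteq> \<Lambda>" "W \<subseteq> \<Lambda>" "Z \<inter> W = {}" "A \<in> range (\<ll> Z)" "B \<in> range (\<ll> W)" for Z W A B
    using lop_commute[OF Lam_fin that(1-3)] that(4,5) by auto
  show "\<psi> Z r \<in> range (\<ll> Z)" for Z r by (simp add: \<psi>_def)
  show "norm (\<psi> Z r) \<le> p Z" if "Z \<subseteq> \<Lambda>" "Z \<noteq> {}" "r \<in> {-T..T}" for Z r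
  proof -
    have finZ: "finite Z" using that Lam_fin finite_subset by blast
    have "norm (\<psi> Z r) \<le> opnorm dm Z (\<lambda>\<sigma> \<tau>. \<i> * \<Psi> Z r \<sigma> \<tau>)"
      unfolding \<psi>_def by (rule norm_lop_le[OF Lam_fin that(1)])
    also have "\<dots> = opnorm dm Z (\<Psi> Z r)"
    proof -
      have "app dm Z (\<lambda>\<sigma> \<tau>. \<i> * \<Psi> Z r \<sigma> \<tau>) v = (\<lambda>\<sigma>. \<i> * app dm Z (\<Psi> Z r) v \<sigma>)" for v
        by (simp add: app_def sum_distrib_left mult.assoc)
      then show ?thesis by (simp add: opnorm_def vnorm_def norm_mult)
    qed
    also have "\<dots> \<le> p Z"
      by (rule opnorm_le_sup_norm[OF Psi_norm Fxi_pos finZ that(2,3)])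
    finally show ?thesis .
  qed
  show "0 \<le> p Z" for Z by (simp add: sup_norm_def)
  show "propagator T (\<lambda>r. \<Sum>Z\<in>{Z. Z \<subseteq> Y \<and> Z \<noteq> {}}. \<psi> Z r) (\<lambda>t s. \<mu> Y (U Y t s)) (\<lambda>t s. \<mu> Y (adj (U Y t s)))"
    if "Y \<subseteq> \<Lambda>" for Y by (rule propagator_U[OF that])
  show "0 \<le> f x y" for x y using Fxi_pos by (simp add: less_imp_le)
  show "0 \<le> N" by simp
  show "0 < C" by (rule C_pos)
  show "(\<Sum>Z\<in>{Z. Z \<subseteq> \<Lambda> \<and> x \<in> Z \<and> y \<in> Z}. p Z) \<le> N * f x y" for x y
    using Lam_fin by (intro sum_sup_norm_le[OF Psi_norm Fxi_pos])
      (auto intro: finite_subset[of _ "Pow \<Lambda>"] finite_subset)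
  show "(\<Sum>y\<in>\<Lambda>. f x y * f y z) \<le> C * f x z" for x z
    by (rule sum_le_constC[OF Fxi_conv Fxi_pos Lam_fin])
qed

text \<open>Each \<open>Z\<close> is charged to one of the pairs in \<open>A\<close> that it
  contains, and each pair costs at most \<open>N\<close> times its weight.\<close>

lemma sum_p_le_pairs:
  assumes "finite A" "\<And>Z. Z \<in> \<W> \<Longrightarrow> Z \<subseteq> \<Lambda> \<and> (\<exists>(x, y)\<in>A. x \<in> Z \<and> y \<in> Z)" "A \<subseteq> \<Lambda> \<times> \<Lambda>"
  shows "(\<Sum>Z\<in>\<W>. p Z) \<le> N * (\<Sum>(x, y)\<in>A. f x y)"
proof -
  have "\<W> \<subseteq> Pow \<Lambda>" using assms by auto
  then have fin: "finite \<W>" using Lam_fin by (auto intro: finite_subset)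
  have "(\<Sum>Z\<in>\<W>. p Z) \<le> (\<Sum>Z\<in>\<W>. \<Sum>(x, y)\<in>A. of_bool (x \<in> Z \<and> y \<in> Z) * p Z)"
  proof (rule sum_mono)
    fix Z assume "Z \<in> \<W>"
    then obtain xy where xy: "xy \<in> A" "fst xy \<in> Z" "snd xy \<in> Z" using assms(2) by fastforce
    have "(case xy of (x, y) \<Rightarrow> of_bool (x \<in> Z \<and> y \<in> Z) * p Z) \<le> (\<Sum>(x, y)\<in>A. of_bool (x \<in> Z \<and> y \<in> Z) * p Z)"
      by (rule member_le_sum[OF xy(1)]) (auto simp: assms p_nonneg)
    then show "p Z \<le> (\<Sum>(x, y)\<in>A. of_bool (x \<in> Z \<and> y \<in> Z) * p Z)"
      using xy by (simp add: case_prod_beta)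
  qed
  also have "\<dots> = (\<Sum>(x, y)\<in>A. \<Sum>Z\<in>\<W>. of_bool (x \<in> Z \<and> y \<in> Z) * p Z)"
    by (subst sum.swap) (simp add: case_prod_beta)
  also have "\<dots> \<le> (\<Sum>(x, y)\<in>A. N * f x y)"
  proof (rule sum_mono, clarify)
    fix x y assume "(x, y) \<in> A"
    then have xy: "x \<in> \<Lambda>" "y \<in> \<Lambda>" using assms by auto
    have "(\<Sum>Z\<in>\<W>. of_bool (x \<in> Z \<and> y \<in> Z) * p Z) = (\<Sum>Z\<in>{Z\<in>\<W>. x \<in> Z \<and> y \<in> Z}. p Z)"
      using fin by (intro sum.mono_neutral_cong_right) auto
    also have "\<dots> \<le> (\<Sum>Z\<in>{Z. Z \<subseteq> \<Lambda> \<and> x \<in> Z \<and> y \<in> Z}. p Z)"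
      using assms(2) by (intro sum_mono2 p_nonneg finite_subsets) auto
    also have "\<dots> \<le> N * f x y" by (rule p_sum[OF xy])
    finally show "(\<Sum>Z\<in>\<W>. of_bool (x \<in> Z \<and> y \<in> Z) * p Z) \<le> N * f x y" .
  qed
  finally show ?thesis by (simp add: sum_distrib_left case_prod_beta)
qed

text \<open>Decay is extracted once, at the smallest distance, and the remaining sum is one of
  \<open>F\<close> alone; hence ||F|| and not ||F_\<xi>|| as prefactor in the theorem.\<close>

lemma sum_f_le:
  assumes "finite B" "\<And>y. y \<in> B \<Longrightarrow> n \<le> d x y"
  shows "(\<Sum>y\<in>B. f x y) \<le> \<xi> (real n) * enn2real (normF d F)"
proof -
  have "(\<Sum>y\<in>B. f x y) \<le> (\<Sum>y\<in>B. \<xi> (real n) * F (real (d x y)))"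
    using assms(2) xi_mono F_pos by (intro sum_mono) (auto simp: Fxi_def mult.commute less_imp_le intro!: mult_left_mono)
  also have "\<dots> \<le> \<xi> (real n) * enn2real (normF d F)"
    unfolding sum_distrib_left[symmetric] using xi_pos sum_le_normF[OF F_norm F_pos assms(1)]
    by (intro mult_left_mono) (auto simp: less_imp_le)
  finally show ?thesis .
qed

end


section \<open>Estimates for the terms that cross the surface\<close>

context spin_interaction
begin

lemma zeta_nonneg: "0 \<le> zeta \<xi> \<rho>"
  unfolding zeta_def using xi_pos by (intro suminf_nonneg summable_xi) (simp add: less_imp_le)

lemma surface_remainder_le:
  assumes shells: "\<And>n. 1 \<le> n \<Longrightarrow> card (Defs.inner d X n - Defs.inner d X (n - 1)) \<le> card (bdry d X)"
    and X: "X \<subseteq> \<Lambda>"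
  shows "(\<Sum>Z\<in>{Z. Z \<subseteq> \<Lambda> \<and> Z \<inter> X \<noteq> {} \<and> Z \<inter> (\<Lambda> - X) \<noteq> {} \<and> \<not> Z \<subseteq> bdryR d X \<rho>}. p Z)
    \<le> N * (2 * (real (card (bdry d X)) * zeta \<xi> \<rho> * enn2real (normF d F)))"
    (is "sum p ?\<W> \<le> N * (2 * ?b)")
\<comment> \<open>If \<Lambda> = X no term crosses the surface. Otherwise the complement of
  \<open>X\<close> is nonempty, which depths presuppose.\<close>
proof (cases "\<Lambda> - X = {}")
  case True
  then have empty: "?\<W> = {}" by auto
  show ?thesis unfolding empty using zeta_nonneg by simp
next
  case False
  then have X': "- X \<noteq> {}" by auto
  have finX: "finite X" using X Lam_fin finite_subset by blast
  \<comment> \<open>Each of the two families of pairs costs one \<zeta>(\<rho>): in the first the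
    distance is at least the depth plus \<rho>, in the second at least the depth, which itself
    exceeds \<rho>.\<close>
  let ?A1 = "X \<times> (\<Lambda> - X - outer d X \<rho>)" and ?A2 = "(X - Defs.inner d X \<rho>) \<times> (\<Lambda> - X)"
  have fin: "finite ?A1" "finite ?A2" using finX Lam_fin by auto
  have shell_sum: "(\<Sum>x\<in>A. \<xi> (real (h (depth d X x)))) \<le> real (card (bdry d X)) * zeta \<xi> \<rho>"
    if "A \<subseteq> X" "inj h" "\<And>x. x \<in> A \<Longrightarrow> \<rho> + 1 \<le> h (depth d X x)" for A h
    by (rule sum_depth_le[OF graph shells finX X' that(1) _ summable_xi that(2,3)])
       (use xi_pos in \<open>auto simp: less_imp_le\<close>)
  have "Z \<subseteq> \<Lambda> \<and> (\<exists>(x, y)\<in>?A1 \<union> ?A2. x \<in> Z \<and> y \<in> Z)" if Z: "Z \<in> ?\<W>" for Z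
  proof
    from Z show "Z \<subseteq> \<Lambda>" by auto
    from Z obtain x y z where xyz: "x \<in> Z" "x \<in> X" "y \<in> Z" "y \<in> \<Lambda> - X" "z \<in> Z" "z \<in> \<Lambda>" "z \<notin> bdryR d X \<rho>"
      by auto
    \<comment> \<open>A site outside the \<rho>-boundary is far from \<open>X\<close>, hence outside
      it, or far from the complement, hence inside \<open>X\<close>. In either case \<open>z\<close>
      is one end of the pair, and the other is a site of \<open>Z\<close> across the
      surface.\<close>
    show "\<exists>(x, y)\<in>?A1 \<union> ?A2. x \<in> Z \<and> y \<in> Z"
    proof (cases "z \<in> outer d X \<rho>")
      case False
      then have "z \<notin> X" by (auto simp: mem_outer[OF graph] dist_self[OF graph])
      then have "(x, z) \<in> ?A1" using xyz False by auto
      then show ?thesis using xyz by blast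
    next
      case True
      then have z: "z \<notin> Defs.inner d X \<rho>" using xyz by (auto simp: bdryR_def)
      then have "z \<in> X"
        using dist_self[OF graph, of z] unfolding mem_inner[OF graph] by (metis ComplI le0)
      then have "(z, y) \<in> ?A2" using xyz z by auto
      then show ?thesis using xyz by blast
    qed
  qed
  then have main: "sum p ?\<W> \<le> N * (\<Sum>(x, y)\<in>?A1 \<union> ?A2. f x y)"
    using fin X by (intro sum_p_le_pairs) auto
  have split: "(\<Sum>(x, y)\<in>?A1 \<union> ?A2. f x y) \<le> (\<Sum>(x, y)\<in>?A1. f x y) + (\<Sum>(x, y)\<in>?A2. f x y)"
    using sum.union_inter[OF fin, of "\<lambda>(x, y). f x y"] f_nonneg
    by (smt (verit, best) case_prod_beta sum_nonneg)
  have "(\<Sum>(x, y)\<in>?A1. f x y) \<le> ?b"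
  proof -
    have "(\<Sum>(x, y)\<in>?A1. f x y) = (\<Sum>x\<in>X. \<Sum>y\<in>\<Lambda> - X - outer d X \<rho>. f x y)"
      by (simp add: sum.cartesian_product)
    also have "\<dots> \<le> (\<Sum>x\<in>X. \<xi> (real (depth d X x + \<rho>)) * enn2real (normF d F))"
      using Lam_fin depth_dist_gap[OF graph] by (intro sum_mono sum_f_le) auto
    also have "\<dots> = (\<Sum>x\<in>X. \<xi> (real (depth d X x + \<rho>))) * enn2real (normF d F)"
      by (simp add: sum_distrib_right)
    also have "\<dots> \<le> ?b"
      using depth_shell(1)[OF graph _ X']
      by (intro mult_right_mono shell_sum[where h = "\<lambda>n. n + \<rho>"]) (auto simp: inj_def)
    finally show ?thesis .
  qed
  moreover have "(\<Sum>(x, y)\<in>?A2. f x y) \<le> ?b"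
  proof -
    have "(\<Sum>(x, y)\<in>?A2. f x y) = (\<Sum>x\<in>X - Defs.inner d X \<rho>. \<Sum>y\<in>\<Lambda> - X. f x y)"
      by (simp add: sum.cartesian_product)
    also have "\<dots> \<le> (\<Sum>x\<in>X - Defs.inner d X \<rho>. \<xi> (real (depth d X x)) * enn2real (normF d F))"
      using Lam_fin depth_dist_le[OF graph] by (intro sum_mono sum_f_le) auto
    also have "\<dots> = (\<Sum>x\<in>X - Defs.inner d X \<rho>. \<xi> (real (depth d X x))) * enn2real (normF d F)"
      by (simp add: sum_distrib_right)
    also have "\<dots> \<le> ?b"
    proof (intro mult_right_mono shell_sum[where h = "\<lambda>n. n"])
      fix x assume x: "x \<in> X - Defs.inner d X \<rho>"
      then have "x \<in> Defs.inner d X (depth d X x)" using depth_shell(2)[OF graph _ X', of x] by auto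
      then show "\<rho> + 1 \<le> depth d X x"
        using x inner_mono[OF graph, of "depth d X x" \<rho> X] by (auto simp: not_less_eq_eq[symmetric])
    qed auto
    finally show ?thesis .
  qed
  ultimately have "(\<Sum>(x, y)\<in>?A1 \<union> ?A2. f x y) \<le> 2 * ?b" using split by linarith
  then have "N * (\<Sum>(x, y)\<in>?A1 \<union> ?A2. f x y) \<le> N * (2 * ?b)" by (rule mult_left_mono) simp
  with main show ?thesis by (rule order_trans)
qed

text \<open>The purpose of \<rho> = R div 2: the distance from the \<rho>-boundary to the outside of
  the R-boundary exceeds R - \<rho>, which is still at least \<rho>.\<close>

lemma inter_sum_surface_le:
  assumes "2 * \<rho> \<le> R" "finite (bdryR d X \<rho>)"
  shows "inter_sum (bdryR d X \<rho>) (\<Lambda> - bdryR d X R)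
    \<le> real (card (bdryR d X \<rho>)) * (\<xi> (real \<rho>) * enn2real (normF d F))"
proof -
  have "(\<Sum>y\<in>\<Lambda> - bdryR d X R. f x y) \<le> \<xi> (real \<rho>) * enn2real (normF d F)" if "x \<in> bdryR d X \<rho>" for x
  proof (rule sum_f_le)
    fix y assume "y \<in> \<Lambda> - bdryR d X R"
    then have "R - \<rho> < d x y" using bdryR_dist[OF graph that, of y R \<Lambda>] assms by auto
    then show "\<rho> \<le> d x y" using assms by linarith
  qed (use Lam_fin in auto)
  then have "inter_sum (bdryR d X \<rho>) (\<Lambda> - bdryR d X R)
      \<le> (\<Sum>x\<in>bdryR d X \<rho>. \<xi> (real \<rho>) * enn2real (normF d F))"
    unfolding inter_sum_def by (rule sum_mono)
  then show ?thesis by simp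
qed

text \<open>Every term is charged to a single site of \<open>P\<close>, that is to a diagonal pair
  of weight F_\<xi>(0), which is one summand of ||F_\<xi>||.\<close>

lemma surface_term_norm_le:
  assumes "\<W> \<subseteq> {Z. Z \<subseteq> P \<and> Z \<noteq> {}}" "P \<subseteq> \<Lambda>" "r \<in> {-T..T}"
  shows "norm (\<Sum>Z\<in>\<W>. \<psi> Z r) \<le> N * (real (card P) * enn2real (normF d (Fxi F \<xi>)))"
proof -
  have "norm (\<Sum>Z\<in>\<W>. \<psi> Z r) \<le> (\<Sum>Z\<in>\<W>. p Z)"
    using assms by (intro order_trans[OF norm_sum] sum_mono \<psi>_norm) auto
  also have "\<dots> \<le> N * (\<Sum>(x, y)\<in>(\<lambda>x. (x, x)) ` P. f x y)"
    using assms Lam_fin finite_subset[OF assms(2)] by (intro sum_p_le_pairs) fastforce+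
  also have "(\<Sum>(x, y)\<in>(\<lambda>x. (x, x)) ` P. f x y) = (\<Sum>x\<in>P. f x x)"
    by (subst sum.reindex) (auto simp: inj_on_def)
  also have "\<dots> \<le> (\<Sum>x\<in>P. enn2real (normF d (Fxi F \<xi>)))"
    using sum_le_normF[OF Fxi_norm Fxi_pos, of "{x}" x for x] by (intro sum_mono) simp
  finally show ?thesis by (simp add: mult_left_mono)
qed

lemma gen_remainder:
  assumes "X \<subseteq> \<Lambda>" and \<M>: "\<M> = {Z. Z \<subseteq> P \<and> Z \<inter> X \<noteq> {} \<and> Z \<inter> (\<Lambda> - X) \<noteq> {}}" and "P \<subseteq> \<Lambda>"
  shows "gen \<Lambda> r - gen X r - gen (\<Lambda> - X) r - (\<Sum>Z\<in>\<M>. \<psi> Z r)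
    = (\<Sum>Z\<in>{Z. Z \<subseteq> \<Lambda> \<and> Z \<inter> X \<noteq> {} \<and> Z \<inter> (\<Lambda> - X) \<noteq> {} \<and> \<not> Z \<subseteq> P}. \<psi> Z r)"
    (is "_ = sum _ ?B")
proof -
  let ?S = "\<lambda>Y. {Z. Z \<subseteq> Y \<and> Z \<noteq> {}}"
  have fin: "finite (?S X)" "finite (?S (\<Lambda> - X))" "finite \<M>" "finite ?B"
    using assms by auto
  have "?S \<Lambda> = (?S X \<union> ?S (\<Lambda> - X)) \<union> (\<M> \<union> ?B)"
    using assms by auto
  then have "(\<Sum>Z\<in>?S \<Lambda>. \<psi> Z r) = (\<Sum>Z\<in>?S X \<union> ?S (\<Lambda> - X). \<psi> Z r) + (\<Sum>Z\<in>\<M> \<union> ?B. \<psi> Z r)"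
    using fin \<M> by (simp only:) (intro sum.union_disjoint, auto)
  also have "(\<Sum>Z\<in>?S X \<union> ?S (\<Lambda> - X). \<psi> Z r) = gen X r + gen (\<Lambda> - X) r"
    unfolding gen_def using fin by (intro sum.union_disjoint) auto
  also have "(\<Sum>Z\<in>\<M> \<union> ?B. \<psi> Z r) = (\<Sum>Z\<in>\<M>. \<psi> Z r) + sum (\<lambda>Z. \<psi> Z r) ?B"
    using fin \<M> by (intro sum.union_disjoint) auto
  finally show ?thesis by (simp add: gen_def)
qed

lemma ulop_gen_commute:
  assumes "X \<subseteq> \<Lambda>"
  shows "\<mu> X A * gen (\<Lambda> - X) r = gen (\<Lambda> - X) r * \<mu> X A"
  unfolding gen_def sum_distrib_left sum_distrib_right
proof (intro sum.cong refl)
  fix W assume "W \<in> {Z. Z \<subseteq> \<Lambda> - X \<and> Z \<noteq> {}}"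
  then have "W \<subseteq> \<Lambda>" "X \<inter> W = {}" by auto
  then show "\<mu> X A * \<psi> W r = \<psi> W r * \<mu> X A"
    unfolding \<psi>_def by (simp add: ulop_mult_lop[OF Lam_fin] lop_commute[OF Lam_fin assms])
qed

lemma lop_surface:
  assumes "\<M> \<subseteq> Pow Y" "Y \<subseteq> \<Lambda>"
  shows "\<ll> Y (\<lambda>\<sigma> \<tau>. \<i> * (\<Sum>Z\<in>\<M>. emb Z Y (\<Psi> Z r) \<sigma> \<tau>)) = (\<Sum>Z\<in>\<M>. \<psi> Z r)"
proof -
  have "(\<lambda>\<sigma> \<tau>. \<i> * (\<Sum>Z\<in>\<M>. emb Z Y (\<Psi> Z r) \<sigma> \<tau>))
      = (\<lambda>\<sigma> \<tau>. \<Sum>Z\<in>\<M>. emb Z Y (\<lambda>\<sigma> \<tau>. \<i> * \<Psi> Z r \<sigma> \<tau>) \<sigma> \<tau>)"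
    unfolding sum_distrib_left by (intro ext sum.cong refl) (simp add: emb_def)
  then show ?thesis
    using assms by (auto simp: lop_sum[OF Lam_fin] \<psi>_def lop_emb[OF Lam_fin] intro!: sum.cong)
qed

lemma Sop_sa:
  assumes "finite (bdryR d X R)" "Mset d X \<Lambda>' R \<subseteq> Pow (bdryR d X R)" "r \<in> {-T..T}"
    and "\<sigma> \<in> confs dm (bdryR d X R)" "\<tau> \<in> confs dm (bdryR d X R)"
  shows "Sop d \<Psi> X \<Lambda>' R r \<sigma> \<tau> = cnj (Sop d \<Psi> X \<Lambda>' R r \<tau> \<sigma>)"
  unfolding Sop_def cnj_sum
proof (intro sum.cong refl)
  fix Z assume Z: "Z \<in> Mset d X \<Lambda>' R"
  then have sub: "Z \<subseteq> bdryR d X R" and "Z \<noteq> {}" using assms(2) by (auto simp: Mset_def)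
  then show "emb Z (bdryR d X R) (\<Psi> Z r) \<sigma> \<tau> = cnj (emb Z (bdryR d X R) (\<Psi> Z r) \<tau> \<sigma>)"
    using Psi_sa[rule_format, of Z r "restr Z \<sigma>" "restr Z \<tau>"] assms finite_subset[OF sub]
    by (auto simp: emb_def restr_confs)
qed

end

section \<open>The surface evolution and the final estimate\<close>

lemma heis_sa:
  assumes "\<And>\<sigma> \<tau>. \<sigma> \<in> confs dm Y \<Longrightarrow> \<tau> \<in> confs dm Y \<Longrightarrow> A \<sigma> \<tau> = cnj (A \<tau> \<sigma>)"
  shows "heis dm Y V A \<sigma> \<tau> = cnj (heis dm Y V A \<tau> \<sigma>)"
proof -
  have "heis dm Y V A \<sigma> \<tau> = (\<Sum>\<kappa>\<in>confs dm Y. \<Sum>\<rho>\<in>confs dm Y. cnj (V \<kappa> \<sigma>) * (A \<kappa> \<rho> * V \<rho> \<tau>))"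
    by (simp add: heis_def mmult_def adj_def sum_distrib_left)
  also have "\<dots> = (\<Sum>\<rho>\<in>confs dm Y. \<Sum>\<kappa>\<in>confs dm Y. V \<rho> \<tau> * (cnj (A \<rho> \<kappa>) * cnj (V \<kappa> \<sigma>)))"
    by (subst sum.swap) (intro sum.cong refl, subst assms, auto)
  also have "\<dots> = cnj (heis dm Y V A \<tau> \<sigma>)"
    by (simp add: heis_def mmult_def adj_def sum_distrib_left)
  finally show ?thesis .
qed

lemma rpow_double: "0 \<le> x \<Longrightarrow> rpow x (2 * D) = (rpow x D)\<^sup>2"
  by (simp add: rpow_def power2_eq_square powr_add[symmetric])

theorem theorem1:
  fixes E :: "'a::countable \<Rightarrow> 'a \<Rightarrow> bool" and d :: "'a \<Rightarrow> 'a \<Rightarrow> nat"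
    and F \<xi> :: "real \<Rightarrow> real" and G D T :: real and dm :: "'a \<Rightarrow> nat"
    and \<Psi> :: "'a set \<Rightarrow> real \<Rightarrow> 'a op"
    and U :: "'a set \<Rightarrow> real \<Rightarrow> real \<Rightarrow> 'a op" and Ut :: "real \<Rightarrow> real \<Rightarrow> 'a op"
    and X \<Lambda> :: "'a set" and R :: nat and s t :: real
  assumes graph: "graph_distance E d"
    and F_pos: "\<forall>r\<ge>0. F r > 0"
    and F_norm: "normF d F < \<infinity>"
    and F_conv: "constC d F < \<infinity>"
    and xi_pos: "\<forall>r\<ge>0. \<xi> r > 0"
    and xi_mono: "\<forall>a b. 0 \<le> a \<longrightarrow> a \<le> b \<longrightarrow> \<xi> b \<le> \<xi> a"
    and xi_supmult: "\<forall>a b. 0 \<le> a \<longrightarrow> 0 \<le> b \<longrightarrow> \<xi> (a + b) \<ge> \<xi> a * \<xi> b"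
    and xi_decay: "\<forall>n::nat. ((\<lambda>r. \<xi> r * r ^ n) \<longlongrightarrow> 0) at_top"
    and G_pos: "G > 0" and D_nonneg: "D \<ge> 0"
    and surface: "\<forall>Y R'. finite Y \<longrightarrow>
                    real (card (bdryR d Y R')) \<le> G * rpow (real R') D * real (card (bdry d Y))"
    and T_pos: "T > 0"
    and Psi_sa: "\<forall>Z r. finite Z \<longrightarrow> Z \<noteq> {} \<longrightarrow> r \<in> {-T..T} \<longrightarrow>
                   (\<forall>\<sigma>\<in>confs dm Z. \<forall>\<tau>\<in>confs dm Z. \<Psi> Z r \<sigma> \<tau> = cnj (\<Psi> Z r \<tau> \<sigma>))"
    and Psi_cont: "\<forall>Z \<sigma> \<tau>. finite Z \<longrightarrow> Z \<noteq> {} \<longrightarrow> continuous_on {-T..T} (\<lambda>r. \<Psi> Z r \<sigma> \<tau>)"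
    and Psi_norm: "normPsi dm d F \<xi> T \<Psi> < \<infinity>"
    and U_sol: "\<forall>\<Lambda>'. finite \<Lambda>' \<longrightarrow>
                  solves dm \<Lambda>' T (- \<i>) (\<lambda>r _. Ham dm \<Psi> \<Lambda>' r) (U \<Lambda>')"
    and X_fin: "finite X"
    and shells: "\<forall>n m. 1 \<le> n \<longrightarrow> n \<le> m \<longrightarrow>
                   card (inner d X m - inner d X (m - 1)) \<le> card (inner d X n - inner d X (n - 1))"
    and R_pos: "R \<ge> 1"
    and Lam_fin: "finite \<Lambda>" and Lam_sup: "outer d X R \<subseteq> \<Lambda>"
    and Ut_sol: "solves dm (bdryR d X R) T \<i>
                   (\<lambda>r s'. heis dm (bdryR d X R) (U (bdryR d X R) r s') (Sop d \<Psi> X \<Lambda> R r)) Ut"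
    and s_in: "s \<in> {-T..T}" and t_in: "t \<in> {-T..T}"
  shows "opnorm dm \<Lambda>
           (\<lambda>\<sigma> \<tau>. U \<Lambda> t s \<sigma> \<tau>
                  - mmult dm \<Lambda> (tens X (\<Lambda> - X) (U X t s) (U (\<Lambda> - X) t s))
                                 (emb (bdryR d X R) \<Lambda> (adj (Ut t s))) \<sigma> \<tau>)
         \<le> real (card (bdry d X)) * enn2real (normPsi dm d F \<xi> T \<Psi>) * enn2real (normF d F)
             * \<bar>t - s\<bar>
             * (2 * zeta \<xi> (R div 2)
                + real (card (bdry d X))
                  * (G\<^sup>2 * enn2real (normF d (Fxi F \<xi>)) / enn2real (constC d (Fxi F \<xi>)))
                  * rpow (real (R div 2)) (2 * D) * \<xi> (real (R div 2))
                  * (exp (2 * enn2real (normPsi dm d F \<xi> T \<Psi>) * enn2real (constC d (Fxi F \<xi>))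
                          * \<bar>t - s\<bar>) - 1))"
proof -
  interpret spin_interaction E d F \<xi> T dm \<Psi> U \<Lambda>
    by (rule spin_interaction.intro)
       (fact graph F_pos F_norm F_conv xi_pos xi_mono xi_supmult xi_decay Psi_sa Psi_norm U_sol Lam_fin)+
  define \<rho> where "\<rho> = R div 2"
  define P where "P = bdryR d X \<rho>"
  define Y where "Y = bdryR d X R"
  define \<M> where "\<M> = Mset d X \<Lambda> R"
  define nF where "nF = enn2real (normF d F)"
  define nX where "nX = enn2real (normF d (Fxi F \<xi>))"
  define b where "b = real (card (bdry d X))"
  define S where "S r = (\<Sum>Z\<in>\<M>. \<psi> Z r)" for r
  have Y: "Y \<subseteq> \<Lambda>" using Lam_sup by (auto simp: Y_def bdryR_def)
  have PY: "P \<subseteq> Y"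
    using outer_mono[OF graph, of \<rho> R X] inner_mono[OF graph, of \<rho> R X]
    by (auto simp: P_def Y_def bdryR_def \<rho>_def)
  have P: "P \<subseteq> \<Lambda>" using PY Y by auto
  have X: "X \<subseteq> \<Lambda>"
    using Lam_sup dist_self[OF graph] by (auto simp: mem_outer[OF graph] subset_iff) (metis le0)
  have finY: "finite Y" using Y Lam_fin by (rule finite_subset)
  have finP: "finite P" using P Lam_fin by (rule finite_subset)
  have \<M>: "\<M> = {Z. Z \<subseteq> P \<and> Z \<inter> X \<noteq> {} \<and> Z \<inter> (\<Lambda> - X) \<noteq> {}}"
    by (simp add: \<M>_def Mset_def P_def \<rho>_def)
  have \<M>Y: "\<M> \<subseteq> Pow Y" using PY by (auto simp: \<M>)
  have shell1: "card (Defs.inner d X n - Defs.inner d X (n - 1)) \<le> card (bdry d X)" if "1 \<le> n" for n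
    using shells[rule_format, of 1 n] that by (simp add: bdry_eq_shell[OF graph])
  have S_loc: "S r \<in> range (\<ll> P)" for r
    using lop_surface[of \<M> P r] P unfolding S_def by (metis (no_types, lifting) \<M> Pow_iff mem_Collect_eq rangeI subsetI)
  have Sop: "\<ll> Y (\<lambda>\<sigma> \<tau>. \<i> * Sop d \<Psi> X \<Lambda> R r \<sigma> \<tau>) = S r" for r
    using lop_surface[OF \<M>Y Y] by (simp add: Sop_def S_def Y_def \<M>_def)
  \<comment> \<open>The minus sign comes from \<open>c = \<i>\<close> in
    \<open>unitary_evolution\<close>. It cancels the one in the derivative there, and the surface
    evolution obtains the sign that \<open>decoupling\<close> expects.\<close>
  have heis: "\<ll> Y (\<lambda>\<sigma> \<tau>. - \<i> * heis dm Y (U Y r s) (Sop d \<Psi> X \<Lambda> R r) \<sigma> \<tau>)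
      = - (\<mu> Y (adj (U Y r s)) * S r * \<mu> Y (U Y r s))" for r
  proof -
    have "(\<lambda>\<sigma> \<tau>. - \<i> * heis dm Y (U Y r s) (Sop d \<Psi> X \<Lambda> R r) \<sigma> \<tau>)
        = (\<lambda>\<sigma> \<tau>. - heis dm Y (U Y r s) (\<lambda>\<sigma> \<tau>. \<i> * Sop d \<Psi> X \<Lambda> R r \<sigma> \<tau>) \<sigma> \<tau>)"
      by (simp add: heis_def mmult_def sum_distrib_left sum_negf mult_ac)
    then show ?thesis
      unfolding Sop[symmetric] by (simp add: lop_uminus[OF Lam_fin] heis_def
          lop_mult[OF Lam_fin Y, symmetric] ulop_mult_lop[OF Lam_fin] mult.assoc)
  qed
  note Ut_sol_s = bspec[OF Ut_sol[unfolded solves_def, folded Y_def] s_in]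
  have init: "Ut s s \<sigma> \<tau> = idop \<sigma> \<tau>" if "\<sigma> \<in> confs dm Y" "\<tau> \<in> confs dm Y" for \<sigma> \<tau>
    by (rule bspec[OF bspec[OF conjunct1[OF Ut_sol_s] that(1)] that(2)])
  have der: "((\<lambda>r. Ut r s \<sigma> \<tau>) has_vector_derivative
      \<i> * (\<Sum>\<kappa>\<in>confs dm Y. heis dm Y (U Y t s) (Sop d \<Psi> X \<Lambda> R t) \<sigma> \<kappa> * Ut t s \<kappa> \<tau>)) (at t within {-T..T})"
    if "t \<in> {-T..T}" "\<sigma> \<in> confs dm Y" "\<tau> \<in> confs dm Y" for \<sigma> \<tau> t
    by (rule bspec[OF bspec[OF bspec[OF conjunct2[OF Ut_sol_s] that(1)] that(2)] that(3)])
  have sa: "heis dm Y (U Y r s) (Sop d \<Psi> X \<Lambda> R r) \<sigma> \<tau> = cnj (heis dm Y (U Y r s) (Sop d \<Psi> X \<Lambda> R r) \<tau> \<sigma>)"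
    if "r \<in> {-T..T}" for r \<sigma> \<tau>
    unfolding Y_def by (rule heis_sa) (rule Sop_sa[OF finY[unfolded Y_def] \<M>Y[unfolded Y_def \<M>_def] that])
  have ci: "cnj \<i> = - \<i>" by simp
  note ev = unitary_evolution[OF Lam_fin Y ci s_in, where V = "\<lambda>r. Ut r s"
      and H = "\<lambda>r. heis dm Y (U Y r s) (Sop d \<Psi> X \<Lambda> R r)", OF init sa der, unfolded heis]
  have remainder: "norm (gen \<Lambda> r - gen X r - gen (\<Lambda> - X) r - S r) \<le> N * (2 * (b * zeta \<xi> \<rho> * nF))"
    if r: "r \<in> {-T..T}" for r
  proof -
    let ?\<W> = "{Z. Z \<subseteq> \<Lambda> \<and> Z \<inter> X \<noteq> {} \<and> Z \<inter> (\<Lambda> - X) \<noteq> {} \<and> \<not> Z \<subseteq> P}"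
    have "norm (gen \<Lambda> r - gen X r - gen (\<Lambda> - X) r - S r) = norm (\<Sum>Z\<in>?\<W>. \<psi> Z r)"
      unfolding S_def gen_remainder[OF X \<M> P] ..
    also have "\<dots> \<le> (\<Sum>Z\<in>?\<W>. p Z)"
      using r by (intro order_trans[OF norm_sum] sum_mono \<psi>_norm) auto
    also have "\<dots> \<le> N * (2 * (b * zeta \<xi> \<rho> * nF))"
      unfolding P_def b_def nF_def by (rule surface_remainder_le[OF shell1 X])
    finally show ?thesis .
  qed
  have S_norm: "norm (S r) \<le> N * (real (card P) * nX)" if "r \<in> {-T..T}" for r
    unfolding S_def nX_def by (rule surface_term_norm_le[OF _ P that]) (auto simp: \<M>)
  define e where "e = (exp (2 * N * C * \<bar>t - s\<bar>) - 1) / C"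
  have e: "0 \<le> e" unfolding e_def by (rule exp_factor_nonneg) simp
  have "norm (\<mu> Y (Ut t s) * (\<mu> (\<Lambda> - X) (adj (U (\<Lambda> - X) t s)) * \<mu> X (adj (U X t s))) - \<mu> \<Lambda> (adj (U \<Lambda> t s)))
      \<le> \<bar>t - s\<bar> * (N * (2 * (b * zeta \<xi> \<rho> * nF)) + N * (real (card P) * nX) * e * inter_sum P (\<Lambda> - Y))"
    unfolding e_def
    by (rule decoupling[where S = S and P = P, OF X Y P s_in t_in])
       (use ev s_in in \<open>auto intro: remainder S_norm simp: S_loc ulop_gen_commute[OF X]\<close>)
  moreover have "opnorm dm \<Lambda>
           (\<lambda>\<sigma> \<tau>. U \<Lambda> t s \<sigma> \<tau>
                  - mmult dm \<Lambda> (tens X (\<Lambda> - X) (U X t s) (U (\<Lambda> - X) t s))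
                                 (emb (bdryR d X R) \<Lambda> (adj (Ut t s))) \<sigma> \<tau>)
      \<le> norm (\<mu> Y (Ut t s) * (\<mu> (\<Lambda> - X) (adj (U (\<Lambda> - X) t s)) * \<mu> X (adj (U X t s))) - \<mu> \<Lambda> (adj (U \<Lambda> t s)))"
    (is "opnorm dm \<Lambda> ?M \<le> norm ?x")
  proof -
    have "matop (confs dm \<Lambda>) ?M = \<ll> \<Lambda> (U \<Lambda> t s) - \<ll> X (U X t s) * \<ll> (\<Lambda> - X) (U (\<Lambda> - X) t s) * \<ll> Y (adj (Ut t s))"
      unfolding matop_diff[OF finite_confs[OF Lam_fin]] mmult_def
        matop_mult[OF finite_confs[OF Lam_fin], symmetric]
      by (simp add: lop_full[OF Lam_fin] lop_tens[OF Lam_fin X] lop_def[OF Lam_fin, of dm "bdryR d X R"] Y_def)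
    \<comment> \<open>On configurations outside \<Lambda> both terms become the identity, so their
      difference is unchanged.\<close>
    also have "\<dots> = \<mu> \<Lambda> (U \<Lambda> t s) - \<mu> X (U X t s) * \<mu> (\<Lambda> - X) (U (\<Lambda> - X) t s) * \<mu> Y (adj (Ut t s))"
      by (simp add: ulop_def[OF Lam_fin] algebra_simps proj_absorb[OF Lam_fin])
    finally have M: "matop (confs dm \<Lambda>) ?M = \<dots>" .
    (* decoupling bounds the adjoint of the required operator *)
    have aa: "adj (adj A) = A" for A :: "'a op" by (simp add: adj_def)
    have "adjoint_pair ?x
        (\<mu> X (adj (adj (U X t s))) * \<mu> (\<Lambda> - X) (adj (adj (U (\<Lambda> - X) t s))) * \<mu> Y (adj (Ut t s))
          - \<mu> \<Lambda> (adj (adj (U \<Lambda> t s))))"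
      by (intro adjoint_pair_diff adjoint_pair_mult adjoint_pair_ulop[OF Lam_fin])
    from norm_adjoint_le[OF adjoint_pair_sym[OF this]] show ?thesis
      unfolding opnorm_eq_norm[OF Lam_fin] M by (simp add: norm_minus_commute aa)
  qed
  \<comment> \<open>The size of \<open>P\<close> enters twice, through the norm of the surface term
    and through the pair sum. Hence the surface bound is squared, which gives G^2, the exponent 2 D
    and a second factor |\<partial>X|; the denominator C_\<xi> is inside \<open>e\<close>.\<close>
  moreover have "N * (real (card P) * nX) * e * inter_sum P (\<Lambda> - Y)
      \<le> N * nX * e * \<xi> (real \<rho>) * nF * (G\<^sup>2 * rpow (real \<rho>) (2 * D) * b\<^sup>2)"
  proof -
    have nn: "0 \<le> nX" "0 \<le> nF" "0 \<le> \<xi> (real \<rho>)" using xi_pos by (auto simp: nX_def nF_def less_imp_le)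
    have "N * (real (card P) * nX) * e * inter_sum P (\<Lambda> - Y)
        \<le> N * (real (card P) * nX) * e * (real (card P) * (\<xi> (real \<rho>) * nF))"
      unfolding P_def Y_def nF_def using e nn finP
      by (intro mult_left_mono inter_sum_surface_le) (auto simp: \<rho>_def P_def)
    also have "\<dots> = N * nX * e * \<xi> (real \<rho>) * nF * (real (card P))\<^sup>2"
      by (simp add: power2_eq_square)
    also have "\<dots> \<le> N * nX * e * \<xi> (real \<rho>) * nF * (G * rpow (real \<rho>) D * b)\<^sup>2"
      using surface X_fin e nn by (intro mult_left_mono power_mono) (auto simp: P_def b_def)
    finally show ?thesis by (simp add: power_mult_distrib rpow_double)
  qed
  ultimately have "opnorm dm \<Lambda> ?M
      \<le> \<bar>t - s\<bar> * (N * (2 * (b * zeta \<xi> \<rho> * nF))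
          + N * nX * e * \<xi> (real \<rho>) * nF * (G\<^sup>2 * rpow (real \<rho>) (2 * D) * b\<^sup>2))"
    by (smt (verit) abs_ge_zero mult_left_mono)
  then show ?thesis
    unfolding \<rho>_def[symmetric] nF_def[symmetric] nX_def[symmetric] b_def[symmetric] e_def
    by (simp add: algebra_simps power2_eq_square)
qed

end
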